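(* Consider the recommendation model with $T$ agents and $m\ge 2$ arms, arm set $\mathcal A=\{1,\ldots,m\}$, described in the context, with homogeneous opportunity costs $c_t=c_*\in(0,1)$, $t\ge 1$, known to the designer. Suppose that the expected reward $\mu_1$ of arm $1$ is known to the designer and satisfies $\mu_1>c_*$. Suppose that $\lambda,\theta_\tau,k$ are chosen such that $$0<\lambda\le \tfrac34(\mu_1-c_* ),\qquad \theta_\tau=\frac{4m^2}{\tau\cdot\min_{i\in\mathcal A}\mathbb P(\mu_i-c_*\ge\tau)}\ \text{ with }\tau\in(0,1-c_* ),$$ $$k\ \ge\ \max\left\{\frac{9}{2\lambda^2}\ln\left(\frac{20m}{\lambda}\right),\ \theta_\tau^2\ln(T\theta_\tau)\right\},$$ and let the tolerance levels be $\gamma_t=1$. Then the Adaptive Recommendation Policy (ARP) with these parameters achieves ex-post regret $$R_T\ \le\ L^*+O\left(\sqrt{mT\ln(mT)}\right),$$ where $L^*=L_1+\cdots+L_m$ is the total number of rounds in Step 2 (sampling) of ARP.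
   Context: **Model.** There are $m\ge2$ arms $\mathcal A=\{1,\ldots,m\}$ and $T$ rounds, $[T]=\{1,\ldots,T\}$. When an agent $t$ pulls arm $i$ she receives a stochastic reward $X_{i,t}\in[0,1]$, drawn i.i.d. with mean $\mu_i$. In round $t$, agent $t$ arrives and observes a message $\mathcal E_t$ sent by the designer (information the designer has collected from past agents). The designer then privately recommends an arm $I_t\in\mathcal A$ to agent $t$. The agent chooses $y_t\in\{0,1\}$: $y_t=1$ if she pulls the recommended arm and $y_t=0$ if she ignores the recommendation and pulls no arm; then she leaves (agents may return in later rounds). The designer observes $y_t$, and observes $X_{I_t,t}$ if $y_t=1$. Agent $t$ has an opportunity cost $c_t\in(0,1)$ and chooses $y_t=1$ if and only if the incentive constraint $\mathbb E[X_{I_t,t}\mid I_t=i,\mathcal E_t]\ge c_t$ holds. The probability $\mathbb P(\mu_i-c_*\ge\tau)$ is with respect to the (prior) distribution of $\mu_i$ (e.g. if the prior of $\mu_i$ is uniform on $[0,1]$ it equals $1-c_*-\tau$). Apart from arm $1$, the arms' expected rewards are a priori unknown. **Loss and regret.** The designer's loss is $l(I_t,y_t)=\max_{i\in\mathcal A}\mathbb E[X_{i,t}-X_{I_t,t}\cdot y_t]$, where the expectation is over randomized recommendations and stochastic rewards, and the regret is $$R_T=\sum_{t=1}^Tl(I_t,y_t)-\min_{i\in\mathcal A}\sum_{t=1}^Tl(i,y_t).$$ **Fairness data.** Agent $t$ has context $(\alpha_t,\beta_t)$: $\alpha_t$ is the number of her visits up to but not including round $t$, and $\beta_t$ is the number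 of those visits in which she followed the recommendation but received a reward worse than her opportunity cost. $\gamma_t\in[0,1]$ is her tolerance level, known to the designer. $\mathcal H(t)$ denotes the condition $\frac{\beta_t+1}{\alpha_t+1}\le\gamma_t$. **Adaptive Recommendation Policy (ARP).** $U_1,U_2,\ldots$ are independent and uniform on $[0,1)$. *Step 1 (Input).* Arm set $\mathcal A$ and parameters $\lambda,\theta_\tau,k>0$. *Step 2 (Sampling), stages $i=1,\ldots,m$; $L_i$ is the number of rounds of stage $i$.* Stage $1$: for $t=1,\ldots,k$ send $\mathcal E_t=\{\mu_1>c_*\}\cup\{\text{exploration rate at time } t \text{ is } 0\}$ and recommend arm $1$; $L_1=k$; $\hat\mu_1^k=\frac1k\sum_{s=1}^kX_{1,s}$. Stage $i>1$ (rounds $\sum_{j=1}^{i-1}L_j+1\le t\le\sum_{j=1}^iL_j$): let $a_i^*=\arg\max_{1\le j\le i-1}\hat\mu_j^k$ (ties broken randomly), let $$\widehat M_i=\frac{1}{\sum_{j=1}^{i-1}L_j}\sum_{s=1}^{L_1+\cdots+L_{i-1}}X_{I_s,s}\,y_s,$$ $$p_{i,t}=\frac{\lambda}{2(c_*-\widehat M_i)+\lambda}\mathbf 1\{\widehat M_i<c_*\}+\mathbf 1\{\widehat M_i\ge c_*\},\quad p_{a_i^*,t}=1-p_{i,t},\quad p_{j,t}=0\ \ (j\notin\{a_i^*,i\}).$$ Send the message $\mathcal E_t=\{\mu_1>c_*\}\cup\{\text{exploration rate }p_{i,t}\}\cup\{X_{I_s,s}:y_s=1,\ 1\le s\le\sum_{j=1}^{i-1}L_j\}$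 (the identities of the previously recommended arms are not disclosed), and recommend $$I_t=\sum_{j\in\{a_i^*,i\}}j\cdot\mathbf 1\Big\{U_t\in\Big[\sum_{s=1}^{j-1}p_{s,t},\sum_{s=1}^{j}p_{s,t}\Big)\Big\}\cdot\mathbf 1\{\mathcal H(t)\text{ holds}\}+a_i^*\cdot\mathbf 1\{\mathcal H(t)\text{ fails}\}.$$ Stage $i$ ends once arm $i$ has been recommended $k$ times and its $k$ rewards collected; $\hat\mu_i^k$ is the mean of these $k$ rewards. *Step 3 (Exploration).* From now on the message is $\mathcal E_t=\{k\text{ rewards that were collected for each arm }i\in\mathcal A\}$. Initialize $\mathcal B=\mathcal A$, $q=k$. While $|\mathcal B|>1$: let $\hat\mu_i^q$ be the mean reward of arm $i$ based on $q$ rewards, $\hat\mu_*^q=\max_{i\in\mathcal B}\hat\mu_i^q$; permanently eliminate from $\mathcal B$ all arms except those with $\hat\mu_i^q+\sqrt{\frac{\ln(T\theta_\tau)}{2q}}\ge\max\{\hat\mu_*^q,c_*\}$; recommend each arm $i\in\mathcal B$, in increasing order, to the next $|\mathcal B|$ agents, collecting one new reward per arm; set $q=q+1$. *Step 4 (Exploitation).* Recommend the single arm left in $\mathcal B$ to all remaining agents. *)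

theory Defs
  imports "HOL-Probability.Probability"
begin

text \<open>
  Arms are \<open>1, \<dots>, m\<close> and rounds are \<open>1, \<dots>, T\<close>.  Index \<open>0\<close> is never used for either.
\<close>

record setting =
  arms :: nat                                \<comment> \<open>\<open>m\<close>\<close>
  horizon :: nat                             \<comment> \<open>\<open>T\<close>\<close>
  cost :: "nat \<Rightarrow> real"                      \<comment> \<open>\<open>c\<^sub>t\<close>\<close>
  cstar :: real                              \<comment> \<open>the cost level \<open>c\<^sub>*\<close> the designer works with\<close>
  agent :: "nat \<Rightarrow> nat"                      \<comment> \<open>identity of the agent arriving in round \<open>t\<close>; agents may return\<close>
  tol :: "nat \<Rightarrow> real"                       \<comment> \<open>\<open>\<gamma>\<^sub>t\<close>\<close>
  lam :: real                                \<comment> \<open>\<open>\<lambda>\<close>\<close>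
  theta :: real                              \<comment> \<open>\<open>\<theta>\<^sub>\<tau>\<close>\<close>
  samples :: nat                             \<comment> \<open>\<open>k\<close>\<close>
  prior :: "(nat \<Rightarrow> real measure) measure"   \<comment> \<open>common prior on environments\<close>


section \<open>Environments and randomness\<close>

text \<open>
  An environment assigns to every arm a reward distribution on \<open>[0,1]\<close>.  The prior is an arbitrary
  joint law on environments; it induces the prior law of the vector of means.
\<close>

definition unit_interval :: "real measure" where
  "unit_interval = restrict_space borel {0..1}"

definition env_space :: "nat \<Rightarrow> (nat \<Rightarrow> real measure) measure" where
  "env_space m = PiM {1..m} (\<lambda>_. prob_algebra unit_interval)"

definition mean :: "(nat \<Rightarrow> real measure) \<Rightarrow> nat \<Rightarrow> real" where
  "mean \<nu> i = (\<integral>x. x \<partial>(\<nu> i))"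

definition uniform01 :: "real measure" where
  "uniform01 = restrict_space lborel {0..<1}"

text \<open>
  Everything random besides the environment: the rewards \<open>x (i, t) = X\<^sub>i\<^sub>,\<^sub>t\<close>, the uniform variables
  \<open>u t = U\<^sub>t\<close> of the policy, and further uniform variables \<open>v i\<close> which break the ties in the
  choice of \<open>a\<^sub>i\<^sup>*\<close>.
\<close>

type_synonym rewards = "nat \<times> nat \<Rightarrow> real"
type_synonym noise = "rewards \<times> (nat \<Rightarrow> real) \<times> (nat \<Rightarrow> real)"
type_synonym point = "(nat \<Rightarrow> real measure) \<times> noise"

definition noise_space :: "setting \<Rightarrow> noise measure" where
  "noise_space S = PiM ({1..arms S} \<times> UNIV) (\<lambda>_. unit_interval) \<Otimes>\<^sub>M
     (PiM UNIV (\<lambda>_. uniform01) \<Otimes>\<^sub>M PiM UNIV (\<lambda>_. uniform01))"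

definition point_space :: "setting \<Rightarrow> point measure" where
  "point_space S = env_space (arms S) \<Otimes>\<^sub>M noise_space S"

text \<open>The ex-post law, given the environment, and the law under which the agents reason.\<close>

definition ex_post :: "setting \<Rightarrow> (nat \<Rightarrow> real measure) \<Rightarrow> noise measure" where
  "ex_post S \<nu> = PiM ({1..arms S} \<times> UNIV) (\<lambda>(i, t). \<nu> i) \<Otimes>\<^sub>M
     (PiM UNIV (\<lambda>_. uniform01) \<Otimes>\<^sub>M PiM UNIV (\<lambda>_. uniform01))"

definition joint :: "setting \<Rightarrow> point measure" where
  "joint S = prior S \<bind> (\<lambda>\<nu>. ex_post S \<nu> \<bind> (\<lambda>\<omega>. return (point_space S) (\<nu>, \<omega>)))"


section \<open>The policy\<close>

text \<open>
  States are purely combinatorial; rewards are looked up in \<open>x\<close>.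
  \<^item> \<open>Sampling i a n\<close>: stage \<open>i\<close> of the sampling step, \<open>a = a\<^sub>i\<^sup>*\<close>, and
    \<open>n = L\<^sub>1 + \<dots> + L\<^bsub>i-1\<^esub>\<close> rounds were played before the stage (\<open>a\<close> is irrelevant for \<open>i = 1\<close>).
  \<^item> \<open>Exploring B q js\<close>: exploration with surviving arms \<open>B\<close> (increasing) and counter \<open>q\<close>; the arms
    \<open>js\<close> still have to be recommended before \<open>q\<close> is increased.
  \<^item> \<open>Exploiting j\<close>: arm \<open>j\<close> is recommended for ever.

  The second component of a state lists those pairs (arm, round) whose rewards enter the estimates:
  the \<open>k\<close> rewards of arm \<open>i\<close> from stage \<open>i\<close>, and then its rewards from exploration.  Rewards
  of \<open>a\<^sub>i\<^sup>*\<close> in stage \<open>i\<close> do not enter.  The third component lists \<open>(I\<^sub>s, y\<^sub>s)\<close> for all past rounds.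
\<close>

datatype phase =
    Sampling nat nat nat
  | Exploring "nat list" nat "nat list"
  | Exploiting nat

type_synonym history = "(nat \<times> bool) list"
type_synonym state = "phase \<times> (nat \<times> nat) list \<times> history"

definition rounds_of :: "(nat \<times> nat) list \<Rightarrow> nat \<Rightarrow> nat list" where
  "rounds_of used i = map snd (filter (\<lambda>p. fst p = i) used)"

definition arm_mean :: "rewards \<Rightarrow> (nat \<times> nat) list \<Rightarrow> nat \<Rightarrow> nat \<Rightarrow> real" where
  "arm_mean x used i q = (\<Sum>s\<leftarrow>take q (rounds_of used i). x (i, s)) / real q"

definition rec_arm :: "history \<Rightarrow> nat \<Rightarrow> nat" where
  "rec_arm h s = fst (h ! (s - 1))"

definition followed :: "history \<Rightarrow> nat \<Rightarrow> bool" where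
  "followed h s = snd (h ! (s - 1))"

definition visits :: "setting \<Rightarrow> nat \<Rightarrow> nat set" where
  "visits S t = {s \<in> {1..<t}. agent S s = agent S t}"

definition fair :: "setting \<Rightarrow> rewards \<Rightarrow> history \<Rightarrow> nat \<Rightarrow> bool" where
  "fair S x h t =
     (let \<alpha> = card (visits S t);
          \<beta> = card {s \<in> visits S t. followed h s \<and> x (rec_arm h s, s) < cost S s}
      in (real \<beta> + 1) / (real \<alpha> + 1) \<le> tol S t)"

definition past_mean :: "rewards \<Rightarrow> history \<Rightarrow> nat \<Rightarrow> real" where
  "past_mean x h n = (\<Sum>s = 1..n. x (rec_arm h s, s) * of_bool (followed h s)) / real n"

definition rate :: "setting \<Rightarrow> rewards \<Rightarrow> history \<Rightarrow> nat \<Rightarrow> real" where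
  "rate S x h n =
     (let M = past_mean x h n
      in if M < cstar S then lam S / (2 * (cstar S - M) + lam S) else 1)"

definition arm_prob :: "setting \<Rightarrow> rewards \<Rightarrow> history \<Rightarrow> nat \<Rightarrow> nat \<Rightarrow> nat \<Rightarrow> nat \<Rightarrow> real" where
  "arm_prob S x h i a n j =
     (if j = i then rate S x h n else if j = a then 1 - rate S x h n else 0)"

definition recommend :: "setting \<Rightarrow> rewards \<Rightarrow> (nat \<Rightarrow> real) \<Rightarrow> state \<Rightarrow> nat" where
  "recommend S x u = (\<lambda>(ph, used, h). let t = length h + 1 in
     case ph of
       Sampling i a n \<Rightarrow>
         if i = 1 then 1
         else if fair S x h t then
           (\<Sum>j\<in>{a, i}. j * of_bool (u t \<in> {(\<Sum>s = 1..<j. arm_prob S x h i a n s) ..<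
                                              (\<Sum>s = 1..j. arm_prob S x h i a n s)}))
         else a
     | Exploring B q js \<Rightarrow> hd js
     | Exploiting j \<Rightarrow> j)"

text \<open>\<open>a\<^sub>i\<^sup>*\<close>, drawn uniformly from the maximizers by means of \<open>v i\<close>.\<close>

definition best_arm :: "setting \<Rightarrow> rewards \<Rightarrow> (nat \<Rightarrow> real) \<Rightarrow> nat \<Rightarrow> (nat \<times> nat) list \<Rightarrow> nat" where
  "best_arm S x v i used =
     (let J = {j \<in> {1..<i}. \<forall>l\<in>{1..<i}. arm_mean x used l (samples S) \<le> arm_mean x used j (samples S)}
      in sorted_list_of_set J ! nat \<lfloor>v i * real (card J)\<rfloor>)"

text \<open>
  One test of the exploration loop and, if it succeeds, the elimination.  If no arm at all survives,
  the designer falls back on arm \<open>1\<close>, which is known to be better than the opportunity cost.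
\<close>

definition explore :: "setting \<Rightarrow> rewards \<Rightarrow> (nat \<times> nat) list \<Rightarrow> nat list \<Rightarrow> nat \<Rightarrow> phase" where
  "explore S x used B q =
     (if length B > 1 then
        let best = Max ((\<lambda>i. arm_mean x used i q) ` set B);
            B' = filter (\<lambda>i. arm_mean x used i q
                   + sqrt (ln (real (horizon S) * theta S) / (2 * real q)) \<ge> max best (cstar S)) B
        in if B' = [] then Exploiting 1 else Exploring B' q B'
      else Exploiting (hd B))"

definition enter_stage ::
  "setting \<Rightarrow> rewards \<Rightarrow> (nat \<Rightarrow> real) \<Rightarrow> nat \<Rightarrow> (nat \<times> nat) list \<Rightarrow> history \<Rightarrow> phase" where
  "enter_stage S x v i used h =
     (if i \<le> arms S then Sampling i (best_arm S x v i used) (length h)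
      else explore S x used [1..<arms S + 1] (samples S))"

text \<open>
  The transition after a round with recommendation \<open>I\<close> and decision \<open>y\<close>.  Stage \<open>1\<close> consists of
  exactly \<open>k\<close> rounds.  In exploration an arm is recommended to successive agents until one of them
  follows, so that one new reward per arm is collected.
\<close>

definition update ::
  "setting \<Rightarrow> rewards \<Rightarrow> (nat \<Rightarrow> real) \<Rightarrow> nat \<Rightarrow> bool \<Rightarrow> state \<Rightarrow> state" where
  "update S x v I y = (\<lambda>(ph, used, h). let t = length h + 1; h' = h @ [(I, y)] in
     case ph of
       Sampling i a n \<Rightarrow>
         let used' = (if I = i \<and> (i = 1 \<or> y) then used @ [(I, t)] else used)
         in (if length (rounds_of used' i) = samples S then enter_stage S x v (i + 1) used' h' else ph,
             used', h')
     | Exploring B q js \<Rightarrow>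
         if y then
           let used' = used @ [(I, t)]
           in (if tl js = [] then explore S x used' B (q + 1) else Exploring B q (tl js), used', h')
         else (ph, used, h')
     | Exploiting j \<Rightarrow> (ph, used, h'))"


section \<open>Messages and the decisions of the agents\<close>

text \<open>
  \<open>Sampling_msg b p f\<close>: truth value of \<open>\<mu>\<^sub>1 > c\<^sub>*\<close>, exploration rate, and the rewards \<open>f s\<close>
  collected in the rounds \<open>s\<close> of earlier stages, without the arms.
  \<open>Collected_msg g\<close>: the \<open>k\<close> rewards \<open>g i 0, \<dots>, g i (k - 1)\<close> of every arm \<open>i\<close>.
\<close>

datatype message =
    Sampling_msg bool real "nat \<Rightarrow> real option"
  | Collected_msg "nat \<Rightarrow> nat \<Rightarrow> real"

definition message_space :: "message measure" where
  "message_space = sigma UNIV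
     ({{Sampling_msg b p f |p f. p \<in> A} |b A. A \<in> sets borel} \<union>
      {{Sampling_msg b p f |b p f. f s \<in> Some ` A} |s A. A \<in> sets borel} \<union>
      {{Collected_msg g |g. g i n \<in> A} |i n A. A \<in> sets borel})"

definition message :: "setting \<Rightarrow> (nat \<Rightarrow> real measure) \<Rightarrow> rewards \<Rightarrow> state \<Rightarrow> message" where
  "message S \<nu> x = (\<lambda>(ph, used, h).
     case ph of
       Sampling i a n \<Rightarrow>
         Sampling_msg (mean \<nu> 1 > cstar S) (if i = 1 then 0 else rate S x h n)
           (\<lambda>s. if s \<in> {1..n} \<and> followed h s then Some (x (rec_arm h s, s)) else None)
     | _ \<Rightarrow>
         Collected_msg (\<lambda>i j. if i \<in> {1..arms S} \<and> j < samples S then x (i, rounds_of used i ! j) else 0))"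

text \<open>
  Below, \<open>st\<close> is the random state just before round \<open>t\<close>.  The agent compares the conditional
  expectation of \<open>X\<^bsub>I\<^sub>t, t\<^esub>\<close> given the recommendation and the message with her cost.
\<close>

definition recommendation :: "setting \<Rightarrow> (point \<Rightarrow> state) \<Rightarrow> point \<Rightarrow> nat" where
  "recommendation S st = (\<lambda>(\<nu>, x, u, v). recommend S x u (st (\<nu>, x, u, v)))"

definition info :: "setting \<Rightarrow> (point \<Rightarrow> state) \<Rightarrow> point measure" where
  "info S st = vimage_algebra (space (point_space S))
     (\<lambda>(\<nu>, x, u, v). (recommendation S st (\<nu>, x, u, v), message S \<nu> x (st (\<nu>, x, u, v))))
     (count_space UNIV \<Otimes>\<^sub>M message_space)"

definition decision :: "setting \<Rightarrow> nat \<Rightarrow> (point \<Rightarrow> state) \<Rightarrow> point \<Rightarrow> bool" where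
  "decision S t st = (\<lambda>\<omega>.
     real_cond_exp (joint S) (info S st)
       (\<lambda>(\<nu>, x, u, v). x (recommendation S st (\<nu>, x, u, v), t)) \<omega> \<ge> cost S t)"

text \<open>\<open>arp S t\<close> is the random state of the policy after \<open>t\<close> rounds.\<close>

primrec arp :: "setting \<Rightarrow> nat \<Rightarrow> point \<Rightarrow> state" where
  "arp S 0 = (\<lambda>_. (Sampling 1 1 0, [], []))"
| "arp S (Suc t) = (\<lambda>(\<nu>, x, u, v).
     update S x v (recommendation S (arp S t) (\<nu>, x, u, v))
       (decision S (Suc t) (arp S t) (\<nu>, x, u, v)) (arp S t (\<nu>, x, u, v)))"

definition arp_I :: "setting \<Rightarrow> nat \<Rightarrow> point \<Rightarrow> nat" where
  "arp_I S t = recommendation S (arp S (t - 1))"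

definition arp_y :: "setting \<Rightarrow> nat \<Rightarrow> point \<Rightarrow> bool" where
  "arp_y S t = decision S t (arp S (t - 1))"


section \<open>Regret\<close>

text \<open>\<open>l(J, y\<^sub>t)\<close> in round \<open>t\<close> for a possibly random arm \<open>J\<close>, given the environment \<open>\<nu>\<close>.\<close>

definition loss :: "setting \<Rightarrow> (nat \<Rightarrow> real measure) \<Rightarrow> nat \<Rightarrow> (point \<Rightarrow> nat) \<Rightarrow> real" where
  "loss S \<nu> t J =
     Max ((\<lambda>i. \<integral>\<omega>. fst \<omega> (i, t) - fst \<omega> (J (\<nu>, \<omega>), t) * of_bool (arp_y S t (\<nu>, \<omega>)) \<partial>(ex_post S \<nu>))
          ` {1..arms S})"

definition regret :: "setting \<Rightarrow> (nat \<Rightarrow> real measure) \<Rightarrow> real" where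
  "regret S \<nu> =
     (\<Sum>t = 1..horizon S. loss S \<nu> t (arp_I S t))
     - Min ((\<lambda>i. \<Sum>t = 1..horizon S. loss S \<nu> t (\<lambda>_. i)) ` {1..arms S})"

definition stage_length :: "setting \<Rightarrow> nat \<Rightarrow> point \<Rightarrow> nat" where
  "stage_length S i \<omega> = card {t \<in> {1..horizon S}. \<exists>a n. fst (arp S (t - 1) \<omega>) = Sampling i a n}"

definition sampling_length :: "setting \<Rightarrow> point \<Rightarrow> nat" where
  "sampling_length S \<omega> = (\<Sum>i = 1..arms S. stage_length S i \<omega>)"

definition expected_sampling_length :: "setting \<Rightarrow> (nat \<Rightarrow> real measure) \<Rightarrow> real" where
  "expected_sampling_length S \<nu> = (\<integral>\<omega>. real (sampling_length S (\<nu>, \<omega>)) \<partial>(ex_post S \<nu>))"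

end

theory Submission
  imports Defs "HOL-Probability.Hoeffding"
begin

text \<open>
  The regret equals the expected sum of \<open>(\<mu>\<^sub>* - \<mu>\<^bsub>I\<^sub>t\<^esub>) y\<^sub>t\<close>, because \<open>y\<^sub>t\<close> and \<open>I\<^sub>t\<close> are independent of
  the rewards of round \<open>t\<close>.  So rounds in which the recommendation is ignored cost nothing, the
  rounds of the sampling step contribute at most \<open>L\<^sup>*\<close>, and successive elimination remains.

  The elimination radius \<open>sqrt (l / (2 q))\<close>, \<open>l = ln (T \<theta>)\<close>, compares the empirical means of two arms,
  so that a single comparison fails with a probability of order \<open>exp (- l / 2) = (T \<theta>)\<^sup>-\<^sup>1\<^sup>/\<^sup>2\<close>, and a union
  bound over all \<open>q \<le> T\<close> is too weak.  Ville's inequality on a geometric grid of slopes shows that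
  an arm with gap \<open>\<Delta>\<close> eliminates the best arm with probability at most of order \<open>exp (- l / 2) / \<Delta>\<close>.
  If this happens, the leader of that moment takes over the role of the best arm at a cost of
  \<open>\<Delta>\<close> per round.  That a leader is later eliminated by a worse arm is again improbable,
  conditionally on its take-over, because it starts with an empirical advantage; the probability of
  both events is of order \<open>1 / T\<close> up to logarithms and powers of \<open>m\<close>, and \<open>m\<^sup>4 \<le> \<theta>\<^sup>2 \<le> k \<le> T\<close>.
\<close>

section \<open>Probability spaces and the decisions\<close>

text \<open>A conditional expectation is determined only up to null sets of the joint law, while the
  regret is evaluated at one environment, which may be null under the prior. What does hold at every
  point is measurability with respect to the information of the agent: a decision is a function of
  recommendation and message, and both are determined by the tapes and the rewards of earlier
  rounds. In this form, as predictability of \<open>fol\<close>, the decisions enter the estimates.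
  Ignored recommendations advance the clock without adding a sample. The concentration bounds
  therefore run over rounds but are normalized by collected rewards, and the regret of exploration
  is summed against the number of collected rewards. A first failure of order exp (- l / 2) /
  \<Delta> is paid at \<Delta> per round: the gap cancels, and T m exp (- l / 2) remains, which is
  of order sqrt T because theta >= 4 m^2. For a second failure, the union over take-over times is
  paid by the expected number of take-overs, at most m times the probability that one occurs, and
  not by T.\<close>

instance phase :: countable by countable_datatype

lemma space_unit_interval [simp]: "space unit_interval = {0..1}"
  by (simp add: unit_interval_def space_restrict_space)

lemma space_uniform01 [simp]: "space uniform01 = {0..<1}"
  by (simp add: uniform01_def space_restrict_space)

lemma measurable_unit_interval_id [measurable]: "(\<lambda>x. x) \<in> borel_measurable unit_interval"
  unfolding unit_interval_def by (rule measurable_restrict_space1) simp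

lemma measurable_uniform01_id [measurable]: "(\<lambda>x. x) \<in> borel_measurable uniform01"
  unfolding uniform01_def by (rule measurable_restrict_space1) simp

lemma prob_space_uniform01: "prob_space uniform01"
  by (rule prob_spaceI) (simp add: uniform01_def emeasure_restrict_space space_restrict_space)

definition reward_law :: "nat \<Rightarrow> (nat \<Rightarrow> real measure) \<Rightarrow> rewards measure" where
  "reward_law m \<nu> = PiM ({1..m} \<times> UNIV) (\<lambda>(i, t). \<nu> i)"

definition tape_law :: "((nat \<Rightarrow> real) \<times> (nat \<Rightarrow> real)) measure" where
  "tape_law = PiM UNIV (\<lambda>_. uniform01) \<Otimes>\<^sub>M PiM UNIV (\<lambda>_. uniform01)"

lemma ex_post_alt: "ex_post S \<nu> = reward_law (arms S) \<nu> \<Otimes>\<^sub>M tape_law"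
  by (simp add: ex_post_def reward_law_def tape_law_def)

lemma prob_space_tape_law: "prob_space tape_law"
  unfolding tape_law_def
  by (intro prob_space_pair prob_space_PiM prob_space_uniform01)

text \<open>The version of the conditional expectation is measurable for the sigma-algebra pulled
  back along (recommendation, message). Singletons are Borel, so each level set is a preimage under
  this map; the decision is thus constant on its fibers at every point, not only almost
  everywhere.\<close>

lemma decision_fiber:
  assumes "\<omega> \<in> space (point_space S)" "\<omega>' \<in> space (point_space S)"
    and "recommendation S st \<omega> = recommendation S st \<omega>'"
    and "message S (fst \<omega>) (fst (snd \<omega>)) (st \<omega>) = message S (fst \<omega>') (fst (snd \<omega>')) (st \<omega>')"
  shows "decision S t st \<omega> = decision S t st \<omega>'"
proof -
  let ?f = "\<lambda>(\<nu>, x, u, v). (recommendation S st (\<nu>, x, u, v), message S \<nu> x (st (\<nu>, x, u, v)))"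
  let ?N = "count_space UNIV \<Otimes>\<^sub>M message_space"
  let ?h = "real_cond_exp (joint S) (info S st) (\<lambda>(\<nu>, x, u, v). x (recommendation S st (\<nu>, x, u, v), t))"
  have sp: "space ?N = UNIV"
    by (simp add: space_pair_measure message_space_def space_measure_of_conv)
  have f: "?f \<omega> = ?f \<omega>'"
    using assms(3,4) by (auto simp: split_beta)
  have h: "?h \<in> borel_measurable (info S st)" by measurable
  have [simp]: "space (info S st) = space (point_space S)"
    by (simp add: info_def)
  have "?h -` {?h \<omega>} \<inter> space (point_space S) \<in> sets (info S st)"
    using measurable_sets[OF h, of "{?h \<omega>}"] by simp
  then obtain A where "?h -` {?h \<omega>} \<inter> space (point_space S) = ?f -` A \<inter> space (point_space S)"
    unfolding info_def by (subst (asm) sets_vimage_algebra2) (auto simp: sp)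
  then have "?h \<omega> = ?h \<omega>'"
    using f assms(1,2) by (metis (no_types, lifting) IntD1 IntI singletonD singletonI vimage_eq)
  then show ?thesis
    by (simp add: decision_def)
qed

locale arp_model =
  fixes S :: setting and \<nu> :: "nat \<Rightarrow> real measure"
  assumes prior: "prior S \<in> space (prob_algebra (env_space (arms S)))"
    and \<nu>: "\<nu> \<in> space (env_space (arms S))"
    and tol: "\<And>t. 1 \<le> t \<Longrightarrow> tol S t = 1"
    and samples_pos: "0 < samples S"
    and arms_pos: "1 \<le> arms S"
begin

abbreviation M :: "noise measure" where "M \<equiv> ex_post S \<nu>"

definition st :: "nat \<Rightarrow> noise \<Rightarrow> state" where
  "st t \<omega> = arp S t (\<nu>, \<omega>)"

lemma sets_\<nu>: "i \<in> {1..arms S} \<Longrightarrow> sets (\<nu> i) = sets unit_interval"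
  and prob_space_\<nu>: "i \<in> {1..arms S} \<Longrightarrow> prob_space (\<nu> i)"
  using \<nu> by (auto simp: env_space_def space_PiM PiE_iff space_prob_algebra)

lemma space_\<nu>: "i \<in> {1..arms S} \<Longrightarrow> space (\<nu> i) = {0..1}"
  using sets_eq_imp_space_eq[OF sets_\<nu>] by simp

lemma measurable_id_\<nu>: "i \<in> {1..arms S} \<Longrightarrow> (\<lambda>z. z) \<in> borel_measurable (\<nu> i)"
  using measurable_unit_interval_id measurable_cong_sets[OF sets_\<nu> refl] by blast

lemma prob_space_reward_law: "prob_space (reward_law (arms S) \<nu>)"
  unfolding reward_law_def by (rule prob_space_PiM) (auto intro!: prob_space_\<nu>)

lemma prob_space_M: "prob_space M"
  unfolding ex_post_alt by (intro prob_space_pair prob_space_reward_law prob_space_tape_law)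

sublocale prob_space M by (rule prob_space_M)

lemma sets_M: "sets M = sets (noise_space S)"
  unfolding ex_post_def noise_space_def
  by (intro sets_pair_measure_cong sets_PiM_cong) (auto simp: sets_\<nu>)

lemma space_M: "space M = space (noise_space S)"
  using sets_M by (rule sets_eq_imp_space_eq)

lemma space_M_iff:
  "(x, u, v) \<in> space M \<longleftrightarrow>
     x \<in> ({1..arms S} \<times> UNIV) \<rightarrow>\<^sub>E {0..1} \<and> range u \<subseteq> {0..<1} \<and> range v \<subseteq> {0..<1}"
  by (auto simp: space_M noise_space_def space_pair_measure space_PiM)

lemma sets_joint: "sets (joint S) = sets (point_space S)"
proof -
  have ne: "space (prior S) \<noteq> {}"
    using prior by (auto simp: space_prob_algebra prob_space.not_empty)
  have sp: "space (prior S) = space (env_space (arms S))"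
    using prior by (auto simp: space_prob_algebra dest: sets_eq_imp_space_eq)
  show ?thesis
    unfolding joint_def
  proof (rule sets_bind[OF _ ne])
    fix \<nu>' assume "\<nu>' \<in> space (prior S)"
    \<comment> \<open>Every environment in the space of the prior satisfies the assumptions of the
      locale, so its noise space is non-empty, as \<open>sets_bind\<close> demands.\<close>
    then interpret E: arp_model S \<nu>'
      using prior tol samples_pos arms_pos by unfold_locales (auto simp: sp)
    show "sets (ex_post S \<nu>' \<bind> (\<lambda>\<omega>. return (point_space S) (\<nu>', \<omega>))) = sets (point_space S)"
      by (rule sets_bind) (auto simp: E.not_empty)
  qed
qed

lemma measurable_decision [measurable]:
  "Measurable.pred M (\<lambda>\<omega>. decision S t f (\<nu>, \<omega>))"
proof -
  have [measurable]: "(\<lambda>\<omega>. (\<nu>, \<omega>)) \<in> measurable M (point_space S)"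
    unfolding point_space_def using \<nu>
    by (intro measurable_Pair) (auto simp: sets_M cong: measurable_cong_sets)
  have "real_cond_exp (joint S) (info S f) h \<in> borel_measurable (point_space S)" for h
    using borel_measurable_cond_exp2 measurable_cong_sets[OF sets_joint refl] by blast
  note [measurable] = this
  show ?thesis unfolding decision_def by measurable
qed

lemma measurable_reward_any [measurable]: "(\<lambda>\<omega>. fst \<omega> p) \<in> borel_measurable M"
proof (cases "fst p \<in> {1..arms S}")
  case True
  then have p: "p \<in> {1..arms S} \<times> UNIV" by (cases p) auto
  have 1: "(\<lambda>\<omega>. fst \<omega> p) \<in> measurable M (case p of (i, t) \<Rightarrow> \<nu> i)"
    unfolding ex_post_alt reward_law_def using p by measurable
  have "sets (case p of (i, t) \<Rightarrow> \<nu> i) = sets unit_interval"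
    using True by (auto simp: sets_\<nu> split: prod.splits)
  then have "(\<lambda>\<omega>. fst \<omega> p) \<in> measurable M unit_interval"
    using 1 measurable_cong_sets by blast
  then show ?thesis
    by (rule measurable_compose) measurable
next
  case False
  then have "p \<notin> {1..arms S} \<times> UNIV" by (cases p) auto
  \<comment> \<open>Points of the product space are extensional: off the index set a coordinate is
    constant.\<close>
  then have "fst \<omega> p = undefined" if "\<omega> \<in> space M" for \<omega>
    using that False by (cases \<omega>; cases p) (auto simp: space_M_iff PiE_def extensional_def)
  then show ?thesis
    by (subst measurable_cong[where g="\<lambda>_. undefined"]) auto
qed

lemma measurable_u [measurable]: "(\<lambda>\<omega>. fst (snd \<omega>) t) \<in> borel_measurable M"
proof -
  have "(\<lambda>\<omega>. fst (snd \<omega>) t) \<in> measurable M uniform01"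
    unfolding ex_post_def by measurable
  then show ?thesis by (rule measurable_compose) measurable
qed

lemma measurable_v [measurable]: "(\<lambda>\<omega>. snd (snd \<omega>) t) \<in> borel_measurable M"
proof -
  have "(\<lambda>\<omega>. snd (snd \<omega>) t) \<in> measurable M uniform01"
    unfolding ex_post_def by measurable
  then show ?thesis by (rule measurable_compose) measurable
qed

text \<open>At tolerance 1 the test reads \<beta> \<le> \<alpha>, and \<beta> counts a subset of the
  visits.\<close>

lemma fair_always: "1 \<le> t \<Longrightarrow> fair S x h t"
proof -
  have "finite (visits S t)" by (simp add: visits_def)
  then have "card {s \<in> visits S t. followed h s \<and> x (rec_arm h s, s) < cost S s} \<le> card (visits S t)"
    by (intro card_mono) auto
  then show "1 \<le> t \<Longrightarrow> fair S x h t"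
    by (simp add: fair_def tol Let_def)
qed

end

section \<open>The states of the policy\<close>

definition num_used :: "(nat \<times> nat) list \<Rightarrow> nat \<Rightarrow> nat" where
  "num_used used i = length (rounds_of used i)"

lemma rounds_of_Nil [simp]: "rounds_of [] i = []"
  by (simp add: rounds_of_def)

lemma rounds_of_snoc [simp]:
  "rounds_of (used @ [(j, t)]) i = (if i = j then rounds_of used i @ [t] else rounds_of used i)"
  by (auto simp: rounds_of_def)

lemma num_used_Nil [simp]: "num_used [] i = 0"
  by (simp add: num_used_def)

lemma num_used_snoc [simp]:
  "num_used (used @ [(j, t)]) i = (if i = j then Suc (num_used used i) else num_used used i)"
  by (auto simp: num_used_def)

lemma set_rounds_of: "set (rounds_of used i) = {s. (i, s) \<in> set used}"
  by (force simp: rounds_of_def)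

lemma arm_mean_cong:
  assumes "\<And>i s. (i, s) \<in> set used \<Longrightarrow> x (i, s) = x' (i, s)"
  shows "arm_mean x used i q = arm_mean x' used i q"
proof -
  have "map (\<lambda>s. x (i, s)) (take q (rounds_of used i)) = map (\<lambda>s. x' (i, s)) (take q (rounds_of used i))"
    using set_take_subset[of q "rounds_of used i"] by (intro map_cong) (auto simp: set_rounds_of assms)
  then show ?thesis unfolding arm_mean_def by (rule arg_cong[where f="\<lambda>l. sum_list l / _"])
qed

lemma best_arm_cong:
  assumes "\<And>i s. (i, s) \<in> set used \<Longrightarrow> x (i, s) = x' (i, s)"
  shows "best_arm S x v i used = best_arm S x' v i used"
  unfolding best_arm_def by (simp add: arm_mean_cong[of used x x', OF assms])

lemma explore_cong:
  assumes "\<And>i s. (i, s) \<in> set used \<Longrightarrow> x (i, s) = x' (i, s)"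
  shows "explore S x used B q = explore S x' used B q"
  unfolding explore_def by (simp add: arm_mean_cong[of used x x', OF assms])

text \<open>The set of maximizers is non-empty, and v i < 1 keeps the index strictly below its
  cardinality, so \<open>!\<close> is applied within range.\<close>

lemma best_arm_mem:
  assumes "1 < i" "0 \<le> v i" "v i < 1"
  shows "best_arm S x v i used \<in> {1..<i}"
proof -
  let ?f = "\<lambda>l. arm_mean x used l (samples S)"
  let ?J = "{j \<in> {1..<i}. \<forall>l\<in>{1..<i}. ?f l \<le> ?f j}"
  have "\<exists>j\<in>{1..<i}. \<forall>l\<in>{1..<i}. ?f l \<le> ?f j"
  proof -
    have "Max (?f ` {1..<i}) \<in> ?f ` {1..<i}"
      using assms(1) by (intro Max_in) auto
    then obtain j where "j \<in> {1..<i}" "Max (?f ` {1..<i}) = ?f j" by auto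
    then show ?thesis
      by (metis (no_types, lifting) Max_ge finite_atLeastLessThan finite_imageI imageI)
  qed
  then have "?J \<noteq> {}" by blast
  then have c: "0 < card ?J" by (simp add: card_gt_0_iff)
  then have "v i * real (card ?J) < real (card ?J)"
    using assms(3) by simp
  then have "nat \<lfloor>v i * real (card ?J)\<rfloor> < card ?J"
    using c assms(2) by (simp add: nat_less_iff floor_less_iff)
  then have "sorted_list_of_set ?J ! nat \<lfloor>v i * real (card ?J)\<rfloor> \<in> set (sorted_list_of_set ?J)"
    by (intro nth_mem) simp
  then have "sorted_list_of_set ?J ! nat \<lfloor>v i * real (card ?J)\<rfloor> \<in> ?J"
    by simp
  then show ?thesis
    unfolding best_arm_def Let_def by blast
qed

text \<open>The two intervals of the sampling rule partition \<open>[0,1)\<close> whatever the rate is.\<close>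

lemma recommend_Sampling:
  assumes "fair S x h (length h + 1)" "1 \<le> a" "a < i" "0 \<le> u (length h + 1)" "u (length h + 1) < 1"
  shows "recommend S x u (Sampling i a n, used, h) =
           (if u (length h + 1) < 1 - rate S x h n then a else i)"
proof -
  let ?p = "arm_prob S x h i a n" and ?r = "rate S x h n"
  have z: "(\<Sum>s = 1..<a. ?p s) = 0"
    using assms by (intro sum.neutral) (auto simp: arm_prob_def)
  have "(\<Sum>s\<in>{1..<i}. ?p s) = (\<Sum>s\<in>{a}. ?p s)"
    using assms by (intro sum.mono_neutral_right) (auto simp: arm_prob_def)
  then have i: "(\<Sum>s = 1..<i. ?p s) = 1 - ?r"
    using assms by (simp add: arm_prob_def)
  have "{1..a} = insert a {1..<a}" "{1..i} = insert i {1..<i}" using assms by auto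
  then have "(\<Sum>s = 1..a. ?p s) = 1 - ?r" "(\<Sum>s = 1..i. ?p s) = 1"
    using z i assms by (simp_all add: arm_prob_def)
  then show ?thesis
    using assms z i by (auto simp: recommend_def)
qed

context arp_model
begin

text \<open>The index counts completed rounds: \<open>rec t\<close> and \<open>fol t\<close> belong
  to round t + 1, so both are settled before the reward of that round is drawn.\<close>

definition rec :: "nat \<Rightarrow> noise \<Rightarrow> nat" where
  "rec t \<omega> = recommend S (fst \<omega>) (fst (snd \<omega>)) (st t \<omega>)"

definition fol :: "nat \<Rightarrow> noise \<Rightarrow> bool" where
  "fol t \<omega> = decision S (Suc t) (arp S t) (\<nu>, \<omega>)"

lemma recommendation_arp: "recommendation S (arp S t) (\<nu>, \<omega>) = rec t \<omega>"
  by (simp add: recommendation_def rec_def st_def split_beta)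

lemma st_0: "st 0 \<omega> = (Sampling 1 1 0, [], [])"
  by (simp add: st_def)

lemma st_Suc: "st (Suc t) \<omega> = update S (fst \<omega>) (snd (snd \<omega>)) (rec t \<omega>) (fol t \<omega>) (st t \<omega>)"
  by (cases \<omega>) (simp add: st_def fol_def flip: recommendation_arp)

text \<open>The configuration of the counters in which an elimination test is due: the survivors are
  level, and arms dropped earlier may lag behind.\<close>

definition ready :: "(nat \<times> nat) list \<Rightarrow> nat list \<Rightarrow> nat \<Rightarrow> bool" where
  "ready used B q \<longleftrightarrow> set B \<subseteq> {1..arms S} \<and> distinct B \<and> B \<noteq> [] \<and> samples S \<le> q \<and>
     (\<forall>j\<in>set B. num_used used j = q) \<and>
     (\<forall>j\<in>{1..arms S}. samples S \<le> num_used used j \<and> num_used used j \<le> q)"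

text \<open>Exploration is caught in the middle of a sweep through B: arms still waiting in js have
  q rewards, those already served have one more. In the sampling case, n \<le> t ensures that the
  rate reads past rounds only.\<close>

definition ok_phase :: "nat \<Rightarrow> (nat \<times> nat) list \<Rightarrow> phase \<Rightarrow> bool" where
  "ok_phase t used ph = (case ph of
     Sampling i a n \<Rightarrow> i \<in> {1..arms S} \<and> (1 < i \<longrightarrow> a \<in> {1..<i}) \<and> n \<le> t \<and>
       (\<forall>j\<in>{1..<i}. num_used used j = samples S) \<and> num_used used i < samples S \<and>
       (\<forall>j>i. num_used used j = 0)
   | Exploring B q js \<Rightarrow> set B \<subseteq> {1..arms S} \<and> distinct B \<and> js \<noteq> [] \<and> distinct js \<and>
       set js \<subseteq> set B \<and> samples S \<le> q \<and>
       (\<forall>j\<in>set js. num_used used j = q) \<and> (\<forall>j\<in>set B - set js. num_used used j = Suc q) \<and>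
       (\<forall>j\<in>{1..arms S}. samples S \<le> num_used used j \<and> num_used used j \<le> Suc q)
   | Exploiting j \<Rightarrow> j \<in> {1..arms S} \<and> (\<forall>j\<in>{1..arms S}. samples S \<le> num_used used j))"

definition ok :: "nat \<Rightarrow> state \<Rightarrow> bool" where
  "ok t = (\<lambda>(ph, used, h). length h = t \<and> length used \<le> t \<and>
     (\<forall>p\<in>set used. fst p \<in> {1..arms S} \<and> snd p \<in> {1..t}) \<and> ok_phase t used ph)"

lemma explore_ok:
  assumes "ready used B q"
  shows "ok_phase t used (explore S x used B q)"
proof -
  have "ok_phase t used (Exploring B' q B')"
    if "B' = filter P B" "B' \<noteq> []" for B' P
    using assms that by (auto simp: ok_phase_def ready_def le_Suc_eq)
  moreover have "hd B \<in> {1..arms S}"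
    using assms hd_in_set[of B] unfolding ready_def by blast
  then have "ok_phase t used (Exploiting 1)" "ok_phase t used (Exploiting (hd B))"
    using assms arms_pos by (auto simp: ok_phase_def ready_def)
  ultimately show ?thesis
    by (auto simp: explore_def Let_def)
qed

lemma recommend_ok:
  assumes "ok t \<sigma>" "0 \<le> u (Suc t)" "u (Suc t) < 1"
  shows "recommend S x u \<sigma> \<in> {1..arms S}"
proof -
  obtain ph used h where \<sigma>: "\<sigma> = (ph, used, h)" by (cases \<sigma>)
  show ?thesis
  proof (cases ph)
    case (Sampling i a n)
    then have l: "length h = t" using assms by (simp add: ok_def \<sigma>)
    show ?thesis
    proof (cases "i = 1")
      case True then show ?thesis
        using arms_pos by (simp add: recommend_def \<sigma> Sampling)
    next
      case False
      have "recommend S x u \<sigma> = (if u (length h + 1) < 1 - rate S x h n then a else i)"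
        unfolding \<sigma> Sampling using assms False
        by (intro recommend_Sampling fair_always) (auto simp: ok_def \<sigma> ok_phase_def Sampling)
      then show ?thesis
        using assms False by (auto simp: ok_def \<sigma> ok_phase_def Sampling)
    qed
  next
    case (Exploring B q js)
    then have "set B \<subseteq> {1..arms S}" "js \<noteq> []" "set js \<subseteq> set B"
      using assms by (auto simp: ok_def ok_phase_def \<sigma>)
    then have "hd js \<in> {1..arms S}"
      using hd_in_set by blast
    then show ?thesis
      by (simp add: \<sigma> Exploring recommend_def)
  next
    case (Exploiting j)
    then show ?thesis
      using assms by (simp add: ok_def ok_phase_def \<sigma> recommend_def)
  qed
qed

lemma sampling_ready:
  assumes ph: "ok_phase t used (Sampling (arms S) a n)"
    and used': "used' = used \<or> used' = used @ [(arms S, s)]"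
    and "num_used used' (arms S) = samples S"
  shows "ready used' [1..<arms S + 1] (samples S)"
proof -
  have "num_used used' j = samples S" if "j \<in> {1..arms S}" for j
    using ph assms(2,3) that by (cases "j = arms S") (auto simp: ok_phase_def)
  then show ?thesis using arms_pos by (auto simp: ready_def)
qed

lemma exploring_ready:
  assumes ph: "ok_phase t used (Exploring B q [I])"
  shows "ready (used @ [(I, s)]) B (Suc q)"
proof -
  note E = ph[unfolded ok_phase_def phase.case]
  have B: "set B \<subseteq> {1..arms S}" "distinct B" "samples S \<le> q"
    and "I \<in> set B" and N: "num_used used I = q"
    using E by simp_all
  then have "B \<noteq> []" by auto
  have N': "\<forall>j\<in>set B - {I}. num_used used j = Suc q"
      "\<forall>j\<in>{1..arms S}. samples S \<le> num_used used j \<and> num_used used j \<le> Suc q"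
    using E unfolding list.set by blast+
  note N = N N'
  have "num_used (used @ [(I, s)]) j = Suc q" if "j \<in> set B" for j
    using N that by (cases "j = I") simp_all
  moreover have "samples S \<le> num_used (used @ [(I, s)]) j \<and>
      num_used (used @ [(I, s)]) j \<le> Suc q" if "j \<in> {1..arms S}" for j
    using N B that by (cases "j = I") simp_all
  ultimately show ?thesis
    using B \<open>B \<noteq> []\<close> unfolding ready_def by simp
qed

definition alive :: "phase \<Rightarrow> nat set" where
  "alive ph = (case ph of Sampling i a n \<Rightarrow> {1..arms S} | Exploring B q js \<Rightarrow> set B | Exploiting j \<Rightarrow> {j})"

text \<open>The later arguments distinguish two kinds of rounds only: quiet ones, which leave the
  set of surviving arms unchanged, and those with an elimination test, described by
  \<open>reexplore\<close>.\<close>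

definition quiet :: "phase \<Rightarrow> phase \<Rightarrow> bool" where
  "quiet ph ph' = (case ph of
     Sampling i a n \<Rightarrow> \<exists>i' a' n'. ph' = Sampling i' a' n'
   | Exploring B q js \<Rightarrow> \<exists>js'. ph' = Exploring B q js'
   | Exploiting j \<Rightarrow> ph' = Exploiting j)"

text \<open>The clause \<open>q0 < q\<close> records that every survivor has gained a reward since
  the previous test. A comparison counted from an earlier take-over therefore involves at least one
  new reward.\<close>

definition reexplore :: "rewards \<Rightarrow> (nat \<times> nat) list \<Rightarrow> phase \<Rightarrow> phase \<Rightarrow> bool" where
  "reexplore x used' ph ph' \<longleftrightarrow> (\<exists>B q. ready used' B q \<and> set B = alive ph \<and> ph' = explore S x used' B q \<and>
     (\<forall>j. ph \<noteq> Exploiting j) \<and> (\<forall>B0 q0 js0. ph = Exploring B0 q0 js0 \<longrightarrow> q0 < q))"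

lemma update_step:
  assumes ph: "ok_phase t used ph" and "length h = t" and I: "I = recommend S x u (ph, used, h)"
    and up: "update S x v I y (ph, used, h) = (ph', used', h')"
  shows "quiet ph ph' \<or> reexplore x used' ph ph'"
proof (cases ph)
  case (Sampling i a n)
  define us where "us = (if I = i \<and> (i = 1 \<or> y) then used @ [(I, Suc t)] else used)"
  have up': "update S x v I y (ph, used, h) =
    (if num_used us i = samples S then enter_stage S x v (i + 1) us (h @ [(I, y)])
     else Sampling i a n, us, h @ [(I, y)])"
    using assms(2) by (auto simp: update_def Sampling us_def num_used_def Let_def)
  show ?thesis
  proof (cases "num_used us i = samples S \<and> \<not> i + 1 \<le> arms S")
    case True
    then have "i = arms S" using ph by (auto simp: ok_phase_def Sampling)
    then have "ready us [1..<arms S + 1] (samples S)"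
      using True ph sampling_ready[of t used a n us "Suc t"] by (auto simp: us_def Sampling)
    moreover have "set [1..<arms S + 1] = {1..arms S}" by auto
    ultimately show ?thesis
      using True up up' unfolding reexplore_def
      by (intro disjI2 exI[of _ "[1..<arms S + 1]"] exI[of _ "samples S"])
        (simp add: Sampling alive_def enter_stage_def)
  next
    case False
    then show ?thesis using up up' by (auto simp: quiet_def Sampling enter_stage_def)
  qed
next
  case (Exploring B q js)
  show ?thesis
  proof (cases "y \<and> tl js = []")
    case True
    then have js: "js = [I]"
      using ph by (cases js) (simp_all add: ok_phase_def Exploring I recommend_def)
    have "ready (used @ [(I, Suc t)]) B (Suc q)"
      using ph unfolding Exploring js by (rule exploring_ready)
    then show ?thesis
      using up True assms(2) by (auto simp: reexplore_def Exploring alive_def update_def Let_def)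
  next
    case False
    then show ?thesis using up by (cases y) (auto simp: quiet_def Exploring update_def Let_def)
  qed
next
  case (Exploiting j)
  then show ?thesis using up by (auto simp: quiet_def update_def)
qed

lemma update_ok:
  assumes ok: "ok t \<sigma>" and v: "\<And>i. 0 \<le> v i \<and> v i < 1" and I: "I = recommend S x u \<sigma>"
    and u: "0 \<le> u (Suc t)" "u (Suc t) < 1"
  shows "ok (Suc t) (update S x v I y \<sigma>)"
proof -
  obtain ph used h where \<sigma>: "\<sigma> = (ph, used, h)" by (cases \<sigma>)
  have I_mem: "I \<in> {1..arms S}" using recommend_ok[of t \<sigma> u x] ok u I by simp
  have h: "length h = t" "length used \<le> t" "\<forall>p\<in>set used. fst p \<in> {1..arms S} \<and> snd p \<in> {1..t}"
    and ph: "ok_phase t used ph"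
    using ok by (auto simp: ok_def \<sigma>)
  have used': "\<forall>p\<in>set (used @ [(I, Suc t)]). fst p \<in> {1..arms S} \<and> snd p \<in> {1..Suc t}"
    "\<forall>p\<in>set used. fst p \<in> {1..arms S} \<and> snd p \<in> {1..Suc t}"
    using h(3) I_mem by auto
  show ?thesis
  proof (cases ph)
    case (Sampling i a n)
    define used' where "used' = (if I = i \<and> (i = 1 \<or> y) then used @ [(I, Suc t)] else used)"
    have up: "update S x v I y \<sigma> =
      (if num_used used' i = samples S then enter_stage S x v (i + 1) used' (h @ [(I, y)])
       else Sampling i a n, used', h @ [(I, y)])"
      by (auto simp: update_def \<sigma> Sampling used'_def h(1) num_used_def Let_def)
    have "ok_phase (Suc t) used' (if num_used used' i = samples S
        then enter_stage S x v (i + 1) used' (h @ [(I, y)]) else Sampling i a n)"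
    proof (cases "num_used used' i = samples S")
      case False
      then show ?thesis
        using ph samples_pos by (auto simp: ok_phase_def Sampling used'_def)
    next
      case True
      have a: "\<forall>j\<in>{1..i}. num_used used' j = samples S" "\<forall>j>i. num_used used' j = 0"
      proof -
        have "num_used used' j = num_used used j" if "j \<noteq> i" for j
          using that by (simp add: used'_def)
        then show "\<forall>j\<in>{1..i}. num_used used' j = samples S" "\<forall>j>i. num_used used' j = 0"
          using ph True unfolding ok_phase_def Sampling phase.case
          by (metis atLeastAtMost_iff atLeastLessThan_iff le_neq_implies_less, metis less_irrefl)
      qed
      show ?thesis
      proof (cases "i + 1 \<le> arms S")
        case le: True
        have "best_arm S x v (i + 1) used' \<in> {1..<i + 1}"
          using ph v by (intro best_arm_mem) (auto simp: ok_phase_def Sampling)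
        then show ?thesis
          using True le a samples_pos h(1) by (auto simp: enter_stage_def ok_phase_def)
      next
        case False
        then have "i = arms S" using ph by (auto simp: ok_phase_def Sampling)
        then have "ready used' [1..<arms S + 1] (samples S)"
          using True ph sampling_ready[of t used a n used' "Suc t"] by (auto simp: used'_def Sampling)
        then show ?thesis
          using True False by (auto simp: enter_stage_def intro: explore_ok)
      qed
    qed
    then show ?thesis
      using used' h(1,2) by (auto simp: ok_def up used'_def)
  next
    case (Exploring B q js)
    have Ihd: "I = hd js" by (simp add: I \<sigma> Exploring recommend_def)
    obtain js' where js: "js = I # js'"
      using ph Ihd by (cases js) (auto simp: ok_phase_def Exploring)
    show ?thesis
    proof (cases y)
      case False
      then show ?thesis using ph used' h(1,2)
        by (auto simp: ok_def update_def \<sigma> Exploring ok_phase_def)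
    next
      case True
      show ?thesis
      proof (cases "js' = []")
        case 1: True
        have "ready (used @ [(I, Suc t)]) B (Suc q)"
          using ph unfolding Exploring js 1 by (rule exploring_ready)
        then have "ok_phase (Suc t) (used @ [(I, Suc t)]) (explore S x (used @ [(I, Suc t)]) B (Suc q))"
          by (rule explore_ok)
        then show ?thesis using True h(1,2) used' 1
          by (simp add: ok_def update_def \<sigma> Exploring js Let_def)
      next
        case 2: False
        have "ok_phase (Suc t) (used @ [(I, Suc t)]) (Exploring B q js')"
          using ph 2 by (auto simp: ok_phase_def Exploring js)
        then show ?thesis using True h(1,2) used' 2
          by (simp add: ok_def update_def \<sigma> Exploring js Let_def)
      qed
    qed
  next
    case (Exploiting j)
    then show ?thesis using ph used' h(1,2)
      by (auto simp: ok_def update_def \<sigma> ok_phase_def)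
  qed
qed

lemma uv_range:
  assumes "\<omega> \<in> space M"
  shows "0 \<le> fst (snd \<omega>) t \<and> fst (snd \<omega>) t < 1" "0 \<le> snd (snd \<omega>) t \<and> snd (snd \<omega>) t < 1"
proof -
  obtain x u v where \<omega>: "\<omega> = (x, u, v)" by (cases \<omega>)
  have "range u \<subseteq> {0..<1}" "range v \<subseteq> {0..<1}" using assms unfolding \<omega> space_M_iff by blast+
  then have "u t \<in> {0..<1}" "v t \<in> {0..<1}" by blast+
  then show "0 \<le> fst (snd \<omega>) t \<and> fst (snd \<omega>) t < 1" "0 \<le> snd (snd \<omega>) t \<and> snd (snd \<omega>) t < 1"
    by (simp_all add: \<omega>)
qed

lemma st_ok: "\<omega> \<in> space M \<Longrightarrow> ok t (st t \<omega>)"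
proof (induction t)
  case 0
  then show ?case using arms_pos samples_pos by (simp add: st_0 ok_def ok_phase_def)
next
  case (Suc t)
  then show ?case
    unfolding st_Suc by (intro update_ok[OF _ _ rec_def]) (auto simp: uv_range)
qed

lemma rec_mem: "\<omega> \<in> space M \<Longrightarrow> rec t \<omega> \<in> {1..arms S}"
  unfolding rec_def by (intro recommend_ok[of t]) (auto simp: uv_range st_ok)

section \<open>Dependence on past rewards\<close>

definition agree :: "nat \<Rightarrow> rewards \<Rightarrow> rewards \<Rightarrow> bool" where
  "agree t x x' \<longleftrightarrow> (\<forall>i s. s \<le> t \<longrightarrow> x (i, s) = x' (i, s))"

text \<open>Adaptedness without filtrations: both tapes are regarded as known from the beginning,
  and only the rewards are revealed round by round. Points are taken from the space of
  \<open>M\<close> because the state invariant is available there.\<close>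

definition past :: "nat \<Rightarrow> (noise \<Rightarrow> 'a) \<Rightarrow> bool" where
  "past t G \<longleftrightarrow> (\<forall>x x' u v. (x, u, v) \<in> space M \<longrightarrow> (x', u, v) \<in> space M \<longrightarrow> agree t x x' \<longrightarrow>
     G (x, u, v) = G (x', u, v))"

lemma agree_mono: "agree t x x' \<Longrightarrow> s \<le> t \<Longrightarrow> agree s x x'"
  by (auto simp: agree_def)

lemma past_mono: "past s G \<Longrightarrow> s \<le> t \<Longrightarrow> past t G"
  by (auto simp: past_def dest: agree_mono)

lemma past_compose: "past t G \<Longrightarrow> past t (\<lambda>\<omega>. f (G \<omega>))"
  unfolding past_def by metis

lemma past_compose2: "past t G \<Longrightarrow> past t H \<Longrightarrow> past t (\<lambda>\<omega>. f (G \<omega>) (H \<omega>))"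
  unfolding past_def by metis

lemma rate_agree:
  assumes "ok t (Sampling i a n, used, h)" "agree t x x'"
  shows "rate S x h n = rate S x' h n"
proof -
  have "past_mean x h n = past_mean x' h n"
    using assms unfolding past_mean_def
    by (intro arg_cong[where f="\<lambda>z. z / _"] sum.cong) (auto simp: agree_def ok_def ok_phase_def)
  then show ?thesis by (simp add: rate_def)
qed

lemma recommend_agree:
  assumes "ok t \<sigma>" "agree t x x'"
  shows "recommend S x u \<sigma> = recommend S x' u \<sigma>"
proof -
  obtain ph used h where \<sigma>: "\<sigma> = (ph, used, h)" by (cases \<sigma>)
  show ?thesis
  proof (cases ph)
    case (Sampling i a n)
    then have "rate S x h n = rate S x' h n" using assms rate_agree by (simp add: \<sigma>)
    then show ?thesis
      by (simp add: \<sigma> Sampling recommend_def fair_always arm_prob_def cong: if_cong)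
  qed (auto simp: \<sigma> recommend_def)
qed

lemma message_agree:
  assumes "ok t \<sigma>" "agree t x x'"
  shows "message S \<nu> x \<sigma> = message S \<nu> x' \<sigma>"
proof -
  obtain ph used h where \<sigma>: "\<sigma> = (ph, used, h)" by (cases \<sigma>)
  have collected: "(\<lambda>i j. if i \<in> {1..arms S} \<and> j < samples S then x (i, rounds_of used i ! j) else 0) =
      (\<lambda>i j. if i \<in> {1..arms S} \<and> j < samples S then x' (i, rounds_of used i ! j) else 0)"
    if *: "\<forall>j\<in>{1..arms S}. samples S \<le> num_used used j"
  proof (intro ext if_cong refl)
    fix i j assume ij: "i \<in> {1..arms S} \<and> j < samples S"
    \<comment> \<open>Beyond the end of the list \<open>!\<close> would be arbitrary; the counters
      guarantee k genuine entries for every arm.\<close>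
    then have "rounds_of used i ! j \<in> set (rounds_of used i)"
      using * by (intro nth_mem) (force simp: num_used_def)
    then have "rounds_of used i ! j \<le> t"
      using assms by (force simp: set_rounds_of ok_def \<sigma>)
    then show "x (i, rounds_of used i ! j) = x' (i, rounds_of used i ! j)"
      using assms by (simp add: agree_def)
  qed
  show ?thesis
  proof (cases ph)
    case (Sampling i a n)
    then have "rate S x h n = rate S x' h n" using assms rate_agree by (simp add: \<sigma>)
    then show ?thesis
      using assms by (auto simp: \<sigma> Sampling message_def agree_def ok_def ok_phase_def)
  next
    case (Exploring B q js)
    then show ?thesis
      using collected assms(1) by (simp add: message_def \<sigma> ok_def ok_phase_def)
  next
    case (Exploiting j)
    then show ?thesis
      using collected assms(1) by (simp add: message_def \<sigma> ok_def ok_phase_def)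
  qed
qed

lemma used_agree:
  assumes "ok t (ph, used, h)" "agree t x x'" "(i, s) \<in> set used"
  shows "x (i, s) = x' (i, s)"
  using assms by (fastforce simp: ok_def agree_def)

text \<open>With recommendation and decision given, the transition reads rewards only through
  estimates over the new \<open>used\<close> list, whose entries stem from rounds up to
  \<open>Suc t\<close>.\<close>

lemma update_agree:
  assumes "ok t \<sigma>" "ok (Suc t) (update S x v I y \<sigma>)" "agree (Suc t) x x'"
  shows "update S x v I y \<sigma> = update S x' v I y \<sigma>"
proof -
  obtain ph used h where \<sigma>: "\<sigma> = (ph, used, h)" by (cases \<sigma>)
  obtain ph' used' h' where \<sigma>': "update S x v I y \<sigma> = (ph', used', h')" by (cases "update S x v I y \<sigma>")
  have eq: "\<And>i s. (i, s) \<in> set used' \<Longrightarrow> x (i, s) = x' (i, s)"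
    using used_agree assms(2,3) unfolding \<sigma>' by blast
  have "\<forall>B q. explore S x used' B q = explore S x' used' B q"
    "\<forall>i. best_arm S x v i used' = best_arm S x' v i used'"
    using explore_cong best_arm_cong eq by blast+
  note e = this
  show ?thesis
    using \<sigma>' e unfolding \<sigma>
    by (cases ph) (auto simp: update_def Let_def enter_stage_def split: if_splits)
qed

text \<open>Induction on rounds: the state fixes recommendation and message, by
  \<open>decision_fiber\<close> these fix the decision, and all of them together with the reward of
  the round fix the next state.\<close>

lemma st_past: "past t (st t)"
  and rec_past: "past t (rec t)"
  and fol_past: "past t (fol t)"
proof -
  have rf: "rec t (x, u, v) = rec t (x', u, v) \<and> fol t (x, u, v) = fol t (x', u, v)"
    if "st t (x, u, v) = st t (x', u, v)" "(x, u, v) \<in> space M" "(x', u, v) \<in> space M" "agree t x x'"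
    for t x x' u v
  proof -
    have ok: "ok t (st t (x, u, v))" by (rule st_ok) fact
    have r: "rec t (x, u, v) = rec t (x', u, v)"
      unfolding rec_def using recommend_agree[OF ok that(4)] that(1) by simp
    moreover have "fol t (x, u, v) = fol t (x', u, v)"
      unfolding fol_def
    proof (rule decision_fiber)
      show "(\<nu>, x, u, v) \<in> space (point_space S)" "(\<nu>, x', u, v) \<in> space (point_space S)"
        using that(2,3) \<nu> by (auto simp: point_space_def space_pair_measure space_M)
      show "recommendation S (arp S t) (\<nu>, x, u, v) = recommendation S (arp S t) (\<nu>, x', u, v)"
        using r by (simp add: recommendation_arp)
      show "message S (fst (\<nu>, x, u, v)) (fst (snd (\<nu>, x, u, v))) (arp S t (\<nu>, x, u, v)) =
          message S (fst (\<nu>, x', u, v)) (fst (snd (\<nu>, x', u, v))) (arp S t (\<nu>, x', u, v))"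
        using message_agree[OF ok that(4)] that(1) by (simp add: st_def)
    qed
    ultimately show ?thesis ..
  qed
  have st: "st t (x, u, v) = st t (x', u, v)"
    if "(x, u, v) \<in> space M" "(x', u, v) \<in> space M" "agree t x x'" for t x x' u v
    using that(3)
  proof (induction t)
    case 0 then show ?case by (simp add: st_0)
  next
    case (Suc t)
    have a: "agree t x x'" using Suc.prems by (rule agree_mono) simp
    note IH = Suc.IH[OF a]
    note rf = rf[OF IH that(1,2) a]
    show ?case
      using update_agree[OF st_ok[OF that(1), of t] _ Suc.prems, of v "rec t (x, u, v)" "fol t (x, u, v)"]
        st_ok[OF that(1), of "Suc t"] rf IH
      by (simp add: st_Suc)
  qed
  then show "past t (st t)" "past t (rec t)" "past t (fol t)"
    using rf unfolding past_def by blast+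
qed

definition used :: "nat \<Rightarrow> noise \<Rightarrow> (nat \<times> nat) list" where
  "used t \<omega> = fst (snd (st t \<omega>))"

lemma used_0 [simp]: "used 0 \<omega> = []"
  by (simp add: used_def st_0)

lemma used_past: "past t (used t)"
  unfolding used_def by (rule past_compose) (rule st_past)

text \<open>The arm whose reward of round \<open>t + 1\<close> is collected, or \<open>0\<close> if there is none; it is
  determined before this reward is drawn.\<close>

definition collect :: "nat \<Rightarrow> noise \<Rightarrow> nat" where
  "collect t \<omega> = (case fst (st t \<omega>) of
     Sampling i a n \<Rightarrow> if rec t \<omega> = i \<and> (i = 1 \<or> fol t \<omega>) then rec t \<omega> else 0
   | Exploring B q js \<Rightarrow> if fol t \<omega> then rec t \<omega> else 0
   | Exploiting j \<Rightarrow> 0)"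

lemma used_Suc:
  assumes "\<omega> \<in> space M"
  shows "used (Suc t) \<omega> = (if collect t \<omega> = 0 then used t \<omega> else used t \<omega> @ [(collect t \<omega>, Suc t)])"
proof -
  obtain ph us h where \<sigma>: "st t \<omega> = (ph, us, h)" by (cases "st t \<omega>")
  have h: "length h = t" using st_ok[OF assms, of t] by (simp add: \<sigma> ok_def)
  show ?thesis
    using rec_mem[OF assms, of t]
    by (cases ph) (auto simp: used_def st_Suc \<sigma> collect_def update_def h Let_def)
qed

lemma collect_le: "\<omega> \<in> space M \<Longrightarrow> collect t \<omega> \<le> arms S"
  using rec_mem[of \<omega> t] by (auto simp: collect_def split: phase.splits)

lemma collect_past: "past t (collect t)"
  using st_past[of t] rec_past[of t] fol_past[of t]
  unfolding past_def collect_def by presburger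

end

section \<open>Measurability and fresh rewards\<close>

lemma measurable_filter_list:
  assumes "\<And>i. Measurable.pred N (P i)"
  shows "(\<lambda>\<omega>. filter (\<lambda>i. P i \<omega>) xs) \<in> measurable N (count_space (UNIV :: 'a::countable list set))"
proof (induction xs)
  case (Cons a xs)
  have "(\<lambda>\<omega>. (\<lambda>ys \<omega>. if P a \<omega> then a # ys else ys) (filter (\<lambda>i. P i \<omega>) xs) \<omega>)
      \<in> measurable N (count_space UNIV)"
    by (rule measurable_compose_countable[OF _ Cons]) (use assms in measurable)
  then show ?case by (simp add: if_distrib cong: if_cong)
qed simp

text \<open>States, recommendations and decisions have countable types. Substituting them one after
  another reduces measurability of the policy to that of a transition with these three
  frozen.\<close>

lemma measurable_compose_countable3:
  fixes f :: "'i::countable \<Rightarrow> 'j::countable \<Rightarrow> 'k::countable \<Rightarrow> 'a \<Rightarrow> 'b"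
  assumes "\<And>i j k. f i j k \<in> measurable N L"
    and g: "g \<in> measurable N (count_space UNIV)" and h: "h \<in> measurable N (count_space UNIV)"
    and e: "e \<in> measurable N (count_space UNIV)"
  shows "(\<lambda>\<omega>. f (g \<omega>) (h \<omega>) (e \<omega>) \<omega>) \<in> measurable N L"
proof -
  have "(\<lambda>\<omega>. f i j (e \<omega>) \<omega>) \<in> measurable N L" for i j
    by (rule measurable_compose_countable[OF assms(1) e])
  then have "(\<lambda>\<omega>. f i (h \<omega>) (e \<omega>) \<omega>) \<in> measurable N L" for i
    by (rule measurable_compose_countable[OF _ h])
  then show ?thesis
    by (rule measurable_compose_countable[OF _ g])
qed

context arp_model
begin

lemma measurable_rewards_sum [measurable]:
  "(\<lambda>\<omega>. \<Sum>s\<leftarrow>xs. fst \<omega> (f s)) \<in> borel_measurable M"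
  by (induction xs) auto

lemma measurable_arm_mean [measurable]: "(\<lambda>\<omega>. arm_mean (fst \<omega>) us i q) \<in> borel_measurable M"
  unfolding arm_mean_def by measurable

lemma measurable_rate [measurable]: "(\<lambda>\<omega>. rate S (fst \<omega>) h n) \<in> borel_measurable M"
  unfolding rate_def past_mean_def Let_def by measurable

lemma measurable_arm_prob [measurable]:
  "(\<lambda>\<omega>. arm_prob S (fst \<omega>) h i a n j) \<in> borel_measurable M"
  unfolding arm_prob_def by measurable

lemma measurable_recommend:
  "(\<lambda>\<omega>. recommend S (fst \<omega>) (fst (snd \<omega>)) \<sigma>) \<in> measurable M (count_space UNIV)"
proof -
  obtain ph used h where \<sigma>: "\<sigma> = (ph, used, h)" by (cases \<sigma>)
  show ?thesis
  proof (cases ph)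
    case (Sampling i a n)
    define P where "P j \<omega> \<longleftrightarrow> fst (snd \<omega>) (length h + 1) \<in>
      {(\<Sum>s = 1..<j. arm_prob S (fst \<omega>) h i a n s) ..< (\<Sum>s = 1..j. arm_prob S (fst \<omega>) h i a n s)}"
      for j and \<omega> :: noise
    have P: "Measurable.pred M (P j)" for j
      unfolding P_def atLeastLessThan_iff by measurable
    \<comment> \<open>The sum depends on the noise only through two truth values, and becomes a
      constant once these are frozen. The selector \<open>j = a\<close> also covers a = i.\<close>
    have "(\<lambda>\<omega>. \<Sum>j\<in>{a, i}. j * of_bool (if j = a then P a \<omega> else P i \<omega>))
       \<in> measurable M (count_space UNIV)"
      by (rule measurable_compose_countable3[where f = "\<lambda>p q (_ :: unit) _. \<Sum>j\<in>{a, i}. j * of_bool (if j = a then p else q)"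
            and e = "\<lambda>_. ()", OF _ P P]) simp_all
    moreover have "(\<lambda>\<omega>. \<Sum>j\<in>{a, i}. j * of_bool (if j = a then P a \<omega> else P i \<omega>)) =
      (\<lambda>\<omega>. \<Sum>j\<in>{a, i}. j * of_bool (P j \<omega>))"
      by (intro ext sum.cong) auto
    ultimately have "(\<lambda>\<omega>. \<Sum>j\<in>{a, i}. j * of_bool (P j \<omega>)) \<in> measurable M (count_space UNIV)"
      by simp
    moreover have "recommend S (fst \<omega>) (fst (snd \<omega>)) \<sigma> =
        (if i = 1 then 1 else \<Sum>j\<in>{a, i}. j * of_bool (P j \<omega>))" for \<omega>
    proof -
      have "fair S (fst \<omega>) h (length h + 1)" by (rule fair_always) simp
      then show ?thesis
        by (simp only: \<sigma> Sampling recommend_def prod.case phase.case Let_def P_def if_True)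
    qed
    ultimately show ?thesis
      by (cases "i = 1") simp_all
  qed (simp_all add: \<sigma> recommend_def)
qed

lemma measurable_best_arm:
  "(\<lambda>\<omega>. best_arm S (fst \<omega>) (snd (snd \<omega>)) i us) \<in> measurable M (count_space UNIV)"
proof -
  define J where "J \<omega> = {j \<in> {1..<i}. \<forall>l\<in>{1..<i}.
    arm_mean (fst \<omega>) us l (samples S) \<le> arm_mean (fst \<omega>) us j (samples S)}" for \<omega> :: noise
  have J: "J \<in> measurable M (count_space (Pow {1..<i}))"
  proof (rule measurable_count_space_eq2[THEN iffD2])
    have "J -` {K} \<inter> space M \<in> sets M" if K: "K \<in> Pow {1..<i}" for K
    proof -
      have "J -` {K} \<inter> space M = {\<omega>\<in>space M. \<forall>j\<in>{1..<i}. j \<in> K \<longleftrightarrow> (\<forall>l\<in>{1..<i}.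
          arm_mean (fst \<omega>) us l (samples S) \<le> arm_mean (fst \<omega>) us j (samples S))}"
        using K unfolding J_def by blast
      also have "\<dots> \<in> sets M" by measurable
      finally show ?thesis .
    qed
    then show "J \<in> space M \<rightarrow> Pow {1..<i} \<and> (\<forall>a\<in>Pow {1..<i}. J -` {a} \<inter> space M \<in> sets M)"
      unfolding J_def by blast
  qed simp
  have "(\<lambda>\<omega>. (\<lambda>K \<omega>. sorted_list_of_set K ! nat \<lfloor>snd (snd \<omega>) i * real (card K)\<rfloor>) (J \<omega>) \<omega>)
      \<in> measurable M (count_space UNIV)"
    by (rule measurable_compose_countable'[OF _ J]) (auto intro: countable_finite)
  then show ?thesis
    unfolding best_arm_def J_def Let_def .
qed

lemma measurable_explore:
  "(\<lambda>\<omega>. explore S (fst \<omega>) us B q) \<in> measurable M (count_space UNIV)"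
proof (cases "length B > 1")
  case True
  define P where "P i \<omega> \<longleftrightarrow> arm_mean (fst \<omega>) us i q
      + sqrt (ln (real (horizon S) * theta S) / (2 * real q))
      \<ge> max (Max ((\<lambda>i. arm_mean (fst \<omega>) us i q) ` set B)) (cstar S)" for i and \<omega> :: noise
  have "Measurable.pred M (P i)" for i unfolding P_def by measurable
  from measurable_compose[OF measurable_filter_list[where P = P, OF this, of B],
      of "\<lambda>B'. if B' = [] then Exploiting 1 else Exploring B' q B'" "count_space UNIV"]
  have "(\<lambda>\<omega>. if filter (\<lambda>i. P i \<omega>) B = [] then Exploiting 1
      else Exploring (filter (\<lambda>i. P i \<omega>) B) q (filter (\<lambda>i. P i \<omega>) B)) \<in> measurable M (count_space UNIV)"
    by simp
  then show ?thesis
    using True unfolding explore_def P_def Let_def by simp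
qed (simp add: explore_def)

lemma measurable_enter_stage:
  "(\<lambda>\<omega>. enter_stage S (fst \<omega>) (snd (snd \<omega>)) i us h) \<in> measurable M (count_space UNIV)"
proof (cases "i \<le> arms S")
  case True
  from measurable_compose[OF measurable_best_arm[of i us], of "\<lambda>a. Sampling i a (length h)" "count_space UNIV"]
  show ?thesis by (simp add: enter_stage_def True)
qed (simp add: enter_stage_def measurable_explore)

lemma measurable_update:
  "(\<lambda>\<omega>. update S (fst \<omega>) (snd (snd \<omega>)) I y \<sigma>) \<in> measurable M (count_space UNIV)"
proof -
  obtain ph us h where \<sigma>: "\<sigma> = (ph, us, h)" by (cases \<sigma>)
  have pair: "(\<lambda>\<omega>. (f \<omega>, us', h')) \<in> measurable M (count_space UNIV)"
    if "f \<in> measurable M (count_space UNIV)" for f :: "noise \<Rightarrow> phase" and us' :: "(nat \<times> nat) list" and h' :: history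
    using measurable_compose[OF that, of "\<lambda>p. (p, us', h')" "count_space UNIV"] by simp
  have if_const: "(\<lambda>\<omega>. if b then f \<omega> else g \<omega>) \<in> measurable M (count_space UNIV)"
    if "f \<in> measurable M (count_space UNIV)" "g \<in> measurable M (count_space UNIV)"
    for b and f g :: "noise \<Rightarrow> 'z"
    using that by (cases b) simp_all
  show ?thesis
    by (cases ph; cases y)
      (simp_all add: \<sigma> update_def Let_def pair if_const measurable_enter_stage measurable_explore)
qed

lemma measurable_st [measurable]: "st t \<in> measurable M (count_space UNIV)"
  and measurable_rec [measurable]: "rec t \<in> measurable M (count_space UNIV)"
  and measurable_fol [measurable]: "Measurable.pred M (fol t)"
proof -
  have fol: "Measurable.pred M (fol t)" for t
    unfolding fol_def by measurable
  have rec: "rec t \<in> measurable M (count_space UNIV)" if "st t \<in> measurable M (count_space UNIV)" for t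
    unfolding rec_def by (rule measurable_compose_countable[OF measurable_recommend that])
  have st: "st t \<in> measurable M (count_space UNIV)" for t
  proof (induction t)
    case (Suc t)
    show ?case
      unfolding st_Suc[abs_def]
      by (rule measurable_compose_countable3[where f = "\<lambda>\<sigma> i y \<omega>. update S (fst \<omega>) (snd (snd \<omega>)) i y \<sigma>",
            OF measurable_update Suc rec[OF Suc] fol])
  qed (simp add: st_0[abs_def])
  show "st t \<in> measurable M (count_space UNIV)" "rec t \<in> measurable M (count_space UNIV)"
    "Measurable.pred M (fol t)"
    using st rec fol by blast+
qed

lemma measurable_used [measurable]: "used t \<in> measurable M (count_space UNIV)"
  unfolding used_def[abs_def]
  by (rule measurable_compose[OF measurable_st, of "\<lambda>\<sigma>. fst (snd \<sigma>)"]) simp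

lemma measurable_collect [measurable]: "collect t \<in> measurable M (count_space UNIV)"
  unfolding collect_def[abs_def]
  by (rule measurable_compose_countable3[where f = "\<lambda>\<sigma> i y _. case fst \<sigma> of
     Sampling j a n \<Rightarrow> if i = j \<and> (j = 1 \<or> y) then i else 0
   | Exploring B q js \<Rightarrow> if y then i else 0
   | Exploiting j \<Rightarrow> 0", OF _ measurable_st measurable_rec measurable_fol]) simp

lemma pastD:
  "past t G \<Longrightarrow> (x, u, v) \<in> space M \<Longrightarrow> (x', u, v) \<in> space M \<Longrightarrow> agree t x x' \<Longrightarrow>
    G (x, u, v) = G (x', u, v)"
  unfolding past_def by blast

text \<open>Independence of a future reward from the past. The coordinate (i, s) is split off the
  product measure; overwriting it does not change G, so Fubini separates the factors. The tapes are
  integrated last, because \<open>past\<close> compares points with equal tapes.\<close>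

lemma nn_integral_fresh:
  assumes i: "i \<in> {1..arms S}" and "t < s"
    and [measurable]: "f \<in> borel_measurable borel" "G \<in> borel_measurable M"
    and G: "past t G"
  shows "(\<integral>\<^sup>+\<omega>. f (fst \<omega> (i, s)) * G \<omega> \<partial>M) = (\<integral>\<^sup>+z. f z \<partial>\<nu> i) * (\<integral>\<^sup>+\<omega>. G \<omega> \<partial>M)"
proof -
  let ?I = "{1..arms S} \<times> UNIV" and ?N = "\<lambda>(i, t). \<nu> i" and ?p = "(i, s)"
  let ?R = "PiM (?I - {?p}) ?N"
  let ?X = "reward_law (arms S) \<nu>"
  have ins: "insert ?p (?I - {?p}) = ?I" using i by auto
  interpret X: prob_space ?X by (rule prob_space_reward_law)
  interpret T: prob_space tape_law by (rule prob_space_tape_law)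
  interpret P: prob_space "\<nu> i" using i by (rule prob_space_\<nu>)
  interpret R: prob_space ?R by (rule prob_space_PiM) (auto intro: prob_space_\<nu>)
  interpret PR: pair_prob_space "\<nu> i" ?R ..
  interpret XT: pair_prob_space ?X tape_law ..
  \<comment> \<open>Drawing the coordinate (i, s) separately and inserting it into the others
    reproduces the reward law.\<close>
  have dist: "distr (\<nu> i \<Otimes>\<^sub>M ?R) ?X (\<lambda>(z, x). x(?p := z)) = ?X"
  proof -
    have "distr (?N ?p \<Otimes>\<^sub>M ?R) (PiM (insert ?p (?I - {?p})) ?N) (\<lambda>(z, x). x(?p := z)) =
        PiM (insert ?p (?I - {?p})) ?N"
      by (rule distr_pair_PiM_eq_PiM) (use i in \<open>auto intro: prob_space_\<nu>\<close>)
    then show ?thesis unfolding ins reward_law_def by simp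
  qed
  have upd [measurable]: "(\<lambda>(z, x). x(?p := z)) \<in> measurable (\<nu> i \<Otimes>\<^sub>M ?R) ?X"
  proof -
    have "(\<lambda>zx. (snd zx)(?p := fst zx)) \<in> measurable (\<nu> i \<Otimes>\<^sub>M ?R) (PiM (insert ?p (?I - {?p})) ?N)"
      by (rule measurable_fun_upd[where J = "?I - {?p}"]) auto
    then show ?thesis
      unfolding ins reward_law_def by (simp add: split_beta)
  qed
  have [measurable]: "f \<in> borel_measurable (\<nu> i)"
    by (rule measurable_compose[OF measurable_id_\<nu>[OF i] assms(3)])
  have Gm [measurable]: "G \<in> borel_measurable (?X \<Otimes>\<^sub>M tape_law)"
    using assms(4) by (simp add: ex_post_alt)
  have fp [measurable]: "(\<lambda>x. f (x ?p)) \<in> borel_measurable ?X"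
  proof -
    have "(\<lambda>x. x ?p) \<in> measurable ?X (\<nu> i)"
      unfolding reward_law_def using measurable_component_singleton[of ?p ?I ?N] i by simp
    then show ?thesis by (rule measurable_compose) measurable
  qed
  have G': "(\<lambda>x. G (x, r)) \<in> borel_measurable ?X" if "r \<in> space tape_law" for r
    using that by measurable
  have slice: "(\<integral>\<^sup>+x. f (x ?p) * G (x, r) \<partial>?X) = (\<integral>\<^sup>+z. f z \<partial>\<nu> i) * (\<integral>\<^sup>+x. G (x, r) \<partial>?X)"
    if r: "r \<in> space tape_law" for r
  proof -
    note [measurable] = G'[OF r]
    have zero: "0 \<in> space (\<nu> i)" using i by (simp add: space_\<nu>)
    \<comment> \<open>The placeholder 0 is an admissible reward, so the modified point stays in the
      space and G becomes a function of the other coordinates.\<close>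
    have const: "G (x(?p := z), r) = G (x(?p := 0), r)" if "z \<in> space (\<nu> i)" "x \<in> space ?R" for z x
    proof -
      have sp: "(x(?p := z), r) \<in> space M" if "z \<in> space (\<nu> i)" for z
        using measurable_space[OF upd, of "(z, x)"] that \<open>x \<in> space ?R\<close> r
        by (simp add: ex_post_alt space_pair_measure)
      obtain u v where uv: "r = (u, v)" by (cases r)
      have "agree t (x(?p := z)) (x(?p := 0))"
        using \<open>t < s\<close> by (simp add: agree_def)
      then show ?thesis
        using sp[OF that(1)] sp[OF zero] unfolding uv by (intro pastD[OF G])
    qed
    have [measurable]: "(\<lambda>x. G (x(?p := 0), r)) \<in> borel_measurable ?R"
    proof -
      have "(\<lambda>x. (\<lambda>(z, x). x(?p := z)) (0::real, x)) \<in> measurable ?R ?X"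
        by (rule measurable_compose[OF _ upd]) (use zero in measurable)
      from measurable_compose[OF this G'[OF r]] show ?thesis by simp
    qed
    have *: "(\<integral>\<^sup>+x. h x \<partial>?X) = (\<integral>\<^sup>+z. \<integral>\<^sup>+x. h (x(?p := z)) \<partial>?R \<partial>\<nu> i)"
      if [measurable]: "h \<in> borel_measurable ?X" for h
    proof -
      have "(\<integral>\<^sup>+x. h x \<partial>?X) = (\<integral>\<^sup>+zx. h ((\<lambda>(z, x). x(?p := z)) zx) \<partial>(\<nu> i \<Otimes>\<^sub>M ?R))"
        by (subst dist[symmetric], subst nn_integral_distr) measurable
      also have "\<dots> = (\<integral>\<^sup>+z. \<integral>\<^sup>+x. h (x(?p := z)) \<partial>?R \<partial>\<nu> i)"
        by (subst R.nn_integral_fst[symmetric]) (rule measurable_compose[OF upd that], simp)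
      finally show ?thesis .
    qed
    have "(\<integral>\<^sup>+x. f (x ?p) * G (x, r) \<partial>?X) = (\<integral>\<^sup>+z. \<integral>\<^sup>+x. f z * G (x(?p := 0), r) \<partial>?R \<partial>\<nu> i)"
      by (subst *) (auto intro!: nn_integral_cong simp: const)
    also have "\<dots> = (\<integral>\<^sup>+z. f z * (\<integral>\<^sup>+x. G (x(?p := 0), r) \<partial>?R) \<partial>\<nu> i)"
      by (intro nn_integral_cong nn_integral_cmult) measurable
    also have "\<dots> = (\<integral>\<^sup>+z. f z \<partial>\<nu> i) * (\<integral>\<^sup>+x. G (x(?p := 0), r) \<partial>?R)"
      by (rule nn_integral_multc) measurable
    also have "(\<integral>\<^sup>+x. G (x(?p := 0), r) \<partial>?R) = (\<integral>\<^sup>+x. G (x, r) \<partial>?X)"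
    proof -
      have "(\<integral>\<^sup>+x. G (x, r) \<partial>?X) = (\<integral>\<^sup>+z. \<integral>\<^sup>+x. G (x(?p := 0), r) \<partial>?R \<partial>\<nu> i)"
        unfolding *[OF G'[OF r]] by (intro nn_integral_cong const)
      then show ?thesis by (simp add: P.emeasure_space_1)
    qed
    finally show ?thesis .
  qed
  have "(\<integral>\<^sup>+\<omega>. f (fst \<omega> ?p) * G \<omega> \<partial>M) = (\<integral>\<^sup>+r. \<integral>\<^sup>+x. f (x ?p) * G (x, r) \<partial>?X \<partial>tape_law)"
    unfolding ex_post_alt by (subst XT.nn_integral_snd[symmetric]) auto
  also have "\<dots> = (\<integral>\<^sup>+r. (\<integral>\<^sup>+z. f z \<partial>\<nu> i) * (\<integral>\<^sup>+x. G (x, r) \<partial>?X) \<partial>tape_law)"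
    by (intro nn_integral_cong slice)
  also have "\<dots> = (\<integral>\<^sup>+z. f z \<partial>\<nu> i) * (\<integral>\<^sup>+\<omega>. G \<omega> \<partial>M)"
    unfolding ex_post_alt by (subst XT.nn_integral_snd[symmetric]) (auto intro!: nn_integral_cmult)
  finally show ?thesis .
qed

end

section \<open>Ville's inequality\<close>

lemma hoeffding_unit_interval:
  assumes N: "sets N = sets unit_interval" and "prob_space N"
  shows "(\<integral>\<^sup>+z. exp (l * (z - (\<integral>z. z \<partial>N))) \<partial>N) \<le> ennreal (exp (l\<^sup>2 / 8))"
proof -
  interpret prob_space N by fact
  have sp: "space N = {0..1}" using sets_eq_imp_space_eq[OF N] by simp
  have id: "(\<lambda>z. z) \<in> borel_measurable N"
    using measurable_unit_interval_id measurable_cong_sets[OF N refl] by blast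
  consider "l = 0" | "l > 0" | "l < 0" by linarith
  then show ?thesis
  proof cases
    case 1 then show ?thesis by (simp add: emeasure_space_1)
  next
    case 2
    interpret I: interval_bounded_random_variable N "\<lambda>z. z" 0 1
      using id by unfold_locales (auto simp: sp)
    show ?thesis using I.Hoeffdings_lemma_nn_integral[OF 2] by simp
  next
    \<comment> \<open>A negative slope is a positive slope for -z, which lives on [-1, 0].\<close>
    case 3
    interpret I: interval_bounded_random_variable N "\<lambda>z. - z" "- 1" 0
      using id by unfold_locales (auto simp: sp)
    show ?thesis using I.Hoeffdings_lemma_nn_integral[of "- l"] 3
      by (simp add: algebra_simps)
  qed
qed

context arp_model
begin

abbreviation \<mu> :: "nat \<Rightarrow> real" where "\<mu> i \<equiv> mean \<nu> i"

definition dev_sum :: "(nat \<Rightarrow> real) \<Rightarrow> nat \<Rightarrow> noise \<Rightarrow> real" where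
  "dev_sum w t \<omega> = (\<Sum>p\<leftarrow>used t \<omega>. w (fst p) * (fst \<omega> p - \<mu> (fst p)))"

text \<open>A variance proxy: a reward of arm i adds (w i)^2, matching the exponent (s w i)^2 / 8 of
  Hoeffding's lemma.\<close>

definition wt_sum :: "(nat \<Rightarrow> real) \<Rightarrow> nat \<Rightarrow> noise \<Rightarrow> real" where
  "wt_sum w t \<omega> = (\<Sum>p\<leftarrow>used t \<omega>. (w (fst p))\<^sup>2)"

definition log_mart :: "real \<Rightarrow> (nat \<Rightarrow> real) \<Rightarrow> nat \<Rightarrow> noise \<Rightarrow> real" where
  "log_mart s w t \<omega> = s * dev_sum w t \<omega> - s\<^sup>2 / 8 * wt_sum w t \<omega>"

lemma dev_sum_0 [simp]: "dev_sum w 0 \<omega> = 0" and wt_sum_0 [simp]: "wt_sum w 0 \<omega> = 0"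
  by (simp_all add: dev_sum_def wt_sum_def)

lemma log_mart_Suc:
  assumes "\<omega> \<in> space M"
  shows "log_mart s w (Suc t) \<omega> = log_mart s w t \<omega> + (let c = collect t \<omega> in
    if c = 0 then 0 else s * w c * (fst \<omega> (c, Suc t) - \<mu> c) - (s * w c)\<^sup>2 / 8)"
  using used_Suc[OF assms, of t]
  by (simp add: log_mart_def dev_sum_def wt_sum_def Let_def algebra_simps)

lemma measurable_dev_sum [measurable]: "dev_sum w t \<in> borel_measurable M"
proof -
  have "(\<lambda>\<omega>. \<Sum>p\<leftarrow>us. w (fst p) * (fst \<omega> p - \<mu> (fst p))) \<in> borel_measurable M" for us
    by (induction us) auto
  then show ?thesis
    unfolding dev_sum_def[abs_def] by (rule measurable_compose_countable[OF _ measurable_used])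
qed

lemma measurable_wt_sum [measurable]: "wt_sum w t \<in> borel_measurable M"
  unfolding wt_sum_def[abs_def]
  by (rule measurable_compose_countable[OF _ measurable_used]) simp

lemma measurable_log_mart [measurable]: "log_mart s w t \<in> borel_measurable M"
  unfolding log_mart_def[abs_def] by measurable

lemma used_rounds_le: "\<omega> \<in> space M \<Longrightarrow> (i, s) \<in> set (used t \<omega>) \<Longrightarrow> s \<le> t"
  using st_ok[of \<omega> t] by (cases "st t \<omega>") (fastforce simp: ok_def used_def)

lemma used_rewards_agree:
  assumes "(x, u, v) \<in> space M" "(x', u, v) \<in> space M" "agree t x x'"
  shows "map (\<lambda>p. (fst p, x p)) (used t (x, u, v)) = map (\<lambda>p. (fst p, x' p)) (used t (x', u, v))"
proof -
  have "used t (x', u, v) = used t (x, u, v)"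
    using pastD[OF used_past assms] by simp
  moreover have "x p = x' p" if "p \<in> set (used t (x, u, v))" for p
  proof -
    obtain i s where p: "p = (i, s)" by (cases p)
    show ?thesis
      using that used_rounds_le[OF assms(1), of i s t] assms(3) unfolding p agree_def by blast
  qed
  ultimately show ?thesis by simp
qed

lemma dev_sum_past: "past t (dev_sum w t)"
proof -
  have *: "dev_sum w t \<omega> =
      sum_list (map (\<lambda>(i, z). w i * (z - \<mu> i)) (map (\<lambda>p. (fst p, fst \<omega> p)) (used t \<omega>)))" for \<omega>
    by (simp add: dev_sum_def comp_def)
  show ?thesis
    unfolding past_def * fst_conv
  proof (intro allI impI)
    fix x x' u v
    assume "(x, u, v) \<in> space M" "(x', u, v) \<in> space M" "agree t x x'"
    from used_rewards_agree[OF this]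
    show "sum_list (map (\<lambda>(i, z). w i * (z - \<mu> i)) (map (\<lambda>p. (fst p, x p)) (used t (x, u, v)))) =
      sum_list (map (\<lambda>(i, z). w i * (z - \<mu> i)) (map (\<lambda>p. (fst p, x' p)) (used t (x', u, v))))"
      by (rule arg_cong)
  qed
qed

lemma wt_sum_past: "past t (wt_sum w t)"
  unfolding wt_sum_def[abs_def] by (rule past_compose) (rule used_past)

lemma log_mart_past: "past t (log_mart s w t)"
  unfolding log_mart_def[abs_def]
  by (rule past_compose2[where f = "\<lambda>d v. s * d - s\<^sup>2 / 8 * v"]) (rule dev_sum_past wt_sum_past)+

text \<open>By Hoeffding's lemma \<open>exp (log_mart s w t)\<close> is a supermartingale.\<close>

lemma ville:
  assumes A [measurable]: "Measurable.pred M A" and pA: "past t0 A"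
  shows "\<P>(\<omega> in M. A \<omega> \<and> (\<exists>t\<in>{t0..t1}. b \<le> log_mart s w t \<omega> - log_mart s w t0 \<omega>))
    \<le> exp (- b) * \<P>(\<omega> in M. A \<omega>)"
proof (cases "t0 \<le> t1")
  case False
  then show ?thesis by simp
next
  case True
  define L where "L t \<omega> = log_mart s w t \<omega> - log_mart s w t0 \<omega>" for t \<omega>
  define X where "X t \<omega> \<longleftrightarrow> (\<exists>r\<in>{t0..t}. b \<le> L r \<omega>)" for t \<omega>
  \<comment> \<open>The stopped process: restricted to A and frozen at exp b once the level is
    reached. Its integral does not increase from t0 on, and at t1 it dominates exp b on the event in
    question.\<close>
  define H where "H t \<omega> = ennreal (if A \<omega> then if X t \<omega> then exp b else exp (L t \<omega>) else 0)" for t \<omega>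
  have [measurable]: "L t \<in> borel_measurable M" for t unfolding L_def[abs_def] by measurable
  have [measurable]: "Measurable.pred M (X t)" for t unfolding X_def by measurable
  have [measurable]: "H t \<in> borel_measurable M" for t unfolding H_def[abs_def] by measurable
  have pL: "past r (L t)" if "t0 \<le> r" "t \<le> r" for t r
    unfolding L_def[abs_def] using that log_mart_past past_mono
    by (intro past_compose2[where f = "(-)"]) blast+
  have pX: "past t (X t)" if "t0 \<le> t" for t
    unfolding past_def X_def using pL[OF that] unfolding past_def by fastforce
  have H0: "(\<integral>\<^sup>+\<omega>. H t0 \<omega> \<partial>M) \<le> emeasure M {\<omega>\<in>space M. A \<omega>}"
  proof -
    have "(\<integral>\<^sup>+\<omega>. H t0 \<omega> \<partial>M) \<le> (\<integral>\<^sup>+\<omega>. indicator {\<omega>\<in>space M. A \<omega>} \<omega> \<partial>M)"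
      by (intro nn_integral_mono) (auto simp: H_def X_def L_def indicator_def)
    then show ?thesis by simp
  qed
  have step: "(\<integral>\<^sup>+\<omega>. H (Suc t) \<omega> \<partial>M) \<le> (\<integral>\<^sup>+\<omega>. H t \<omega> \<partial>M)" if t: "t0 \<le> t" for t
  proof -
    \<comment> \<open>One step is split according to the arm c collected in round t + 1, with c = 0
      for none. The weight \<open>G c\<close> depends on the past, so the fresh factor
      \<open>f c\<close> integrates separately, to at most 1.\<close>
    define f where "f c z = (if c = 0 then 1 else ennreal (exp (s * w c * (z - \<mu> c) - (s * w c)\<^sup>2 / 8)))"
      for c z
    define G where "G c \<omega> = ennreal (of_bool (A \<omega> \<and> \<not> X t \<omega> \<and> collect t \<omega> = c) * exp (L t \<omega>))" for c \<omega>
    define K where "K \<omega> = ennreal (of_bool (A \<omega> \<and> X t \<omega>) * exp b)" for \<omega>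
    have [measurable]: "f c \<in> borel_measurable borel" for c unfolding f_def[abs_def] by measurable
    have G [measurable]: "G c \<in> borel_measurable M" for c unfolding G_def[abs_def] by measurable
    have [measurable]: "K \<in> borel_measurable M" unfolding K_def[abs_def] by measurable
    have pG: "past t (G c)" for c
    proof -
      have "past t (\<lambda>\<omega>. ((A \<omega>, X t \<omega>), (collect t \<omega>, L t \<omega>)))"
        by (intro past_compose2[where f = Pair] past_mono[OF pA t] pX t pL order.refl collect_past)
      from past_compose[OF this, of "\<lambda>((a, x), (k, l)). ennreal (of_bool (a \<and> \<not> x \<and> k = c) * exp l)"]
      show ?thesis by (simp add: G_def[abs_def])
    qed
    have up: "H (Suc t) \<omega> \<le> K \<omega> + (\<Sum>c\<in>{0..arms S}. f c (fst \<omega> (c, Suc t)) * G c \<omega>)"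
      if \<omega>: "\<omega> \<in> space M" for \<omega>
    proof (cases "A \<omega> \<and> \<not> X t \<omega>")
      case False
      then show ?thesis using t by (auto simp: H_def K_def X_def)
    next
      case True
      let ?c = "collect t \<omega>"
      have "L (Suc t) \<omega> = L t \<omega> + (if ?c = 0 then 0
          else s * w ?c * (fst \<omega> (?c, Suc t) - \<mu> ?c) - (s * w ?c)\<^sup>2 / 8)"
        unfolding L_def log_mart_Suc[OF \<omega>] Let_def by simp
      then have "ennreal (exp (L (Suc t) \<omega>)) = f ?c (fst \<omega> (?c, Suc t)) * G ?c \<omega>"
        using True by (simp add: f_def G_def exp_add mult.commute flip: ennreal_mult)
      also have "\<dots> \<le> (\<Sum>c\<in>{0..arms S}. f c (fst \<omega> (c, Suc t)) * G c \<omega>)"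
        using collect_le[OF \<omega>, of t] by (intro member_le_sum) auto
      finally have "ennreal (exp (L (Suc t) \<omega>)) \<le> (\<Sum>c\<in>{0..arms S}. f c (fst \<omega> (c, Suc t)) * G c \<omega>)" .
      moreover have "H (Suc t) \<omega> \<le> ennreal (exp (L (Suc t) \<omega>))"
        using True by (auto simp: H_def X_def atLeastAtMostSuc_conv[OF le_SucI[OF t]] intro!: ennreal_leI)
      ultimately have "H (Suc t) \<omega> \<le> (\<Sum>c\<in>{0..arms S}. f c (fst \<omega> (c, Suc t)) * G c \<omega>)"
        by (rule order_trans[rotated])
      then show ?thesis
        by (rule add_increasing[OF zero_le])
    qed
    have fG: "(\<integral>\<^sup>+\<omega>. f c (fst \<omega> (c, Suc t)) * G c \<omega> \<partial>M) \<le> (\<integral>\<^sup>+\<omega>. G c \<omega> \<partial>M)"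
      if "c \<in> {0..arms S}" for c
    proof (cases "c = 0")
      case True
      then show ?thesis by (simp add: f_def)
    next
      case False
      then have c: "c \<in> {1..arms S}" using that by simp
      note [measurable] = measurable_id_\<nu>[OF c]
      have "(\<integral>\<^sup>+z. f c z \<partial>\<nu> c) = (\<integral>\<^sup>+z. ennreal (exp (- ((s * w c)\<^sup>2 / 8))) * ennreal (exp (s * w c * (z - \<mu> c))) \<partial>\<nu> c)"
        using False by (intro nn_integral_cong) (simp add: f_def flip: ennreal_mult exp_add)
      also have "\<dots> = ennreal (exp (- ((s * w c)\<^sup>2 / 8))) * (\<integral>\<^sup>+z. ennreal (exp (s * w c * (z - \<mu> c))) \<partial>\<nu> c)"
        by (intro nn_integral_cmult) measurable
      also have "\<dots> \<le> ennreal (exp (- ((s * w c)\<^sup>2 / 8))) * ennreal (exp ((s * w c)\<^sup>2 / 8))"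
        using hoeffding_unit_interval[OF sets_\<nu>[OF c] prob_space_\<nu>[OF c]]
        unfolding mean_def by (intro mult_left_mono) auto
      also have "\<dots> = 1"
        by (simp add: exp_minus flip: ennreal_mult)
      finally have "(\<integral>\<^sup>+z. f c z \<partial>\<nu> c) * (\<integral>\<^sup>+\<omega>. G c \<omega> \<partial>M) \<le> 1 * (\<integral>\<^sup>+\<omega>. G c \<omega> \<partial>M)"
        by (rule mult_right_mono) simp
      then show ?thesis
        by (subst nn_integral_fresh[OF c lessI _ G pG]) simp_all
    qed
    have "(\<integral>\<^sup>+\<omega>. H (Suc t) \<omega> \<partial>M)
        \<le> (\<integral>\<^sup>+\<omega>. K \<omega> + (\<Sum>c\<in>{0..arms S}. f c (fst \<omega> (c, Suc t)) * G c \<omega>) \<partial>M)"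
      by (intro nn_integral_mono up)
    also have "\<dots> = (\<integral>\<^sup>+\<omega>. K \<omega> \<partial>M) + (\<Sum>c\<in>{0..arms S}. (\<integral>\<^sup>+\<omega>. f c (fst \<omega> (c, Suc t)) * G c \<omega> \<partial>M))"
      by (subst nn_integral_add) (auto simp: nn_integral_sum)
    also have "\<dots> \<le> (\<integral>\<^sup>+\<omega>. K \<omega> \<partial>M) + (\<Sum>c\<in>{0..arms S}. (\<integral>\<^sup>+\<omega>. G c \<omega> \<partial>M))"
      by (intro add_left_mono sum_mono fG)
    also have "\<dots> = (\<integral>\<^sup>+\<omega>. K \<omega> + (\<Sum>c\<in>{0..arms S}. G c \<omega>) \<partial>M)"
      by (subst nn_integral_add) (auto simp: nn_integral_sum)
    also have "\<dots> = (\<integral>\<^sup>+\<omega>. H t \<omega> \<partial>M)"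
    proof (rule nn_integral_cong)
      fix \<omega> assume \<omega>: "\<omega> \<in> space M"
      have "(\<Sum>c\<in>{0..arms S}. G c \<omega>) = (\<Sum>c\<in>{collect t \<omega>}. G c \<omega>)"
        using collect_le[OF \<omega>, of t] by (intro sum.mono_neutral_right) (auto simp: G_def)
      then show "K \<omega> + (\<Sum>c\<in>{0..arms S}. G c \<omega>) = H t \<omega>"
        by (auto simp: K_def G_def H_def)
    qed
    finally show ?thesis .
  qed
  have Ht: "(\<integral>\<^sup>+\<omega>. H t1 \<omega> \<partial>M) \<le> emeasure M {\<omega>\<in>space M. A \<omega>}"
    using True
  proof (induction t1 rule: dec_induct)
    case base then show ?case by (rule H0)
  next
    case (step n) then show ?case using \<open>\<And>t. t0 \<le> t \<Longrightarrow> _ t \<le> _\<close>[of n] by (meson order_trans)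
  qed
  have "ennreal (exp b) * emeasure M {\<omega>\<in>space M. A \<omega> \<and> X t1 \<omega>} \<le> (\<integral>\<^sup>+\<omega>. H t1 \<omega> \<partial>M)"
  proof -
    have "ennreal (exp b) * emeasure M {\<omega>\<in>space M. A \<omega> \<and> X t1 \<omega>} =
        (\<integral>\<^sup>+\<omega>. ennreal (exp b) * indicator {\<omega>\<in>space M. A \<omega> \<and> X t1 \<omega>} \<omega> \<partial>M)"
      by (subst nn_integral_cmult_indicator) auto
    also have "\<dots> \<le> (\<integral>\<^sup>+\<omega>. H t1 \<omega> \<partial>M)"
      by (intro nn_integral_mono) (auto simp: H_def indicator_def)
    finally show ?thesis .
  qed
  also note Ht
  finally have "exp b * \<P>(\<omega> in M. A \<omega> \<and> X t1 \<omega>) \<le> \<P>(\<omega> in M. A \<omega>)"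
    by (simp add: emeasure_eq_measure flip: ennreal_mult)
  then show ?thesis
    unfolding X_def L_def by (simp add: exp_minus field_simps)
qed

end

section \<open>Crossing the elimination threshold\<close>

lemma geometric_grid:
  fixes \<rho> y :: real
  assumes "1 < \<rho>" "1 \<le> y" "y < \<rho> ^ N"
  obtains n where "n < N" "\<rho> ^ n \<le> y" "y < \<rho> ^ Suc n"
proof -
  define n where "n = (LEAST n. y < \<rho> ^ Suc n)"
  have "N \<noteq> 0" using assms by (cases N) auto
  then have ex: "y < \<rho> ^ Suc (N - 1)" using assms by simp
  have n: "y < \<rho> ^ Suc n" unfolding n_def by (rule LeastI) (rule ex)
  have "n \<le> N - 1" unfolding n_def by (rule Least_le) (rule ex)
  moreover have "\<rho> ^ n \<le> y"
  proof (cases n)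
    case (Suc j)
    then have "\<not> y < \<rho> ^ Suc j" using not_less_Least[of j "\<lambda>n. y < \<rho> ^ Suc n"] by (simp add: n_def)
    then show ?thesis using Suc by simp
  qed (use assms in simp)
  ultimately show ?thesis using n \<open>N \<noteq> 0\<close> by (intro that[of n]) auto
qed

text \<open>The exponent at slope \<open>s = sqrt (2 l / Q)\<close>, which is optimal for the boundary
  \<open>sqrt (q l / 2)\<close> at \<open>q = Q\<close>, loses at most \<open>1/2\<close> as long as \<open>sqrt (q / Q) \<le> 1 + 1 / sqrt l\<close>.\<close>

lemma slope_bound:
  fixes Q q l \<Delta> :: real
  assumes l: "1 \<le> l" and Q: "0 < Q" and q: "Q \<le> q" "sqrt q \<le> sqrt Q * (1 + 1 / sqrt l)" and \<Delta>: "0 \<le> \<Delta>"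
  defines "s \<equiv> sqrt (2 * l / Q)"
  shows "l / 2 - 1 / 2 + \<Delta> * sqrt (2 * l * Q) \<le> s * (sqrt (q * l / 2) + \<Delta> * q) - s\<^sup>2 / 4 * q"
proof -
  define x where "x = sqrt (q / Q)"
  have x1: "1 \<le> x" using Q q by (simp add: x_def)
  have "x * sqrt Q = sqrt q" using Q by (simp add: x_def real_sqrt_divide)
  then have "sqrt Q * x \<le> sqrt Q * (1 + 1 / sqrt l)" using q(2) by (simp add: mult.commute)
  then have x2: "x \<le> 1 + 1 / sqrt l"
    using Q by (subst (asm) mult_le_cancel_left_pos) simp_all
  have x_sq: "x\<^sup>2 = q / Q" using Q q by (simp add: x_def)
  \<comment> \<open>The loss is explicit: l x - l x^2 / 2 = l / 2 - l (x - 1)^2 / 2.\<close>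
  have "(x - 1)\<^sup>2 \<le> (1 / sqrt l)\<^sup>2"
    using x1 x2 by (intro power_mono) auto
  then have "l * (x - 1)\<^sup>2 \<le> 1"
    using l by (simp add: power_divide field_simps)
  then have a: "l / 2 - 1 / 2 \<le> l * x - l * x\<^sup>2 / 2"
    by (simp add: power2_eq_square algebra_simps)
  have "s * sqrt (q * l / 2) = sqrt (l\<^sup>2 * (q / Q))"
    unfolding s_def real_sqrt_mult[symmetric] by (simp add: power2_eq_square)
  also have "\<dots> = l * x" unfolding real_sqrt_mult[of "l\<^sup>2"] x_def using l by simp
  finally have b: "s * sqrt (q * l / 2) = l * x" .
  have c: "s\<^sup>2 / 4 * q = l * x\<^sup>2 / 2" using l Q by (simp add: s_def x_sq)
  have "s * Q = sqrt (2 * l / Q) * sqrt (Q\<^sup>2)" using Q by (simp add: s_def)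
  also have "\<dots> = sqrt (2 * l * Q)"
    unfolding real_sqrt_mult[symmetric] using Q by (simp add: power2_eq_square)
  finally have "s * Q = sqrt (2 * l * Q)" .
  moreover have "s * Q \<le> s * q" using q l Q by (intro mult_left_mono) (auto simp: s_def)
  ultimately have "\<Delta> * sqrt (2 * l * Q) \<le> s * (\<Delta> * q)"
    using \<Delta> by (metis mult.left_commute mult_left_mono)
  then show ?thesis using a b c by (simp add: algebra_simps)
qed

text \<open>By Bernoulli's inequality the n-th exponent is at least y n, so the sum is dominated by
  a geometric series of ratio exp (- y). The bound is free of N: a positive gap removes the size of
  the grid from the estimate.\<close>

lemma exp_geometric_sum:
  fixes y l :: real
  assumes y: "0 < y" and l: "1 \<le> l"
  shows "(\<Sum>n<N. exp (- (y * sqrt l * (1 + 1 / sqrt l) ^ n))) \<le> 1 + 1 / y"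
proof -
  let ?r = "exp (- y)"
  have r: "0 < ?r" "?r < 1" using y by auto
  have "exp (- (y * sqrt l * (1 + 1 / sqrt l) ^ n)) \<le> ?r ^ n" for n
  proof -
    have "1 + real n * (1 / sqrt l) \<le> (1 + 1 / sqrt l) ^ n"
      using l by (intro Bernoulli_inequality) (auto intro: order_trans[of _ 0])
    then have "sqrt l * (1 + real n * (1 / sqrt l)) \<le> sqrt l * (1 + 1 / sqrt l) ^ n"
      using l by (intro mult_left_mono) auto
    moreover have "real n \<le> sqrt l * (1 + real n * (1 / sqrt l))"
      using l by (simp add: field_simps)
    ultimately have "real n \<le> sqrt l * (1 + 1 / sqrt l) ^ n" by linarith
    then have "y * real n \<le> y * (sqrt l * (1 + 1 / sqrt l) ^ n)"
      using y by (intro mult_left_mono) auto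
    then show ?thesis
      by (simp add: exp_of_nat_mult[symmetric] mult.commute mult.left_commute)
  qed
  then have "(\<Sum>n<N. exp (- (y * sqrt l * (1 + 1 / sqrt l) ^ n))) \<le> (\<Sum>n<N. ?r ^ n)"
    by (intro sum_mono)
  also have "\<dots> \<le> 1 / (1 - ?r)"
    using r by (simp add: sum_gp_strict divide_right_mono)
  also have "\<dots> \<le> 1 + 1 / y"
  proof -
    have "1 + y \<le> exp y" by (rule exp_ge_add_one_self)
    then have "?r \<le> 1 / (1 + y)" using y by (simp add: exp_minus field_simps)
    then have "y / (1 + y) \<le> 1 - ?r" using y by (simp add: field_simps)
    then have "1 / (1 - ?r) \<le> 1 / (y / (1 + y))"
      using y by (intro divide_left_mono) (auto intro!: mult_pos_pos simp: add_pos_pos)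
    also have "\<dots> = 1 + 1 / y" using y by (simp add: field_simps)
    finally show ?thesis .
  qed
  finally show ?thesis .
qed

locale arp_large = arp_model +
  assumes ell_ge: "1 \<le> ln (real (horizon S) * theta S)"
    and horizon_pos: "1 \<le> horizon S"
begin

abbreviation T :: nat where "T \<equiv> horizon S"

definition ell :: real where "ell = ln (real (horizon S) * theta S)"

lemma ell: "1 \<le> ell" using ell_ge by (simp add: ell_def)

text \<open>The number of factors 1 + 1 / sqrt ell that exceeds sqrt T, an upper bound for sqrt (q /
  k); it comes from ln (1 + r) \<ge> r / 2 for 0 < r \<le> 1.\<close>

definition grid_size :: nat where "grid_size = nat \<lceil>sqrt ell * ln (real T)\<rceil> + 1"

lemma grid_size: "sqrt (real T) < (1 + 1 / sqrt ell) ^ grid_size"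
proof -
  define r where "r = 1 / sqrt ell"
  have r: "0 < r" "r \<le> 1" using ell by (auto simp: field_simps r_def)
  have lnr: "r / 2 \<le> ln (1 + r)"
  proof -
    have "r / 2 \<le> r / (1 + r)" using r by (intro divide_left_mono mult_pos_pos) linarith+
    moreover have "r / (1 + r) \<le> ln (1 + r)"
    proof -
      have "ln (inverse (1 + r)) \<le> inverse (1 + r) - 1"
        using r by (intro ln_le_minus_one) auto
      then have "1 - inverse (1 + r) \<le> ln (1 + r)" using r by (simp add: ln_inverse)
      moreover have "1 - inverse (1 + r) = r / (1 + r)" using r by (simp add: field_simps)
      ultimately show ?thesis by simp
    qed
    ultimately show ?thesis by linarith
  qed
  have "sqrt ell * ln (real T) < real grid_size"
    unfolding grid_size_def by linarith
  then have "ln (real T) < real grid_size * r"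
    using ell by (simp add: field_simps r_def)
  then have "ln (real T) / 2 < real grid_size * (r / 2)" by simp
  also have "\<dots> \<le> real grid_size * ln (1 + r)"
    using lnr by (intro mult_left_mono) auto
  finally have "ln (sqrt (real T)) < ln ((1 + r) ^ grid_size)"
    using r horizon_pos by (simp add: ln_sqrt ln_realpow)
  then show ?thesis
    unfolding r_def[symmetric] using r horizon_pos by (subst (asm) ln_less_cancel_iff) auto
qed

text \<open>With \<open>w = e\<^sub>j - e\<^sub>i\<close> and \<open>\<Delta> = \<mu> i - \<mu> j\<close> this says that, counting from time \<open>t0\<close>, the reward
  sum of arm \<open>j\<close> exceeds that of arm \<open>i\<close> by the elimination threshold.\<close>

definition cross :: "(nat \<Rightarrow> real) \<Rightarrow> real \<Rightarrow> nat \<Rightarrow> nat \<Rightarrow> noise \<Rightarrow> bool" where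
  "cross w \<Delta> k t0 \<omega> \<longleftrightarrow> (\<exists>t\<in>{t0..T}. \<exists>q\<in>{k..T}. wt_sum w t \<omega> - wt_sum w t0 \<omega> \<le> 2 * real q \<and>
     sqrt (real q * ell / 2) + \<Delta> * real q \<le> dev_sum w t \<omega> - dev_sum w t0 \<omega>)"

lemma measurable_cross [measurable]: "Measurable.pred M (cross w \<Delta> k t0)"
  unfolding cross_def[abs_def] by measurable

text \<open>The range of q is cut into cells starting at \<open>Q n\<close>, with
  \<open>sqrt (Q n)\<close> geometric of ratio 1 + 1 / sqrt ell. Inside a cell one slope serves all
  q by \<open>slope_bound\<close>, so a crossing there forces a gain of b n in one supermartingale,
  and Ville's inequality is applied once per cell.\<close>

lemma cross_sum:
  assumes A [measurable]: "Measurable.pred M A" and pA: "past t0 A" and k: "1 \<le> k" and \<Delta>: "0 \<le> \<Delta>"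
  shows "\<P>(\<omega> in M. A \<omega> \<and> cross w \<Delta> k t0 \<omega>) \<le>
    exp (1 / 2 - ell / 2) * (\<Sum>n<grid_size. exp (- (\<Delta> * sqrt (2 * real k) * sqrt ell * (1 + 1 / sqrt ell) ^ n)))
      * \<P>(\<omega> in M. A \<omega>)"
proof -
  define \<rho> where "\<rho> = 1 + 1 / sqrt ell"
  have \<rho>: "1 < \<rho>" using ell by (simp add: \<rho>_def)
  define Q where "Q n = real k * (\<rho> ^ n)\<^sup>2" for n
  have Q: "0 < Q n" for n using \<rho> k by (simp add: Q_def)
  have sqrtQ: "sqrt (Q n) = sqrt (real k) * \<rho> ^ n" for n
    using \<rho> by (simp add: Q_def real_sqrt_mult)
  define s where "s n = sqrt (2 * ell / Q n)" for n
  define b where "b n = ell / 2 - 1 / 2 + \<Delta> * sqrt (2 * ell * Q n)" for n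
  define E where "E n = {\<omega>\<in>space M. A \<omega> \<and>
    (\<exists>t\<in>{t0..T}. b n \<le> log_mart (s n) w t \<omega> - log_mart (s n) w t0 \<omega>)}" for n
  have [measurable]: "E n \<in> sets M" for n unfolding E_def by measurable
  have sub: "{\<omega>\<in>space M. A \<omega> \<and> cross w \<Delta> k t0 \<omega>} \<subseteq> (\<Union>n<grid_size. E n)"
  proof
    fix \<omega> assume "\<omega> \<in> {\<omega>\<in>space M. A \<omega> \<and> cross w \<Delta> k t0 \<omega>}"
    then obtain t q where \<omega>: "\<omega> \<in> space M" "A \<omega>" and t: "t \<in> {t0..T}" and q: "k \<le> q" "q \<le> T"
      and wt: "wt_sum w t \<omega> - wt_sum w t0 \<omega> \<le> 2 * real q"
      and dev: "sqrt (real q * ell / 2) + \<Delta> * real q \<le> dev_sum w t \<omega> - dev_sum w t0 \<omega>"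
      by (auto simp: cross_def)
    have "1 \<le> sqrt (real q / real k)" using q k by (simp add: field_simps)
    moreover have "sqrt (real q / real k) < \<rho> ^ grid_size"
    proof -
      have "real q / real k \<le> real q" using divide_left_mono[of 1 "real k" "real q"] k by simp
      then have "sqrt (real q / real k) \<le> sqrt (real T)"
        using q by (intro real_sqrt_le_mono) linarith
      then show ?thesis using grid_size unfolding \<rho>_def by linarith
    qed
    ultimately obtain n where n: "n < grid_size" "\<rho> ^ n \<le> sqrt (real q / real k)"
      "sqrt (real q / real k) < \<rho> ^ Suc n"
      using \<rho> by (metis geometric_grid)
    have q_eq: "sqrt (real q) = sqrt (real k) * sqrt (real q / real k)"
      unfolding real_sqrt_mult[symmetric] using k by simp
    have "sqrt (Q n) \<le> sqrt (real q)"
      unfolding sqrtQ q_eq using n k by (intro mult_left_mono) auto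
    then have Qq: "Q n \<le> real q" by simp
    have "sqrt (real q) \<le> sqrt (real k) * \<rho> ^ Suc n"
      unfolding q_eq using n k by (intro mult_left_mono) auto
    then have "sqrt (real q) \<le> sqrt (Q n) * (1 + 1 / sqrt ell)"
      unfolding sqrtQ by (simp add: \<rho>_def mult_ac)
    from slope_bound[OF ell Q Qq this \<Delta>]
    have "b n \<le> s n * (sqrt (real q * ell / 2) + \<Delta> * real q) - (s n)\<^sup>2 / 4 * real q"
      unfolding b_def s_def .
    \<comment> \<open>The variance proxy has grown by at most 2 q, the share of two arms with q
      rewards each; hence s^2 / 8 turns into s^2 / 4.\<close>
    also have "\<dots> \<le> s n * (dev_sum w t \<omega> - dev_sum w t0 \<omega>) - (s n)\<^sup>2 / 8 * (wt_sum w t \<omega> - wt_sum w t0 \<omega>)"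
    proof -
      have "0 \<le> s n" using ell Q[of n] by (simp add: s_def)
      then have "s n * (sqrt (real q * ell / 2) + \<Delta> * real q) \<le> s n * (dev_sum w t \<omega> - dev_sum w t0 \<omega>)"
        using dev by (intro mult_left_mono)
      moreover have "(s n)\<^sup>2 / 8 * (wt_sum w t \<omega> - wt_sum w t0 \<omega>) \<le> (s n)\<^sup>2 / 8 * (2 * real q)"
        using wt by (intro mult_left_mono) auto
      moreover have "(s n)\<^sup>2 / 8 * (2 * real q) = (s n)\<^sup>2 / 4 * real q" by simp
      ultimately show ?thesis by linarith
    qed
    also have "\<dots> = log_mart (s n) w t \<omega> - log_mart (s n) w t0 \<omega>"
      by (simp add: log_mart_def algebra_simps)
    finally have "\<omega> \<in> E n" using \<omega> t by (auto simp: E_def)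
    then show "\<omega> \<in> (\<Union>n<grid_size. E n)" using n by auto
  qed
  have "\<P>(\<omega> in M. A \<omega> \<and> cross w \<Delta> k t0 \<omega>) \<le> prob (\<Union>n<grid_size. E n)"
    by (intro finite_measure_mono sub) measurable
  also have "\<dots> \<le> (\<Sum>n<grid_size. prob (E n))"
    by (intro finite_measure_subadditive_finite) auto
  also have "\<dots> \<le> (\<Sum>n<grid_size. exp (- b n) * \<P>(\<omega> in M. A \<omega>))"
    unfolding E_def by (intro sum_mono ville A pA)
  also have "\<dots> = (\<Sum>n<grid_size. exp (1 / 2 - ell / 2)
      * exp (- (\<Delta> * sqrt (2 * real k) * sqrt ell * \<rho> ^ n)) * \<P>(\<omega> in M. A \<omega>))"
  proof -
    have "sqrt (2 * ell * Q n) = sqrt (2 * real k) * sqrt ell * \<rho> ^ n" for n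
      using \<rho> by (simp add: Q_def real_sqrt_mult)
    then show ?thesis
      by (simp add: b_def mult.assoc flip: exp_add)
  qed
  finally show ?thesis
    by (simp add: \<rho>_def sum_distrib_left sum_distrib_right mult.assoc)
qed

text \<open>Every cell is bounded by the same term, so this form also covers gap zero, at the price
  of the factor \<open>grid_size\<close>. The factor P(A) on the right is what lets two failures
  multiply.\<close>

lemma cross_prob:
  assumes A [measurable]: "Measurable.pred M A" and pA: "past t0 A" and k: "1 \<le> k" and \<Delta>: "0 \<le> \<Delta>"
  shows "\<P>(\<omega> in M. A \<omega> \<and> cross w \<Delta> k t0 \<omega>) \<le>
    real grid_size * exp (1 / 2 - ell / 2) * \<P>(\<omega> in M. A \<omega>)"
proof -
  have "(\<Sum>n<grid_size. exp (- (\<Delta> * sqrt (2 * real k) * sqrt ell * (1 + 1 / sqrt ell) ^ n)))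
      \<le> (\<Sum>n<grid_size. 1)"
    using \<Delta> ell by (intro sum_mono) (auto intro!: mult_nonneg_nonneg zero_le_power add_nonneg_nonneg)
  then have "exp (1 / 2 - ell / 2) * (\<Sum>n<grid_size. exp (- (\<Delta> * sqrt (2 * real k) * sqrt ell * (1 + 1 / sqrt ell) ^ n)))
      * \<P>(\<omega> in M. A \<omega>) \<le> exp (1 / 2 - ell / 2) * real grid_size * \<P>(\<omega> in M. A \<omega>)"
    by (intro mult_right_mono mult_left_mono) auto
  with cross_sum[OF A pA k \<Delta>, of w] show ?thesis by (simp add: mult.commute)
qed

text \<open>Here 1 / \<Delta> replaces \<open>grid_size\<close>; it cancels against the gap in
  \<open>expectation_drop\<close>.\<close>

lemma cross_prob_gap:
  assumes k: "1 \<le> k" and \<Delta>: "0 < \<Delta>"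
  shows "\<P>(\<omega> in M. cross w \<Delta> k 0 \<omega>) \<le> exp (1 / 2 - ell / 2) * (1 + 1 / (\<Delta> * sqrt (2 * real k)))"
proof -
  let ?s = "\<Sum>n<grid_size. exp (- (\<Delta> * sqrt (2 * real k) * sqrt ell * (1 + 1 / sqrt ell) ^ n))"
  have "\<P>(\<omega> in M. cross w \<Delta> k 0 \<omega>) \<le> exp (1 / 2 - ell / 2) * ?s"
    using cross_sum[of "\<lambda>_. True" 0 k \<Delta> w] k \<Delta> by (simp add: past_def prob_space)
  also have "\<dots> \<le> exp (1 / 2 - ell / 2) * (1 + 1 / (\<Delta> * sqrt (2 * real k)))"
    using k \<Delta> ell by (intro mult_left_mono exp_geometric_sum) auto
  finally show ?thesis .
qed

text \<open>The constants belong together: if 8 ell \<le> \<delta>^2 q, then the threshold sqrt (q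
  ell / 2) is at most \<delta> q / 4, so an arm worse by \<delta> that survives next to the better
  one has deviated by at least 3/4 \<delta> q.\<close>

definition stray :: "(nat \<Rightarrow> real) \<Rightarrow> real \<Rightarrow> noise \<Rightarrow> bool" where
  "stray w \<delta> \<omega> \<longleftrightarrow> (\<exists>t\<in>{0..T}. \<exists>q. wt_sum w t \<omega> \<le> 2 * real q \<and> 8 * ell \<le> \<delta>\<^sup>2 * real q \<and>
     3 / 4 * \<delta> * real q \<le> dev_sum w t \<omega>)"

lemma measurable_stray [measurable]: "Measurable.pred M (stray w \<delta>)"
  unfolding stray_def[abs_def] by measurable

text \<open>The deviation is linear in q, so the single slope \<delta> serves all q: the exponent is
  at least (3/4 - 1/4) \<delta>^2 q, which is at least 4 ell.\<close>

lemma stray_prob: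
  assumes "0 < \<delta>"
  shows "\<P>(\<omega> in M. stray w \<delta> \<omega>) \<le> exp (- (4 * ell))"
proof -
  have "{\<omega>\<in>space M. stray w \<delta> \<omega>} \<subseteq>
    {\<omega>\<in>space M. True \<and> (\<exists>t\<in>{0..T}. 4 * ell \<le> log_mart \<delta> w t \<omega> - log_mart \<delta> w 0 \<omega>)}"
  proof safe
    fix \<omega> assume "stray w \<delta> \<omega>"
    then obtain t q where t: "t \<in> {0..T}" and q: "wt_sum w t \<omega> \<le> 2 * real q" "8 * ell \<le> \<delta>\<^sup>2 * real q"
      "3 / 4 * \<delta> * real q \<le> dev_sum w t \<omega>" unfolding stray_def by blast
    have "\<delta> * (3 / 4 * \<delta> * real q) \<le> \<delta> * dev_sum w t \<omega>"
      using q assms by (intro mult_left_mono) auto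
    moreover have "\<delta>\<^sup>2 / 8 * wt_sum w t \<omega> \<le> \<delta>\<^sup>2 / 8 * (2 * real q)"
      using q by (intro mult_left_mono) auto
    ultimately have "4 * ell \<le> log_mart \<delta> w t \<omega>"
      using q(2) by (simp add: log_mart_def power2_eq_square)
    then show "\<exists>t\<in>{0..T}. 4 * ell \<le> log_mart \<delta> w t \<omega> - log_mart \<delta> w 0 \<omega>"
      using t by (auto simp: log_mart_def)
  qed
  then have "\<P>(\<omega> in M. stray w \<delta> \<omega>) \<le>
    \<P>(\<omega> in M. True \<and> (\<exists>t\<in>{0..T}. 4 * ell \<le> log_mart \<delta> w t \<omega> - log_mart \<delta> w 0 \<omega>))"
    by (intro finite_measure_mono) measurable
  also have "\<dots> \<le> exp (- (4 * ell)) * \<P>(\<omega> in M. True)"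
    by (rule ville) (auto simp: past_def)
  finally show ?thesis by (simp add: prob_space)
qed

end

section \<open>The elimination step\<close>

definition rew_sum :: "rewards \<Rightarrow> (nat \<times> nat) list \<Rightarrow> nat \<Rightarrow> real" where
  "rew_sum x used i = (\<Sum>s\<leftarrow>rounds_of used i. x (i, s))"

lemma arm_mean_eq: "num_used used i = q \<Longrightarrow> arm_mean x used i q = rew_sum x used i / real q"
  by (simp add: arm_mean_def rew_sum_def num_used_def)

lemma num_used_le_length: "num_used used i \<le> length used"
  by (simp add: num_used_def rounds_of_def)

lemma sum_num_used:
  assumes "fst ` set used \<subseteq> I" "finite I"
  shows "(\<Sum>i\<in>I. num_used used i) = length used"
  using assms(1)
proof (induction used rule: rev_induct)
  case (snoc p us)
  obtain j t where p: "p = (j, t)" by (cases p)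
  have j: "j \<in> I" and us: "fst ` set us \<subseteq> I" using snoc.prems by (auto simp: p)
  have "(\<Sum>i\<in>I. num_used (us @ [p]) i) = (\<Sum>i\<in>I. num_used us i + (if i = j then 1 else 0))"
    by (intro sum.cong) (auto simp: p)
  also have "\<dots> = length us + 1"
    using snoc.IH[OF us] j assms(2) by (simp add: sum.distrib)
  finally show ?case by simp
qed simp

text \<open>Arm \<open>0\<close> stands for the opportunity cost: a virtual arm with a noiseless reward.\<close>

definition rival :: "nat \<Rightarrow> nat \<Rightarrow> nat \<Rightarrow> real" where
  "rival a j = (\<lambda>l. of_bool (l = j) - of_bool (l = a))"

lemma sum_list_rival:
  assumes "\<forall>p\<in>set us. fst p \<noteq> 0" "a \<noteq> j"
  shows "(\<Sum>p\<leftarrow>us. rival a j (fst p) * (x p - c (fst p))) =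
      (if j = 0 then 0 else rew_sum x us j - c j * real (num_used us j))
      - (rew_sum x us a - c a * real (num_used us a))" (is ?dev)
    and "(\<Sum>p\<leftarrow>us. (rival a j (fst p))\<^sup>2) =
      (if j = 0 then 0 else real (num_used us j)) + real (num_used us a)" (is ?wt)
proof -
  have "?dev \<and> ?wt"
    using assms(1)
  proof (induction us rule: rev_induct)
    case (snoc p us)
    obtain i s where p: "p = (i, s)" by (cases p)
    have "rew_sum x (us @ [p]) l = rew_sum x us l + (if l = i then x p else 0)" for l
      by (simp add: rew_sum_def p)
    then show ?case
      using snoc assms(2) by (auto simp: p rival_def algebra_simps)
  qed (simp_all add: rew_sum_def)
  then show ?dev ?wt by blast+
qed

text \<open>Outside exploration the value is the default \<open>a\<close>, which keeps an anchor in
  place.\<close>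

definition leader :: "rewards \<Rightarrow> state \<Rightarrow> nat \<Rightarrow> nat" where
  "leader x = (\<lambda>(ph, used, h) a. case ph of
     Exploring B q js \<Rightarrow> hd (filter (\<lambda>i. \<forall>j\<in>set B. arm_mean x used j q \<le> arm_mean x used i q) B)
   | _ \<Rightarrow> a)"

context arp_large
begin

lemma st_used: "st t \<omega> = (fst (st t \<omega>), used t \<omega>, snd (snd (st t \<omega>)))"
  by (simp add: used_def)

lemma ok_st:
  assumes "\<omega> \<in> space M"
  shows "ok_phase t (used t \<omega>) (fst (st t \<omega>))" "length (snd (snd (st t \<omega>))) = t"
    "length (used t \<omega>) \<le> t" "fst ` set (used t \<omega>) \<subseteq> {1..arms S}"
  using st_ok[OF assms, of t] by (auto simp: ok_def used_def split_beta)

lemma st_step: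
  assumes "\<omega> \<in> space M"
  shows "quiet (fst (st t \<omega>)) (fst (st (Suc t) \<omega>)) \<or>
    reexplore (fst \<omega>) (used (Suc t) \<omega>) (fst (st t \<omega>)) (fst (st (Suc t) \<omega>))"
proof -
  obtain x u v where \<omega>: "\<omega> = (x, u, v)" by (cases \<omega>)
  have I: "rec t \<omega> = recommend S x u (fst (st t \<omega>), used t \<omega>, snd (snd (st t \<omega>)))"
    unfolding rec_def \<omega> using st_used[of t \<omega>] by (simp add: \<omega>)
  have up: "update S x v (rec t \<omega>) (fol t \<omega>) (fst (st t \<omega>), used t \<omega>, snd (snd (st t \<omega>))) =
      (fst (st (Suc t) \<omega>), used (Suc t) \<omega>, snd (snd (st (Suc t) \<omega>)))"
    using st_Suc[of t \<omega>] st_used[of t \<omega>] st_used[of "Suc t" \<omega>] by (simp add: \<omega>)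
  show ?thesis
    using update_step[OF ok_st(1,2)[OF assms] I up] by (simp add: \<omega>)
qed

text \<open>The elimination radius, rescaled from means to sums of q rewards.\<close>

definition thresh :: "nat \<Rightarrow> real" where
  "thresh q = sqrt (real q * ell / 2)"

lemma thresh_mono: "p \<le> q \<Longrightarrow> thresh p \<le> thresh q"
  using ell by (auto simp: thresh_def intro!: mult_right_mono)

lemma thresh_pos: "0 < q \<Longrightarrow> 0 < thresh q"
  using ell by (simp add: thresh_def)

lemma radius_eq:
  assumes "0 < q"
  shows "sqrt (ln (real T * theta S) / (2 * real q)) = thresh q / real q"
proof -
  have "sqrt (real q * ell / 2) / sqrt ((real q)\<^sup>2) = sqrt ((real q * ell / 2) / (real q)\<^sup>2)"
    by (simp only: real_sqrt_divide)
  also have "(real q * ell / 2) / (real q)\<^sup>2 = ell / (2 * real q)"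
    using assms by (simp add: power2_eq_square)
  finally show ?thesis by (simp add: thresh_def ell_def)
qed

lemma explore_cases:
  assumes rd: "ready us B q"
  obtains
    (one) "explore S x us B q = Exploiting (hd B)" "set B = {hd B}"
  | (none) "explore S x us B q = Exploiting 1" "\<And>i. i \<in> set B \<Longrightarrow> rew_sum x us i + thresh q < cstar S * real q"
  | (some) B' where "explore S x us B q = Exploring B' q B'" "B' \<noteq> []"
      "\<And>i. i \<in> set B' \<longleftrightarrow> i \<in> set B \<and> cstar S * real q \<le> rew_sum x us i + thresh q \<and>
        (\<forall>j\<in>set B. rew_sum x us j \<le> rew_sum x us i + thresh q)"
proof -
  have q: "0 < q" and B: "B \<noteq> []" "distinct B"
    and mean: "\<And>i. i \<in> set B \<Longrightarrow> arm_mean x us i q = rew_sum x us i / real q"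
    using rd samples_pos by (auto simp: ready_def intro: arm_mean_eq)
  show thesis
  proof (cases "length B > 1")
    case False
    then obtain b where "B = [b]" using B by (cases B) (auto simp: Suc_le_eq)
    then show ?thesis using False by (intro one) (simp_all add: explore_def)
  next
    case True
    define best where "best = Max ((\<lambda>i. arm_mean x us i q) ` set B)"
    define P where "P i \<longleftrightarrow> arm_mean x us i q + thresh q / real q \<ge> max best (cstar S)" for i
    have best: "best \<le> z \<longleftrightarrow> (\<forall>j\<in>set B. arm_mean x us j q \<le> z)" for z
      using B unfolding best_def by (subst Max_le_iff) auto
    have P: "P i \<longleftrightarrow> cstar S * real q \<le> rew_sum x us i + thresh q \<and>
        (\<forall>j\<in>set B. rew_sum x us j \<le> rew_sum x us i + thresh q)" if "i \<in> set B" for i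
      using q that by (auto simp: P_def best mean field_simps)
    have ex: "explore S x us B q = (if filter P B = [] then Exploiting 1 else Exploring (filter P B) q (filter P B))"
      using True unfolding explore_def radius_eq[OF q] P_def[abs_def] best_def Let_def by simp
    show ?thesis
    proof (cases "filter P B = []")
      case True
      \<comment> \<open>An empirically best arm passes every comparison between arms, so it can have
        failed only against the cost; all other arms lie below it.\<close>
      have "best \<in> (\<lambda>i. arm_mean x us i q) ` set B"
        unfolding best_def using B by (intro Max_in) auto
      then obtain i where i: "i \<in> set B" "best = rew_sum x us i / real q" using mean by auto
      have top: "rew_sum x us j \<le> rew_sum x us i" if "j \<in> set B" for j
        using best[of best] that i q by (auto simp: mean field_simps)
      have "\<not> P i" using True i by (auto simp: filter_empty_conv)
      then have "rew_sum x us i + thresh q < cstar S * real q"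
        using P[OF i(1)] top thresh_pos[OF q] by fastforce
      then show ?thesis
        using True ex top by (intro none) (auto intro: le_less_trans[rotated] add_right_mono)
    next
      case False
      then show ?thesis using ex P by (intro some[of "filter P B"]) auto
    qed
  qed
qed

text \<open>If anyone survives the cost test, an empirically best arm of B does so too. Hence the
  leader among the survivors leads all of B.\<close>

lemma leader_some:
  assumes rd: "ready us B q" and ex: "explore S x us B q = Exploring B' q B'" and ne: "B' \<noteq> []"
    and mem: "\<And>i. i \<in> set B' \<longleftrightarrow> i \<in> set B \<and> cstar S * real q \<le> rew_sum x us i + thresh q \<and>
        (\<forall>j\<in>set B. rew_sum x us j \<le> rew_sum x us i + thresh q)"
    and l_def: "l = leader x (Exploring B' q B', us, h) a"
  shows "l \<in> set B'" "\<And>j. j \<in> set B \<Longrightarrow> rew_sum x us j \<le> rew_sum x us l"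
proof -
  have q: "0 < q"
    and mean: "\<And>i. i \<in> set B \<Longrightarrow> arm_mean x us i q = rew_sum x us i / real q"
    using rd samples_pos by (auto simp: ready_def intro: arm_mean_eq)
  have sub: "set B' \<subseteq> set B" using mem by blast
  let ?f = "\<lambda>i. rew_sum x us i"
  have "B \<noteq> []" using rd by (simp add: ready_def)
  then have "Max (?f ` set B) \<in> ?f ` set B" by (intro Max_in) auto
  then obtain i where i: "i \<in> set B" "Max (?f ` set B) = ?f i" by auto
  have top: "?f j \<le> ?f i" if "j \<in> set B" for j
    unfolding i(2)[symmetric] using that by (intro Max_ge) auto
  obtain i0 where "i0 \<in> set B'" using ne by (cases B') auto
  then have "cstar S * real q \<le> ?f i + thresh q" using mem[of i0] top[of i0] by auto
  then have iB': "i \<in> set B'" using mem i top thresh_pos[OF q] by (smt (verit) )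
  have "l = hd (filter (\<lambda>i. \<forall>j\<in>set B'. arm_mean x us j q \<le> arm_mean x us i q) B')"
    by (simp add: l_def leader_def)
  moreover have "filter (\<lambda>i. \<forall>j\<in>set B'. arm_mean x us j q \<le> arm_mean x us i q) B' \<noteq> []"
    using iB' top sub i(1) q by (auto simp: filter_empty_conv mean subset_iff divide_right_mono intro!: bexI[of _ i])
  ultimately have "l \<in> set (filter (\<lambda>i. \<forall>j\<in>set B'. arm_mean x us j q \<le> arm_mean x us i q) B')"
    by (metis (lifting) hd_in_set)
  then have l: "l \<in> set B'" "arm_mean x us i q \<le> arm_mean x us l q" using iB' by auto
  then show "l \<in> set B'" by simp
  have "?f i \<le> ?f l" using l sub i(1) q by (auto simp: mean subset_iff divide_le_cancel)
  then show "\<And>j. j \<in> set B \<Longrightarrow> ?f j \<le> ?f l" using top by (meson order_trans)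
qed

lemma explore_dead:
  assumes rd: "ready us B q" and a: "a \<in> set B" "a \<notin> alive (explore S x us B q)"
  shows "rew_sum x us a + thresh q \<le> cstar S * real q \<or>
    (\<exists>B'. explore S x us B q = Exploring B' q B' \<and> set B' \<subseteq> set B \<and>
       (let l = leader x (Exploring B' q B', us, h) a in l \<in> set B' \<and>
        rew_sum x us a + thresh q \<le> rew_sum x us l \<and> cstar S * real q \<le> rew_sum x us l \<and>
        (\<forall>j\<in>set B. rew_sum x us j \<le> rew_sum x us l)))"
  using rd
proof (cases rule: explore_cases[where x = x])
  case one
  then show ?thesis using a by (simp add: alive_def)
next
  case none
  then show ?thesis using a(1) by fastforce
next
  case (some B')
  note l = leader_some[OF rd some refl, where h = h and a = a]
  let ?l = "leader x (Exploring B' q B', us, h) a"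
  have "a \<notin> set B'" using a some(1) by (simp add: alive_def)
  then consider "rew_sum x us a + thresh q < cstar S * real q"
    | j where "j \<in> set B" "rew_sum x us a + thresh q < rew_sum x us j" using some(3) a(1) by force
  then show ?thesis
  proof cases
    case 2
    then have "rew_sum x us a + thresh q \<le> rew_sum x us ?l" using l(2)[OF 2(1)] by linarith
    moreover have "set B' \<subseteq> set B" using some(3) by blast
    \<comment> \<open>If the leader itself is below the cost, then so is \<open>a\<close> by the
      full threshold, which is the first alternative.\<close>
    ultimately show ?thesis
      using some(1) l by (cases "cstar S * real q \<le> rew_sum x us ?l") (auto simp: Let_def)
  qed auto
qed

end

section \<open>The anchor\<close>

locale arp_best = arp_large +
  fixes b :: nat
  assumes b: "b \<in> {1..arms S}" and b_max: "\<And>i. i \<in> {1..arms S} \<Longrightarrow> mean \<nu> i \<le> mean \<nu> b"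
    and b_cost: "cstar S < mean \<nu> b"
begin

definition gap :: "nat \<Rightarrow> real" where "gap i = \<mu> b - \<mu> i"

definition worth :: "nat \<Rightarrow> real" where "worth j = (if j = 0 then cstar S else \<mu> j)"

abbreviation pulls :: "nat \<Rightarrow> noise \<Rightarrow> nat \<Rightarrow> nat" where
  "pulls t \<omega> \<equiv> num_used (used t \<omega>)"

abbreviation total :: "nat \<Rightarrow> noise \<Rightarrow> nat \<Rightarrow> real" where
  "total t \<omega> \<equiv> rew_sum (fst \<omega>) (used t \<omega>)"

abbreviation phase_at :: "nat \<Rightarrow> noise \<Rightarrow> phase" where
  "phase_at t \<omega> \<equiv> fst (st t \<omega>)"

lemma dev_sum_rival:
  assumes "\<omega> \<in> space M" "a \<noteq> j"
  shows "dev_sum (rival a j) t \<omega> = (if j = 0 then 0 else total t \<omega> j - \<mu> j * pulls t \<omega> j)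
      - (total t \<omega> a - \<mu> a * pulls t \<omega> a)"
    and "wt_sum (rival a j) t \<omega> = (if j = 0 then 0 else pulls t \<omega> j) + pulls t \<omega> a"
proof -
  have "\<forall>p\<in>set (used t \<omega>). fst p \<noteq> 0" using ok_st(4)[OF assms(1), of t] by force
  note * = sum_list_rival(1)[OF this assms(2), where c = \<mu>] sum_list_rival(2)[OF this assms(2)]
  show "dev_sum (rival a j) t \<omega> = (if j = 0 then 0 else total t \<omega> j - \<mu> j * pulls t \<omega> j)
      - (total t \<omega> a - \<mu> a * pulls t \<omega> a)"
    unfolding dev_sum_def *(1) by simp
  show "wt_sum (rival a j) t \<omega> = (if j = 0 then 0 else pulls t \<omega> j) + pulls t \<omega> a"
    unfolding wt_sum_def *(2) by simp
qed

lemma crossI: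
  assumes \<omega>: "\<omega> \<in> space M" and t: "t0 \<le> t" "t \<le> T" and a: "a \<noteq> j"
    and pa: "pulls t \<omega> a = pulls t0 \<omega> a + n" and pj: "j \<noteq> 0 \<Longrightarrow> pulls t \<omega> j = pulls t0 \<omega> j + n"
    and k: "k \<le> n"
    and gain: "total t \<omega> a - total t0 \<omega> a + thresh n \<le>
      (if j = 0 then cstar S * real n else total t \<omega> j - total t0 \<omega> j)"
  shows "cross (rival a j) (\<mu> a - worth j) k t0 \<omega>"
proof -
  \<comment> \<open>Every collected reward uses up a round.\<close>
  have "n \<le> T"
    using pa num_used_le_length[of "used t \<omega>" a] ok_st(3)[OF \<omega>, of t] t by linarith
  moreover have "wt_sum (rival a j) t \<omega> - wt_sum (rival a j) t0 \<omega> \<le> 2 * real n"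
    using pa pj by (simp add: dev_sum_rival(2)[OF \<omega> a])
  moreover have "sqrt (real n * ell / 2) + (\<mu> a - worth j) * real n \<le>
      dev_sum (rival a j) t \<omega> - dev_sum (rival a j) t0 \<omega>"
    unfolding dev_sum_rival(1)[OF \<omega> a] using pa pj gain
    by (cases "j = 0") (simp_all add: worth_def thresh_def algebra_simps)
  ultimately show ?thesis
    unfolding cross_def using t k by (intro bexI[of _ t] bexI[of _ n]) auto
qed

text \<open>The current holder of the role of the best arm.\<close>

primrec anchor :: "nat \<Rightarrow> noise \<Rightarrow> nat" where
  "anchor 0 \<omega> = b"
| "anchor (Suc t) \<omega> = (if anchor t \<omega> \<in> alive (phase_at (Suc t) \<omega>) then anchor t \<omega>
     else leader (fst \<omega>) (st (Suc t) \<omega>) (anchor t \<omega>))"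

definition switch :: "nat \<Rightarrow> nat \<Rightarrow> noise \<Rightarrow> bool" where
  "switch t a \<omega> \<longleftrightarrow> anchor t \<omega> = a \<and> anchor (t - 1) \<omega> \<noteq> a"

lemma measurable_leader: "(\<lambda>\<omega>. leader (fst \<omega>) \<sigma> a) \<in> measurable M (count_space UNIV)"
proof -
  obtain ph us h where \<sigma>: "\<sigma> = (ph, us, h)" by (cases \<sigma>)
  show ?thesis
  proof (cases ph)
    case (Exploring B q js)
    have "Measurable.pred M (\<lambda>\<omega>. \<forall>j\<in>set B. arm_mean (fst \<omega>) us j q \<le> arm_mean (fst \<omega>) us i q)" for i
      by measurable
    from measurable_compose[OF measurable_filter_list[where P = "\<lambda>i \<omega>. \<forall>j\<in>set B.
        arm_mean (fst \<omega>) us j q \<le> arm_mean (fst \<omega>) us i q", OF this, of B], of hd "count_space UNIV"]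
    show ?thesis by (simp add: leader_def \<sigma> Exploring)
  qed (simp_all add: leader_def \<sigma>)
qed

lemma measurable_anchor [measurable]: "anchor t \<in> measurable M (count_space UNIV)"
proof (induction t)
  case (Suc t)
  show ?case
    unfolding anchor.simps[abs_def]
  proof (rule measurable_compose_countable3[where e = "\<lambda>_. ()" and
        f = "\<lambda>\<sigma> a (_ :: unit) \<omega>. if a \<in> alive (fst \<sigma>) then a else leader (fst \<omega>) \<sigma> a",
        OF _ measurable_st Suc])
    fix \<sigma> a
    show "(\<lambda>\<omega>. if a \<in> alive (fst \<sigma>) then a else leader (fst \<omega>) \<sigma> a) \<in> measurable M (count_space UNIV)"
      using measurable_leader by (cases "a \<in> alive (fst \<sigma>)") simp_all
  qed simp
qed simp

lemma anchor_past: "past t (anchor t)"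
proof (induction t)
  case (Suc t)
  show ?case
    unfolding past_def
  proof (intro allI impI)
    fix x x' u v assume sp: "(x, u, v) \<in> space M" "(x', u, v) \<in> space M" and ag: "agree (Suc t) x x'"
    have a: "anchor t (x, u, v) = anchor t (x', u, v)"
      by (rule pastD[OF Suc sp agree_mono[OF ag]]) simp
    have s: "st (Suc t) (x, u, v) = st (Suc t) (x', u, v)"
      by (rule pastD[OF st_past sp ag])
    have eq: "\<And>i s. (i, s) \<in> set (used (Suc t) (x, u, v)) \<Longrightarrow> x (i, s) = x' (i, s)"
      using used_agree[OF _ ag] st_ok[OF sp(1), of "Suc t"] st_used[of "Suc t" "(x, u, v)"] by metis
    obtain ph us h where st: "st (Suc t) (x, u, v) = (ph, us, h)" by (cases "st (Suc t) (x, u, v)")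
    have "leader x (ph, us, h) d = leader x' (ph, us, h) d" for d
      unfolding leader_def using arm_mean_cong[of us x x'] eq by (auto simp: used_def st split: phase.splits)
    then show "anchor (Suc t) (x, u, v) = anchor (Suc t) (x', u, v)"
      using a s st by simp
  qed
qed (simp add: past_def)

lemma measurable_switch [measurable]: "Measurable.pred M (switch t a)"
  unfolding switch_def[abs_def] by measurable

text \<open>A take-over is an event of the past, so Ville's inequality can be restarted from
  it.\<close>

lemma switch_past: "past t (switch t a)"
  unfolding switch_def[abs_def]
  by (rule past_compose2[where f = "\<lambda>x y. x = a \<and> y \<noteq> a"])
    (rule anchor_past, rule past_mono[OF anchor_past], simp)

section \<open>The exceptional events\<close>

definition first_kill :: "nat \<Rightarrow> noise \<Rightarrow> bool" where
  "first_kill j \<omega> \<longleftrightarrow> cross (rival b j) (\<mu> b - worth j) (samples S) 0 \<omega>"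

text \<open>After a take-over the comparison may rest on a single new reward, hence the 1 in place
  of k. The union over all t0 is affordable because the probabilities of the take-overs have a sum
  free of any factor T, see \<open>switch_prob\<close>.\<close>

definition later_kill :: "noise \<Rightarrow> bool" where
  "later_kill \<omega> \<longleftrightarrow> (\<exists>t0\<in>{1..T}. \<exists>a\<in>{1..arms S}. \<exists>j\<in>{0..arms S}. j \<noteq> a \<and> worth j \<le> \<mu> a \<and>
     switch t0 a \<omega> \<and> cross (rival a j) (\<mu> a - worth j) 1 t0 \<omega>)"

definition strayed :: "noise \<Rightarrow> bool" where
  "strayed \<omega> \<longleftrightarrow> (\<exists>a\<in>{1..arms S}. \<exists>j\<in>{1..arms S}. \<mu> j < \<mu> a \<and> stray (rival a j) (\<mu> a - \<mu> j) \<omega>)"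

definition cheap_kill :: "noise \<Rightarrow> bool" where
  "cheap_kill \<omega> \<longleftrightarrow> (\<exists>j\<in>{0..arms S}. worth j \<le> cstar S \<and> first_kill j \<omega>)"

text \<open>A random upper bound for the gap of the anchor on good paths. A sum over all arms in
  place of the arm actually taking over makes the expectation linear.\<close>

definition drop :: "noise \<Rightarrow> real" where
  "drop \<omega> = (\<Sum>i\<in>{1..arms S} - {b}. gap i * of_bool (first_kill i \<omega>))"

definition bad :: "noise \<Rightarrow> bool" where
  "bad \<omega> \<longleftrightarrow> cheap_kill \<omega> \<or> later_kill \<omega> \<or> strayed \<omega>"

lemma gap_nonneg: "i \<in> {1..arms S} \<Longrightarrow> 0 \<le> gap i"
  using b_max by (simp add: gap_def)

lemma gap_le_drop: "i \<in> {1..arms S} \<Longrightarrow> i \<noteq> b \<Longrightarrow> first_kill i \<omega> \<Longrightarrow> gap i \<le> drop \<omega>"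
  unfolding drop_def
  using member_le_sum[of i "{1..arms S} - {b}" "\<lambda>i. gap i * of_bool (first_kill i \<omega>)"] gap_nonneg
  by auto

lemma drop_nonneg: "0 \<le> drop \<omega>"
  unfolding drop_def using gap_nonneg by (intro sum_nonneg) auto

lemma quiet_alive: "quiet ph ph' \<Longrightarrow> alive ph' = alive ph"
  by (auto simp: quiet_def alive_def split: phase.splits)

lemma kill_best:
  assumes \<omega>: "\<omega> \<in> space M" and t: "Suc t \<le> T"
    and re: "ready (used (Suc t) \<omega>) B q"  and bB: "b \<in> set B"
  shows "total (Suc t) \<omega> b + thresh q \<le> cstar S * real q \<Longrightarrow> first_kill 0 \<omega>"
    and "l \<in> set B \<Longrightarrow> l \<noteq> b \<Longrightarrow> total (Suc t) \<omega> b + thresh q \<le> total (Suc t) \<omega> l \<Longrightarrow> first_kill l \<omega>"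
proof -
  have p: "pulls (Suc t) \<omega> i = q" if "i \<in> set B" for i using re that by (simp add: ready_def)
  have k: "samples S \<le> q" using re by (simp add: ready_def)
  have z: "total 0 \<omega> i = 0" "pulls 0 \<omega> i = 0" for i by (simp_all add: rew_sum_def)
  show "total (Suc t) \<omega> b + thresh q \<le> cstar S * real q \<Longrightarrow> first_kill 0 \<omega>"
    unfolding first_kill_def using b p[OF bB] k t z
    by (intro crossI[OF \<omega>, of 0 "Suc t" b 0 q]) auto
  have "l \<noteq> 0" if "l \<in> set B" using re that by (auto simp: ready_def)
  then show "l \<in> set B \<Longrightarrow> l \<noteq> b \<Longrightarrow> total (Suc t) \<omega> b + thresh q \<le> total (Suc t) \<omega> l \<Longrightarrow> first_kill l \<omega>"
    unfolding first_kill_def using p[OF bB] p k t z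
    by (intro crossI[OF \<omega>, of 0 "Suc t" b l q]) auto
qed

text \<open>What is remembered about an anchor that took over at time \<open>t0\<close>: it then led all arms that
  are still alive, and the opportunity cost.\<close>

definition took_over :: "nat \<Rightarrow> nat \<Rightarrow> nat \<Rightarrow> noise \<Rightarrow> bool" where
  "took_over a t0 t \<omega> \<longleftrightarrow> 1 \<le> t0 \<and> t0 \<le> t \<and> switch t0 a \<omega> \<and> cstar S < \<mu> a \<and> gap a \<le> drop \<omega> \<and>
     (\<exists>B0 q0. a \<in> set B0 \<and> alive (phase_at t \<omega>) \<subseteq> set B0 \<and>
       (\<forall>i\<in>set B0. pulls t0 \<omega> i = q0 \<and> total t0 \<omega> i \<le> total t0 \<omega> a) \<and> cstar S * real q0 \<le> total t0 \<omega> a \<and>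
       (\<forall>B q js. phase_at t \<omega> = Exploring B q js \<longrightarrow> q0 \<le> q) \<and>
       (\<forall>i a n. phase_at t \<omega> \<noteq> Sampling i a n))"

text \<open>The last clause is what bounds the loss against the anchor: an arm still surviving
  beside it is worse by at most sqrt (8 ell / q).\<close>

definition inv :: "nat \<Rightarrow> noise \<Rightarrow> bool" where
  "inv t \<omega> \<longleftrightarrow> anchor t \<omega> \<in> alive (phase_at t \<omega>) \<and>
     (anchor t \<omega> = b \<or> (\<exists>t0. took_over (anchor t \<omega>) t0 t \<omega>)) \<and>
     (\<forall>B q js. phase_at t \<omega> = Exploring B q js \<longrightarrow>
        (\<forall>a\<in>set B. \<forall>j\<in>set B. \<mu> j < \<mu> a \<longrightarrow> (\<mu> a - \<mu> j)\<^sup>2 * real q \<le> 8 * ell))"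

lemma inv_gap: "inv t \<omega> \<Longrightarrow> gap (anchor t \<omega>) \<le> drop \<omega>"
  using drop_nonneg[of \<omega>] by (auto simp: inv_def took_over_def gap_def)

lemma coalive_gap:
  assumes \<omega>: "\<omega> \<in> space M" and good: "\<not> bad \<omega>" and t: "Suc t \<le> T"
    and rd: "ready (used (Suc t) \<omega>) B q"
    and ij: "a \<in> set B" "j \<in> set B" "total (Suc t) \<omega> a \<le> total (Suc t) \<omega> j + thresh q" "\<mu> j < \<mu> a"
  shows "(\<mu> a - \<mu> j)\<^sup>2 * real q \<le> 8 * ell"
proof (rule ccontr)
  assume "\<not> ?thesis"
  then have big: "8 * ell \<le> (\<mu> a - \<mu> j)\<^sup>2 * real q" by simp
  define \<delta> where "\<delta> = \<mu> a - \<mu> j"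
  have \<delta>: "0 < \<delta>" using ij by (simp add: \<delta>_def)
  have arms: "a \<in> {1..arms S}" "j \<in> {1..arms S}" using rd ij by (auto simp: ready_def)
  have neq: "a \<noteq> j" using ij by auto
  have p: "pulls (Suc t) \<omega> a = q" "pulls (Suc t) \<omega> j = q" using rd ij by (auto simp: ready_def)
  have "real q * ell / 2 \<le> (\<delta> * real q / 4)\<^sup>2"
  proof -
    have "real q * (8 * ell) \<le> real q * (\<delta>\<^sup>2 * real q)"
      using big unfolding \<delta>_def by (intro mult_left_mono) auto
    then show ?thesis by (simp add: power2_eq_square algebra_simps)
  qed
  then have "thresh q \<le> \<delta> * real q / 4"
    unfolding thresh_def using \<delta> by (intro real_le_lsqrt) auto
  moreover have "dev_sum (rival a j) (Suc t) \<omega> = total (Suc t) \<omega> j - total (Suc t) \<omega> a + \<delta> * real q"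
    unfolding dev_sum_rival(1)[OF \<omega> neq] p \<delta>_def using arms by (simp add: algebra_simps)
  ultimately have "3 / 4 * \<delta> * real q \<le> dev_sum (rival a j) (Suc t) \<omega>"
    using ij(3) by linarith
  moreover have "wt_sum (rival a j) (Suc t) \<omega> \<le> 2 * real q"
    using p by (simp add: dev_sum_rival(2)[OF \<omega> neq])
  ultimately have "stray (rival a j) \<delta> \<omega>"
    unfolding stray_def using t big unfolding \<delta>_def by (intro bexI[of _ "Suc t"] exI[of _ q]) auto
  then have "strayed \<omega>" unfolding strayed_def \<delta>_def using arms ij by blast
  then show False using good by (simp add: bad_def)
qed

text \<open>Only elimination tests matter. Losing to the cost is excluded: for b it would be a
  \<open>cheap_kill\<close>, for a later anchor a \<open>later_kill\<close>. If b loses to a leader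
  l, this is a \<open>first_kill\<close> of l, whose gap is counted in \<open>drop\<close>. If a
  later anchor loses to l, the absence of a \<open>later_kill\<close> forces l to be strictly
  better, so the gap shrinks.\<close>

lemma inv_Suc:
  assumes \<omega>: "\<omega> \<in> space M" and good: "\<not> bad \<omega>" and inv: "inv t \<omega>" and t: "Suc t \<le> T"
  shows "inv (Suc t) \<omega>"
  using st_step[OF \<omega>, of t]
proof
  assume q: "quiet (phase_at t \<omega>) (phase_at (Suc t) \<omega>)"
  have al: "alive (phase_at (Suc t) \<omega>) = alive (phase_at t \<omega>)" using quiet_alive[OF q] .
  have anc: "anchor (Suc t) \<omega> = anchor t \<omega>" using inv by (simp add: al inv_def)
  have ex: "\<exists>js'. phase_at t \<omega> = Exploring B q js'" if "phase_at (Suc t) \<omega> = Exploring B q js" for B q js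
    using q that by (auto simp: quiet_def split: phase.splits)
  have samp: "\<exists>i' a' n'. phase_at t \<omega> = Sampling i' a' n'" if "phase_at (Suc t) \<omega> = Sampling i a n" for i a n
    using q that by (auto simp: quiet_def split: phase.splits)
  have "took_over a t0 (Suc t) \<omega>" if to: "took_over a t0 t \<omega>" for a t0
  proof -
    obtain B0 q0 where *: "a \<in> set B0" "alive (phase_at t \<omega>) \<subseteq> set B0"
       "\<forall>i\<in>set B0. pulls t0 \<omega> i = q0 \<and> total t0 \<omega> i \<le> total t0 \<omega> a" "cstar S * real q0 \<le> total t0 \<omega> a"
       "\<forall>B q js. phase_at t \<omega> = Exploring B q js \<longrightarrow> q0 \<le> q" "\<forall>i a n. phase_at t \<omega> \<noteq> Sampling i a n"
      and to': "1 \<le> t0" "t0 \<le> t" "switch t0 a \<omega>" "cstar S < \<mu> a" "gap a \<le> drop \<omega>"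
      using to unfolding took_over_def by blast
    have "\<forall>B q js. phase_at (Suc t) \<omega> = Exploring B q js \<longrightarrow> q0 \<le> q"
      using ex *(5) by blast
    moreover have "\<forall>i a n. phase_at (Suc t) \<omega> \<noteq> Sampling i a n"
      using samp *(6) by blast
    ultimately show ?thesis
      unfolding took_over_def al using to' *(1-4)
      by (intro conjI exI[of _ B0] exI[of _ q0]) simp_all
  qed
  then show ?thesis
    using inv ex unfolding inv_def anc al by metis
next
  assume "reexplore (fst \<omega>) (used (Suc t) \<omega>) (phase_at t \<omega>) (phase_at (Suc t) \<omega>)"
  then obtain B q where rd: "ready (used (Suc t) \<omega>) B q" and B: "set B = alive (phase_at t \<omega>)"
    and ph': "phase_at (Suc t) \<omega> = explore S (fst \<omega>) (used (Suc t) \<omega>) B q"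
    and q_gt: "\<And>B0 q0 js0. phase_at t \<omega> = Exploring B0 q0 js0 \<Longrightarrow> q0 < q"
    and nx: "\<And>j. phase_at t \<omega> \<noteq> Exploiting j"
    unfolding reexplore_def by blast
  define a where "a = anchor t \<omega>"
  have a: "a \<in> set B" using inv by (simp add: a_def B inv_def)
  have arms: "set B \<subseteq> {1..arms S}" using rd by (simp add: ready_def)
  have p: "pulls (Suc t) \<omega> i = q" if "i \<in> set B" for i using rd that by (simp add: ready_def)
  have nocheap: "\<not> first_kill j \<omega>" if "j \<in> {0..arms S}" "worth j \<le> cstar S" for j
    using good that by (auto simp: bad_def cheap_kill_def)
  have nolater: "\<not> cross (rival a j) (\<mu> a - worth j) 1 t0 \<omega>"
    if "t0 \<in> {1..T}" "switch t0 a \<omega>" "j \<in> {0..arms S}" "j \<noteq> a" "worth j \<le> \<mu> a" for t0 j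
    using good that a arms unfolding bad_def later_kill_def by blast
  \<comment> \<open>Here n is the number of rewards each survivor has gained since the take-over.
    The lead over the cost at that time means that any later deficit arose within these n
    rewards.\<close>
  have late: "\<exists>n. 1 \<le> n \<and> n \<le> q \<and>
       (\<forall>i\<in>set B. pulls (Suc t) \<omega> i = pulls t0 \<omega> i + n \<and> total t0 \<omega> i \<le> total t0 \<omega> a) \<and>
       cstar S * real q - total t0 \<omega> a \<le> cstar S * real n" (is ?late)
    and keep: "alive (phase_at (Suc t) \<omega>) \<subseteq> set B \<Longrightarrow>
      (\<And>B1 q1 js. phase_at (Suc t) \<omega> = Exploring B1 q1 js \<Longrightarrow> q1 = q) \<Longrightarrow>
      (\<And>i a n. phase_at (Suc t) \<omega> \<noteq> Sampling i a n) \<Longrightarrow> took_over a t0 (Suc t) \<omega>"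
    if to: "took_over a t0 t \<omega>" for t0
  proof -
    obtain B0 q0 where *: "a \<in> set B0" "alive (phase_at t \<omega>) \<subseteq> set B0"
       "\<forall>i\<in>set B0. pulls t0 \<omega> i = q0 \<and> total t0 \<omega> i \<le> total t0 \<omega> a" "cstar S * real q0 \<le> total t0 \<omega> a"
       "\<forall>B q js. phase_at t \<omega> = Exploring B q js \<longrightarrow> q0 \<le> q" "\<forall>i a n. phase_at t \<omega> \<noteq> Sampling i a n"
      and to': "1 \<le> t0" "t0 \<le> t" "switch t0 a \<omega>" "cstar S < \<mu> a" "gap a \<le> drop \<omega>"
      using to unfolding took_over_def by blast
    \<comment> \<open>The phase before the test was exploration, since \<open>took_over\<close>
      excludes sampling and \<open>reexplore\<close> excludes exploitation; so the counter has moved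
      on.\<close>
    have q0: "q0 < q"
      using nx q_gt *(5,6) by (cases "phase_at t \<omega>") (auto intro: le_less_trans)
    then have "pulls (Suc t) \<omega> i = pulls t0 \<omega> i + (q - q0) \<and> total t0 \<omega> i \<le> total t0 \<omega> a" if "i \<in> set B" for i
      using *(2,3) that p[OF that] by (auto simp: B subset_iff)
    moreover have "cstar S * real q - total t0 \<omega> a \<le> cstar S * real (q - q0)"
      using *(4) q0 by (simp add: of_nat_diff right_diff_distrib)
    ultimately show ?late
      using q0 by (intro exI[of _ "q - q0"]) auto
    assume "alive (phase_at (Suc t) \<omega>) \<subseteq> set B"
      and "\<And>B1 q1 js. phase_at (Suc t) \<omega> = Exploring B1 q1 js \<Longrightarrow> q1 = q"
      and "\<And>i a n. phase_at (Suc t) \<omega> \<noteq> Sampling i a n"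
    then show "took_over a t0 (Suc t) \<omega>"
      unfolding took_over_def using to' * q0 B
      by (intro conjI exI[of _ B0] exI[of _ q0]) (auto intro: less_imp_le)
  qed
  have anc: "a = b \<or> (\<exists>t0. took_over a t0 t \<omega>)" using inv by (simp add: inv_def a_def)
  have a_pos: "a \<noteq> 0" using a arms by auto
  have cost: "\<not> total (Suc t) \<omega> a + thresh q \<le> cstar S * real q"
  proof
    assume k: "total (Suc t) \<omega> a + thresh q \<le> cstar S * real q"
    show False
      using anc
    proof
      assume "a = b"
      then show False
        using kill_best(1)[OF \<omega> t rd] a k nocheap[of 0] by (simp add: worth_def)
    next
      assume "\<exists>t0. took_over a t0 t \<omega>"
      then obtain t0 where to: "took_over a t0 t \<omega>" by blast
      obtain n where n: "1 \<le> n" "n \<le> q" "pulls (Suc t) \<omega> a = pulls t0 \<omega> a + n"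
        "cstar S * real q - total t0 \<omega> a \<le> cstar S * real n" using late[OF to] a by blast
      have t0: "t0 \<in> {1..T}" "t0 \<le> Suc t" "switch t0 a \<omega>" "cstar S < \<mu> a"
        using to t by (auto simp: took_over_def)
      have "cross (rival a 0) (\<mu> a - worth 0) 1 t0 \<omega>"
        using n thresh_mono[OF n(2)] k by (intro crossI[OF \<omega> t0(2) t a_pos n(3)]) auto
      then show False using nolater[OF t0(1,3), of 0] a_pos t0 by (simp add: worth_def)
    qed
  qed
  from rd show ?thesis
  proof (cases rule: explore_cases[where x = "fst \<omega>"])
    case one
    then have ph: "phase_at (Suc t) \<omega> = Exploiting (hd B)" by (simp add: ph')
    then have "alive (phase_at (Suc t) \<omega>) = set B" using one(2) by (simp add: alive_def)
    moreover then have "anchor (Suc t) \<omega> = a" using a by (simp add: a_def)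
    ultimately show ?thesis
      using anc keep a ph by (auto simp: inv_def)
  next
    case none
    then show ?thesis using cost a by fastforce
  next
    case (some B')
    have ph: "phase_at (Suc t) \<omega> = Exploring B' q B'" using some by (simp add: ph')
    have al: "alive (phase_at (Suc t) \<omega>) = set B'" by (simp add: ph alive_def)
    have sub: "set B' \<subseteq> set B" using some(3) by blast
    have gaps: "\<forall>a\<in>set B'. \<forall>j\<in>set B'. \<mu> j < \<mu> a \<longrightarrow> (\<mu> a - \<mu> j)\<^sup>2 * real q \<le> 8 * ell"
      using coalive_gap[OF \<omega> good t rd] some(3) by blast
    show ?thesis
    proof (cases "a \<in> set B'")
      case True
      then have an: "anchor (Suc t) \<omega> = a" using al by (simp add: a_def)
      have "took_over a t0 t \<omega> \<Longrightarrow> took_over a t0 (Suc t) \<omega>" for t0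
        by (rule keep) (simp_all add: alive_def sub ph)
      then have "a = b \<or> (\<exists>t0. took_over a t0 (Suc t) \<omega>)" using anc by blast
      then show ?thesis
        unfolding inv_def an al using True gaps ph by simp
    next
      case False
      define l where "l = leader (fst \<omega>) (Exploring B' q B', used (Suc t) \<omega>, snd (snd (st (Suc t) \<omega>))) a"
      have "a \<notin> alive (explore S (fst \<omega>) (used (Suc t) \<omega>) B q)"
        using False al by (simp flip: ph')
      from explore_dead[OF rd a this, of "snd (snd (st (Suc t) \<omega>))"]
      have l: "l \<in> set B'" "total (Suc t) \<omega> a + thresh q \<le> total (Suc t) \<omega> l"
        "cstar S * real q \<le> total (Suc t) \<omega> l" "\<forall>j\<in>set B. total (Suc t) \<omega> j \<le> total (Suc t) \<omega> l"
        using cost ph unfolding ph' by (auto simp: Let_def l_def)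
      have anc': "anchor (Suc t) \<omega> = l"
        using False al st_used[of "Suc t" \<omega>] ph by (simp add: a_def[symmetric] l_def)
      have la: "l \<noteq> a" "l \<in> set B" "l \<in> {1..arms S}" using False l sub arms by auto
      have sw: "switch (Suc t) l \<omega>" using anc' la by (simp add: switch_def a_def)
      have "cstar S < \<mu> l \<and> gap l \<le> drop \<omega>"
        using anc
      proof
        assume ab: "a = b"
        then have fk: "first_kill l \<omega>"
            using kill_best(2)[OF \<omega> t rd _ la(2)] a la l by simp
        then have "cstar S < \<mu> l" using nocheap[of l] la by (cases "\<mu> l \<le> cstar S") (auto simp: worth_def)
        then show ?thesis using gap_le_drop[OF la(3) _ fk] la ab by simp
      next
        assume "\<exists>t0. took_over a t0 t \<omega>"
        then obtain t0 where to: "took_over a t0 t \<omega>" by blast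
        obtain n where n: "1 \<le> n" "n \<le> q" "pulls (Suc t) \<omega> a = pulls t0 \<omega> a + n"
          "pulls (Suc t) \<omega> l = pulls t0 \<omega> l + n" "total t0 \<omega> l \<le> total t0 \<omega> a"
          using late[OF to] a la by blast
        have t0: "t0 \<in> {1..T}" "t0 \<le> Suc t" "switch t0 a \<omega>" "cstar S < \<mu> a" "gap a \<le> drop \<omega>"
          using to t by (auto simp: took_over_def)
        \<comment> \<open>A deficit of thresh q over the whole history, from a lead at t0, is a
          deficit of at least thresh n over the n new rewards.\<close>
        have "total (Suc t) \<omega> a - total t0 \<omega> a + thresh n \<le> total (Suc t) \<omega> l - total t0 \<omega> l"
          using n(5) thresh_mono[OF n(2)] l(2) by linarith
        then have "cross (rival a l) (\<mu> a - worth l) 1 t0 \<omega>"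
          using n(1,4) la(3) by (intro crossI[OF \<omega> t0(2) t la(1)[symmetric] n(3)]) auto
        then have "\<mu> a < worth l" using nolater[OF t0(1,3), of l] la by force
        then show ?thesis using t0 la by (simp add: worth_def gap_def)
      qed
      then have "took_over l (Suc t) (Suc t) \<omega>"
        unfolding took_over_def using sw l sub p ph al
        by (intro conjI exI[of _ B'] exI[of _ q]) auto
      then show ?thesis
        unfolding inv_def anc' al using l gaps ph by auto
    qed
  qed
qed

lemma inv_good:
  assumes \<omega>: "\<omega> \<in> space M" and good: "\<not> bad \<omega>" and t: "t \<le> T"
  shows "inv t \<omega>"
  using t
proof (induction t)
  case 0
  then show ?case using b by (simp add: inv_def st_0 alive_def)
next
  case (Suc t)
  then show ?case using inv_Suc[OF \<omega> good] by simp
qed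

end

section \<open>Probability of the bad events\<close>

context arp_best
begin

text \<open>This holds on every path, also on bad ones, because take-overs are counted before
  anything is excluded. The alternative \<open>Exploiting\<close> covers the fall-back on arm 1,
  after which the anchor need not be alive but no longer changes.\<close>

lemma anchor_step:
  assumes \<omega>: "\<omega> \<in> space M" and an: "anchor t \<omega> \<in> alive (phase_at t \<omega>) \<or> (\<exists>j. phase_at t \<omega> = Exploiting j)"
  shows "anchor (Suc t) \<omega> \<in> alive (phase_at (Suc t) \<omega>) \<or> (\<exists>j. phase_at (Suc t) \<omega> = Exploiting j)"
    and "card (alive (phase_at (Suc t) \<omega>)) + of_bool (anchor (Suc t) \<omega> \<noteq> anchor t \<omega>) \<le> card (alive (phase_at t \<omega>))"
    and "anchor t \<omega> = b \<Longrightarrow> anchor (Suc t) \<omega> \<noteq> b \<Longrightarrow> Suc t \<le> T \<Longrightarrow> \<exists>j\<in>{0..arms S} - {b}. first_kill j \<omega>"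
proof -
  define x where "x = fst \<omega>"
  let ?A = "alive (phase_at t \<omega>)" and ?A' = "alive (phase_at (Suc t) \<omega>)"
  have "(anchor (Suc t) \<omega> \<in> ?A' \<or> (\<exists>j. phase_at (Suc t) \<omega> = Exploiting j)) \<and>
    card ?A' + of_bool (anchor (Suc t) \<omega> \<noteq> anchor t \<omega>) \<le> card ?A \<and>
    (anchor t \<omega> = b \<longrightarrow> anchor (Suc t) \<omega> \<noteq> b \<longrightarrow> Suc t \<le> T \<longrightarrow> (\<exists>j\<in>{0..arms S} - {b}. first_kill j \<omega>))"
    using st_step[OF \<omega>, of t]
  proof
    assume q: "quiet (phase_at t \<omega>) (phase_at (Suc t) \<omega>)"
    have al: "?A' = ?A" using quiet_alive[OF q] .
    show ?thesis
    proof (cases "anchor t \<omega> \<in> ?A")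
      case True
      then have "anchor (Suc t) \<omega> = anchor t \<omega>" by (simp add: al)
      then show ?thesis using True by (simp add: al del: anchor.simps)
    next
      case False
      then obtain j where "phase_at t \<omega> = Exploiting j" using an by blast
      then have j: "phase_at (Suc t) \<omega> = Exploiting j" using q by (simp add: quiet_def)
      then have "leader (fst \<omega>) (st (Suc t) \<omega>) (anchor t \<omega>) = anchor t \<omega>"
        by (cases "st (Suc t) \<omega>") (simp add: leader_def)
      then have "anchor (Suc t) \<omega> = anchor t \<omega>" by simp
      then show ?thesis using j al by (simp del: anchor.simps)
    qed
  next
    assume "reexplore (fst \<omega>) (used (Suc t) \<omega>) (phase_at t \<omega>) (phase_at (Suc t) \<omega>)"
    then obtain B q where rd: "ready (used (Suc t) \<omega>) B q" and B: "set B = ?A"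
      and ph': "phase_at (Suc t) \<omega> = explore S x (used (Suc t) \<omega>) B q"
      and nx: "\<And>j. phase_at t \<omega> \<noteq> Exploiting j"
      unfolding reexplore_def x_def by blast
    define a where "a = anchor t \<omega>"
    have a: "a \<in> set B" using an nx by (simp add: a_def B)
    have arms: "set B \<subseteq> {1..arms S}" using rd by (simp add: ready_def)
    from rd show ?thesis
    proof (cases rule: explore_cases[where x = x])
      case one
      then have al: "?A' = set B" by (simp add: ph' alive_def)
      then have "anchor (Suc t) \<omega> = anchor t \<omega>" using a by (simp add: a_def)
      then show ?thesis using al a B by (simp add: a_def del: anchor.simps)
    next
      case none
      then have ph: "phase_at (Suc t) \<omega> = Exploiting 1" by (simp add: ph')
      then have "leader (fst \<omega>) (st (Suc t) \<omega>) (anchor t \<omega>) = anchor t \<omega>"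
        by (cases "st (Suc t) \<omega>") (simp add: leader_def)
      then have "anchor (Suc t) \<omega> = anchor t \<omega>" by simp
      moreover have "1 \<le> card ?A" using a B by (metis One_nat_def Suc_leI card_gt_0_iff empty_iff finite_set)
      ultimately show ?thesis using ph by (simp add: alive_def del: anchor.simps)
    next
      case (some B')
      have ph: "phase_at (Suc t) \<omega> = Exploring B' q B'" using some by (simp add: ph')
      have al: "?A' = set B'" by (simp add: ph alive_def)
      have sub: "set B' \<subseteq> set B" using some(3) by blast
      show ?thesis
      proof (cases "a \<in> set B'")
        case True
        then have "anchor (Suc t) \<omega> = anchor t \<omega>" using al by (simp add: a_def)
        then show ?thesis
          using True al sub B card_mono[OF finite_set sub] by (simp add: a_def del: anchor.simps)
      next
        case False
        define l where "l = leader x (Exploring B' q B', used (Suc t) \<omega>, snd (snd (st (Suc t) \<omega>))) a"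
        have a_dead: "a \<notin> alive (explore S x (used (Suc t) \<omega>) B q)" using False al by (simp flip: ph')
        have dead: "rew_sum x (used (Suc t) \<omega>) a + thresh q \<le> cstar S * real q \<or>
            rew_sum x (used (Suc t) \<omega>) a + thresh q \<le> rew_sum x (used (Suc t) \<omega>) l"
          using explore_dead[OF rd a a_dead, of "snd (snd (st (Suc t) \<omega>))"] some(1)
          by (auto simp: Let_def l_def)
        have l: "l \<in> set B'" using leader_some[OF rd some refl] by (simp add: l_def)
        have anc': "anchor (Suc t) \<omega> = l"
          using False al st_used[of "Suc t" \<omega>] ph by (simp add: a_def[symmetric] l_def x_def)
        have "set B' \<subset> set B" using sub a False by blast
        then have "card (set B') < card (set B)" by (rule psubset_card_mono[OF finite_set])
        moreover have "\<exists>j\<in>{0..arms S} - {b}. first_kill j \<omega>" if ab: "a = b" and t: "Suc t \<le> T"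
        proof -
          have bB: "b \<in> set B" using a ab by simp
          note kb = kill_best[OF \<omega> t rd bB]
          from dead show ?thesis
          proof
            assume "rew_sum x (used (Suc t) \<omega>) a + thresh q \<le> cstar S * real q"
            then have "first_kill 0 \<omega>" using kb(1) by (simp add: ab x_def)
            then show ?thesis using b by (intro bexI[of _ 0]) auto
          next
            assume "rew_sum x (used (Suc t) \<omega>) a + thresh q \<le> rew_sum x (used (Suc t) \<omega>) l"
            then have "total (Suc t) \<omega> b + thresh q \<le> total (Suc t) \<omega> l" by (simp add: ab x_def)
            moreover have "l \<in> set B" "l \<noteq> b" using l sub False ab by auto
            ultimately have "first_kill l \<omega>" using kb(2) by simp
            then show ?thesis using \<open>l \<in> set B\<close> \<open>l \<noteq> b\<close> arms by (intro bexI[of _ l]) auto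
          qed
        qed
        ultimately show ?thesis
          using l False unfolding anc' al B[symmetric] a_def[symmetric] by auto
      qed
    qed
  qed
  then show "anchor (Suc t) \<omega> \<in> ?A' \<or> (\<exists>j. phase_at (Suc t) \<omega> = Exploiting j)"
    "card ?A' + of_bool (anchor (Suc t) \<omega> \<noteq> anchor t \<omega>) \<le> card ?A"
    "anchor t \<omega> = b \<Longrightarrow> anchor (Suc t) \<omega> \<noteq> b \<Longrightarrow> Suc t \<le> T \<Longrightarrow> \<exists>j\<in>{0..arms S} - {b}. first_kill j \<omega>"
    by blast+
qed

lemma anchor_alive:
  assumes \<omega>: "\<omega> \<in> space M"
  shows "anchor t \<omega> \<in> alive (phase_at t \<omega>) \<or> (\<exists>j. phase_at t \<omega> = Exploiting j)"
proof (induction t)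
  case 0
  then show ?case using b by (simp add: st_0 alive_def)
next
  case (Suc t)
  then show ?case by (rule anchor_step(1)[OF \<omega>])
qed

text \<open>The number of surviving arms is a potential: each take-over costs at least the arm that
  loses the role.\<close>

lemma switches_le:
  assumes \<omega>: "\<omega> \<in> space M"
  shows "(\<Sum>t<n. of_bool (anchor (Suc t) \<omega> \<noteq> anchor t \<omega>)) \<le> arms S"
proof -
  have "(\<Sum>t<n. of_bool (anchor (Suc t) \<omega> \<noteq> anchor t \<omega>)) + card (alive (phase_at n \<omega>)) \<le> arms S"
  proof (induction n)
    case 0
    then show ?case by (simp add: st_0 alive_def)
  next
    case (Suc n)
    then show ?case using anchor_step(2)[OF \<omega> anchor_alive[OF \<omega>], of n] by simp
  qed
  then show ?thesis by simp
qed

text \<open>The anchor starts at b, so the earliest take-over dethrones b.\<close>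

lemma switch_first_kill:
  assumes \<omega>: "\<omega> \<in> space M" and sw: "anchor (Suc t) \<omega> \<noteq> anchor t \<omega>" "t < T"
  shows "\<exists>j\<in>{0..arms S} - {b}. first_kill j \<omega>"
proof (rule ccontr)
  assume no: "\<not> ?thesis"
  have "anchor s \<omega> = b" if "s \<le> T" for s
    using that
  proof (induction s)
    case (Suc s)
    show ?case
    proof (rule ccontr)
      assume "anchor (Suc s) \<omega> \<noteq> b"
      from anchor_step(3)[OF \<omega> anchor_alive[OF \<omega>] _ this] Suc show False using no by simp
    qed
  qed simp
  then show False using sw by (metis Suc_leI less_imp_le)
qed

text \<open>exp (- ell / 2) is (T theta)^(-1/2); the additional 1/2 is the loss in
  \<open>slope_bound\<close>.\<close>

definition p_cross :: real where "p_cross = real grid_size * exp (1 / 2 - ell / 2)"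

definition p_base :: real where "p_base = exp (1 / 2 - ell / 2)"

lemma p_cross_nonneg: "0 \<le> p_cross" by (simp add: p_cross_def)

lemma integrable_pred_indicator:
  "Measurable.pred M P \<Longrightarrow> integrable M (indicat_real {\<omega>\<in>space M. P \<omega>})"
  by (intro integrable_real_indicator) (auto simp: less_top[symmetric])

lemma measurable_first_kill [measurable]: "Measurable.pred M (first_kill j)"
  unfolding first_kill_def[abs_def] by measurable

lemma worth_le: "j \<in> {0..arms S} \<Longrightarrow> worth j \<le> \<mu> b"
  using b_max[of j] b_cost by (cases "j = 0") (auto simp: worth_def)

lemma samples_ge: "1 \<le> samples S" using samples_pos by simp

lemma first_kill_prob:
  assumes "j \<in> {0..arms S}"
  shows "\<P>(\<omega> in M. first_kill j \<omega>) \<le> p_cross"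
  using cross_prob[of "\<lambda>_. True" 0 "samples S" "\<mu> b - worth j" "rival b j"] worth_le[OF assms] samples_ge
  by (simp add: past_def prob_space first_kill_def p_cross_def)

text \<open>A path has at most m take-overs, and none unless b is crossed by one of its m rivals
  (the other arms and the cost). The expected number is therefore at most m times the probability of
  such a crossing.\<close>

lemma switch_prob: "(\<Sum>t0\<in>{1..T}. \<Sum>a\<in>{1..arms S}. \<P>(\<omega> in M. switch t0 a \<omega>)) \<le>
    real (arms S) * (real (arms S) * p_cross)"
proof -
  let ?I = "\<lambda>t a. indicat_real {\<omega>\<in>space M. switch t a \<omega>}"
  let ?K = "\<Union>j\<in>{0..arms S} - {b}. {\<omega>\<in>space M. first_kill j \<omega>}"
  have K: "?K \<in> sets M" by measurable
  have "(\<Sum>t0\<in>{1..T}. \<Sum>a\<in>{1..arms S}. \<P>(\<omega> in M. switch t0 a \<omega>)) =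
      expectation (\<lambda>\<omega>. \<Sum>t0\<in>{1..T}. \<Sum>a\<in>{1..arms S}. ?I t0 a \<omega>)"
  proof -
    have int: "integrable M (?I t0 a)" for t0 a
      by (rule integrable_pred_indicator) measurable
    then show ?thesis
      by (subst Bochner_Integration.integral_sum, intro Bochner_Integration.integrable_sum int)
        (subst Bochner_Integration.integral_sum, rule int, simp)
  qed
  also have "\<dots> \<le> expectation (\<lambda>\<omega>. real (arms S) * indicator ?K \<omega>)"
  proof (rule integral_mono)
    show "integrable M (\<lambda>\<omega>. \<Sum>t0\<in>{1..T}. \<Sum>a\<in>{1..arms S}. ?I t0 a \<omega>)"
      by (intro Bochner_Integration.integrable_sum integrable_pred_indicator) measurable
    show "integrable M (\<lambda>\<omega>. real (arms S) * indicat_real ?K \<omega>)"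
      using K by (intro integrable_mult_right integrable_real_indicator) (auto simp: less_top[symmetric])
    fix \<omega> assume \<omega>: "\<omega> \<in> space M"
    have "(\<Sum>t0\<in>{1..T}. \<Sum>a\<in>{1..arms S}. ?I t0 a \<omega>)
      = (\<Sum>t<T. \<Sum>a\<in>{1..arms S}. ?I (Suc t) a \<omega>)"
      by (rule sum.reindex_bij_witness[of _ Suc "\<lambda>t. t - 1"]) auto
    also have "\<dots> \<le> (\<Sum>t<T. of_bool (anchor (Suc t) \<omega> \<noteq> anchor t \<omega>))"
    proof (rule sum_mono)
      fix t
      let ?a = "anchor (Suc t) \<omega>"
      have "(\<Sum>a\<in>{1..arms S}. ?I (Suc t) a \<omega>) \<le>
          (\<Sum>a\<in>{1..arms S}. if a = ?a then of_bool (?a \<noteq> anchor t \<omega>) else 0)"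
        by (intro sum_mono) (auto simp: switch_def indicator_def)
      also have "\<dots> \<le> of_bool (?a \<noteq> anchor t \<omega>)" by simp
      finally show "(\<Sum>a\<in>{1..arms S}. ?I (Suc t) a \<omega>) \<le>
          of_bool (?a \<noteq> anchor t \<omega>)" .
    qed
    also have "\<dots> \<le> real (arms S) * indicator ?K \<omega>"
    proof (cases "\<omega> \<in> ?K")
      case True
      have "(\<Sum>t<T. of_bool (anchor (Suc t) \<omega> \<noteq> anchor t \<omega>)) =
          real (\<Sum>t<T. of_bool (anchor (Suc t) \<omega> \<noteq> anchor t \<omega>))" by simp
      also have "\<dots> \<le> real (arms S)" using switches_le[OF \<omega>] by (subst of_nat_le_iff)
      finally show ?thesis using True by simp
    next
      case False
      then have "anchor (Suc t) \<omega> = anchor t \<omega>" if "t < T" for t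
        using switch_first_kill[OF \<omega> _ that] \<omega> by blast
      then show ?thesis using False by simp
    qed
    finally show "(\<Sum>t0\<in>{1..T}. \<Sum>a\<in>{1..arms S}. ?I t0 a \<omega>)
      \<le> real (arms S) * indicator ?K \<omega>" .
  qed
  also have "\<dots> = real (arms S) * prob ?K" using K by simp
  also have "prob ?K \<le> (\<Sum>j\<in>{0..arms S} - {b}. \<P>(\<omega> in M. first_kill j \<omega>))"
    by (intro finite_measure_subadditive_finite) auto
  also have "\<dots> \<le> (\<Sum>j\<in>{0..arms S} - {b}. p_cross)"
    by (intro sum_mono first_kill_prob) auto
  also have "\<dots> = real (arms S) * p_cross" using b by simp
  finally show ?thesis by (simp add: mult_left_mono)
qed

text \<open>Given a take-over, each of m rivals crosses with probability at most
  \<open>p_cross\<close>; summing over take-overs brings in the factor m^2 \<open>p_cross\<close> of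
  \<open>switch_prob\<close>.\<close>

lemma later_kill_prob: "\<P>(\<omega> in M. later_kill \<omega>) \<le> real (arms S) ^ 3 * p_cross\<^sup>2"
proof -
  define J where "J a = {j \<in> {0..arms S} - {a}. worth j \<le> \<mu> a}" for a
  define E where "E t0 a j = {\<omega>\<in>space M. switch t0 a \<omega> \<and> cross (rival a j) (\<mu> a - worth j) 1 t0 \<omega>}" for t0 a j
  have [measurable]: "E t0 a j \<in> sets M" for t0 a j unfolding E_def by measurable
  have fin: "finite (J a)" for a by (simp add: J_def)
  have "{\<omega>\<in>space M. later_kill \<omega>} = (\<Union>t0\<in>{1..T}. \<Union>a\<in>{1..arms S}. \<Union>j\<in>J a. E t0 a j)"
    unfolding later_kill_def E_def J_def by blast
  then have "\<P>(\<omega> in M. later_kill \<omega>) \<le> (\<Sum>t0\<in>{1..T}. prob (\<Union>a\<in>{1..arms S}. \<Union>j\<in>J a. E t0 a j))"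
    using fin by (auto intro!: finite_measure_subadditive_finite sets.finite_UN)
  also have "\<dots> \<le> (\<Sum>t0\<in>{1..T}. \<Sum>a\<in>{1..arms S}. prob (\<Union>j\<in>J a. E t0 a j))"
    using fin by (auto intro!: sum_mono finite_measure_subadditive_finite sets.finite_UN)
  also have "\<dots> \<le> (\<Sum>t0\<in>{1..T}. \<Sum>a\<in>{1..arms S}. \<Sum>j\<in>J a. prob (E t0 a j))"
    using fin by (auto intro!: sum_mono finite_measure_subadditive_finite)
  also have "\<dots> \<le> (\<Sum>t0\<in>{1..T}. \<Sum>a\<in>{1..arms S}. \<Sum>j\<in>J a. p_cross * \<P>(\<omega> in M. switch t0 a \<omega>))"
    unfolding E_def p_cross_def by (intro sum_mono cross_prob switch_past) (auto simp: J_def)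
  also have "\<dots> \<le> (\<Sum>t0\<in>{1..T}. \<Sum>a\<in>{1..arms S}. (real (arms S) * p_cross) * \<P>(\<omega> in M. switch t0 a \<omega>))"
  proof (intro sum_mono)
    fix t0 a assume a: "a \<in> {1..arms S}"
    have "card (J a) \<le> card ({0..arms S} - {a})" unfolding J_def by (intro card_mono) auto
    then have "real (card (J a)) \<le> real (arms S)" using a by simp
    then have "real (card (J a)) * (p_cross * \<P>(\<omega> in M. switch t0 a \<omega>)) \<le>
        real (arms S) * (p_cross * \<P>(\<omega> in M. switch t0 a \<omega>))"
      using p_cross_nonneg by (intro mult_right_mono) auto
    then show "(\<Sum>j\<in>J a. p_cross * \<P>(\<omega> in M. switch t0 a \<omega>)) \<le>
        real (arms S) * p_cross * \<P>(\<omega> in M. switch t0 a \<omega>)" by (simp add: mult.assoc)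
  qed
  also have "\<dots> = (real (arms S) * p_cross) * (\<Sum>t0\<in>{1..T}. \<Sum>a\<in>{1..arms S}. \<P>(\<omega> in M. switch t0 a \<omega>))"
    by (simp add: sum_distrib_left)
  also have "\<dots> \<le> (real (arms S) * p_cross) * (real (arms S) * (real (arms S) * p_cross))"
    using switch_prob p_cross_nonneg by (intro mult_left_mono) auto
  finally show ?thesis by (simp add: power2_eq_square power3_eq_cube mult_ac)
qed

lemma strayed_prob: "\<P>(\<omega> in M. strayed \<omega>) \<le> real (arms S) ^ 2 * exp (- (4 * ell))"
proof -
  define J where "J a = {j \<in> {1..arms S}. \<mu> j < \<mu> a}" for a
  define E where "E a j = {\<omega>\<in>space M. stray (rival a j) (\<mu> a - \<mu> j) \<omega>}" for a j
  have [measurable]: "E a j \<in> sets M" for a j unfolding E_def by measurable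
  have fin: "finite (J a)" for a by (simp add: J_def)
  have "{\<omega>\<in>space M. strayed \<omega>} = (\<Union>a\<in>{1..arms S}. \<Union>j\<in>J a. E a j)"
    unfolding strayed_def E_def J_def by blast
  then have "\<P>(\<omega> in M. strayed \<omega>) \<le> (\<Sum>a\<in>{1..arms S}. prob (\<Union>j\<in>J a. E a j))"
    using fin by (auto intro!: finite_measure_subadditive_finite sets.finite_UN)
  also have "\<dots> \<le> (\<Sum>a\<in>{1..arms S}. \<Sum>j\<in>J a. prob (E a j))"
    using fin by (auto intro!: sum_mono finite_measure_subadditive_finite)
  also have "\<dots> \<le> (\<Sum>a\<in>{1..arms S}. \<Sum>j\<in>J a. exp (- (4 * ell)))"
    unfolding E_def by (intro sum_mono stray_prob) (auto simp: J_def)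
  also have "\<dots> \<le> (\<Sum>a\<in>{1..arms S}. real (arms S) * exp (- (4 * ell)))"
  proof (intro sum_mono)
    fix a
    have "card (J a) \<le> card {1..arms S}" unfolding J_def by (intro card_mono) auto
    then have "real (card (J a)) \<le> real (arms S)" by simp
    then show "(\<Sum>j\<in>J a. exp (- (4 * ell))) \<le> real (arms S) * exp (- (4 * ell))"
      by (simp add: mult_right_mono)
  qed
  finally show ?thesis by (simp add: power2_eq_square mult.assoc)
qed

text \<open>These rivals are worse than b by at least its margin over the cost. The hypothesis makes
  the gap term of \<open>cross_prob_gap\<close> at most 1, which gives the factor 2 and avoids
  \<open>grid_size\<close>.\<close>

lemma cheap_kill_prob:
  assumes g: "1 \<le> (\<mu> b - cstar S) * sqrt (2 * real (samples S))"
  shows "\<P>(\<omega> in M. cheap_kill \<omega>) \<le> (real (arms S) + 1) * (2 * p_base)"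
proof -
  define J where "J = {j \<in> {0..arms S}. worth j \<le> cstar S}"
  have "{\<omega>\<in>space M. cheap_kill \<omega>} = (\<Union>j\<in>J. {\<omega>\<in>space M. first_kill j \<omega>})"
    unfolding cheap_kill_def J_def by blast
  then have "\<P>(\<omega> in M. cheap_kill \<omega>) \<le> (\<Sum>j\<in>J. \<P>(\<omega> in M. first_kill j \<omega>))"
    by (auto intro!: finite_measure_subadditive_finite simp: J_def)
  also have "\<dots> \<le> (\<Sum>j\<in>J. 2 * p_base)"
  proof (intro sum_mono)
    fix j assume j: "j \<in> J"
    let ?y = "(\<mu> b - worth j) * sqrt (2 * real (samples S))"
    have "(\<mu> b - cstar S) * sqrt (2 * real (samples S)) \<le> ?y"
      using j by (intro mult_right_mono) (auto simp: J_def)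
    then have "1 \<le> ?y" using g by linarith
    then have y: "1 / ?y \<le> 1" by (subst divide_le_eq) auto
    have pos: "0 < \<mu> b - worth j" using j b_cost by (simp add: J_def)
    have "\<P>(\<omega> in M. first_kill j \<omega>) \<le> p_base * (1 + 1 / ?y)"
      unfolding first_kill_def p_base_def by (rule cross_prob_gap[OF samples_ge pos])
    also have "\<dots> \<le> p_base * 2" using y by (intro mult_left_mono) (auto simp: p_base_def)
    finally show "\<P>(\<omega> in M. first_kill j \<omega>) \<le> 2 * p_base" by simp
  qed
  also have "\<dots> \<le> (real (arms S) + 1) * (2 * p_base)"
  proof -
    have "card J \<le> card {0..arms S}" unfolding J_def by (intro card_mono) auto
    then have "real (card J) \<le> real (arms S) + 1" by simp
    then show ?thesis by (simp add: mult_right_mono p_base_def)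
  qed
  finally show ?thesis .
qed

lemma integrable_id_\<nu>: "i \<in> {1..arms S} \<Longrightarrow> integrable (\<nu> i) (\<lambda>z. z)"
  by (rule finite_measure.integrable_const_bound[OF prob_space.finite_measure[OF prob_space_\<nu>], of _ _ 1])
    (auto simp: space_\<nu> measurable_id_\<nu>)

lemma mean_range:
  assumes i: "i \<in> {1..arms S}"
  shows "0 \<le> \<mu> i \<and> \<mu> i \<le> 1"
proof -
  interpret P: prob_space "\<nu> i" by (rule prob_space_\<nu>[OF i])
  show ?thesis
    unfolding mean_def using integrable_id_\<nu>[OF i]
    by (intro conjI P.integral_le_const P.integral_ge_const AE_I2) (auto simp: space_\<nu>[OF i])
qed

lemma gap_le_1: "i \<in> {1..arms S} \<Longrightarrow> gap i \<le> 1"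
  using mean_range[of i] mean_range[OF b] by (simp add: gap_def)

text \<open>The gap cancels: \<Delta> (1 + 1 / (\<Delta> sqrt (2 k))) = \<Delta> + 1 / sqrt (2 k),
  at most 2.\<close>

lemma expectation_drop: "expectation drop \<le> real (arms S) * (2 * p_base)"
proof -
  have "expectation drop = (\<Sum>i\<in>{1..arms S} - {b}. gap i * \<P>(\<omega> in M. first_kill i \<omega>))"
  proof -
    have "expectation drop = expectation (\<lambda>\<omega>. \<Sum>i\<in>{1..arms S} - {b}. gap i * indicator {\<omega>\<in>space M. first_kill i \<omega>} \<omega>)"
      by (intro Bochner_Integration.integral_cong) (auto simp: drop_def intro!: sum.cong)
    also have "\<dots> = (\<Sum>i\<in>{1..arms S} - {b}. gap i * \<P>(\<omega> in M. first_kill i \<omega>))"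
      by (subst Bochner_Integration.integral_sum)
        (auto intro!: integrable_mult_right integrable_pred_indicator)
    finally show ?thesis .
  qed
  also have "\<dots> \<le> (\<Sum>i\<in>{1..arms S} - {b}. 2 * p_base)"
  proof (intro sum_mono)
    fix i assume i: "i \<in> {1..arms S} - {b}"
    have gap_eq: "gap i = \<mu> b - worth i" using i by (simp add: gap_def worth_def)
    show "gap i * \<P>(\<omega> in M. first_kill i \<omega>) \<le> 2 * p_base"
    proof (cases "gap i = 0")
      case True then show ?thesis by (simp add: p_base_def)
    next
      case False
      then have pos: "0 < gap i" using gap_nonneg[of i] i by simp
      have s: "1 \<le> sqrt (2 * real (samples S))" using samples_ge by simp
      have "gap i * \<P>(\<omega> in M. first_kill i \<omega>) \<le> gap i * (p_base * (1 + 1 / (gap i * sqrt (2 * real (samples S)))))"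
        using cross_prob_gap[OF samples_ge, of "gap i" "rival b i"] pos
        unfolding first_kill_def p_base_def gap_eq by (intro mult_left_mono) auto
      also have "\<dots> = p_base * (gap i + 1 / sqrt (2 * real (samples S)))"
        using pos by (simp add: field_simps)
      also have "\<dots> \<le> p_base * (1 + 1)"
        using gap_le_1[of i] i s by (intro mult_left_mono add_mono) (auto simp: p_base_def)
      finally show ?thesis by simp
    qed
  qed
  also have "\<dots> \<le> real (arms S) * (2 * p_base)"
    using b by (simp add: p_base_def)
  finally show ?thesis .
qed

end

section \<open>The regret\<close>

text \<open>Equivalent to a nonnegative square; it lets a sum of inverse roots telescope.\<close>

lemma inverse_sqrt_le: "1 / sqrt (real (Suc n)) \<le> 2 * (sqrt (real (Suc n)) - sqrt (real n))"
proof -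
  let ?a = "sqrt (real (Suc n))" and ?b = "sqrt (real n)"
  have pos: "0 < ?a" by simp
  have "(?a - ?b)\<^sup>2 \<ge> 0" by simp
  then have "2 * ?a * ?b \<le> real (Suc n) + real n" by (simp add: power2_diff)
  then have "1 \<le> 2 * (?a * ?a - ?a * ?b)" by simp
  then have "1 \<le> (2 * (?a - ?b)) * ?a" by (simp add: algebra_simps)
  then show ?thesis using pos by (simp add: divide_le_eq)
qed

context arp_best
begin

definition is_sampling :: "nat \<Rightarrow> noise \<Rightarrow> bool" where
  "is_sampling t \<omega> \<longleftrightarrow> (\<exists>i a n. phase_at t \<omega> = Sampling i a n)"

definition step_regret :: "nat \<Rightarrow> noise \<Rightarrow> real" where
  "step_regret t \<omega> = gap (rec t \<omega>) * of_bool (fol t \<omega>)"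

lemma step_regret_range: "\<omega> \<in> space M \<Longrightarrow> 0 \<le> step_regret t \<omega> \<and> step_regret t \<omega> \<le> 1"
  using gap_nonneg gap_le_1 rec_mem[of \<omega> t] by (auto simp: step_regret_def)

lemma progress_nonneg:
  assumes "\<omega> \<in> space M"
  shows "0 \<le> 8 * sqrt (real (arms S) * ell) *
    (sqrt (real (length (used (Suc t) \<omega>))) - sqrt (real (length (used t \<omega>))))"
  using used_Suc[OF assms, of t] ell by (intro mult_nonneg_nonneg) auto

text \<open>The gap of the recommended arm is the gap of the anchor, at most \<open>drop\<close>,
  plus its distance to the anchor, at most sqrt (8 ell / q). There are at most 2 m q collected
  rewards, so the distance is of order sqrt (m ell) over the root of their number. Ignored rounds
  have no regret and no progress; in exploitation the arm is the anchor itself.\<close>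

lemma exploring_step:
  assumes \<omega>: "\<omega> \<in> space M" and good: "\<not> bad \<omega>" and t: "t < T" and ns: "\<not> is_sampling t \<omega>"
  shows "step_regret t \<omega> \<le> drop \<omega> + 8 * sqrt (real (arms S) * ell) *
    (sqrt (real (length (used (Suc t) \<omega>))) - sqrt (real (length (used t \<omega>))))"
proof (cases "fol t \<omega>")
  case False
  then show ?thesis
    using progress_nonneg[OF \<omega>, of t] drop_nonneg[of \<omega>] by (simp add: step_regret_def)
next
  case True
  have iv: "inv t \<omega>" using inv_good[OF \<omega> good] t by simp
  have r: "rec t \<omega> = recommend S (fst \<omega>) (fst (snd \<omega>)) (phase_at t \<omega>, used t \<omega>, snd (snd (st t \<omega>)))"
    unfolding rec_def by (simp flip: st_used)
  have reg: "step_regret t \<omega> = gap (rec t \<omega>)" using True by (simp add: step_regret_def)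
  show ?thesis
  proof (cases "phase_at t \<omega>")
    case (Sampling i a n)
    then show ?thesis using ns by (auto simp: is_sampling_def)
  next
    case (Exploiting j)
    then have "rec t \<omega> = j" by (simp add: r recommend_def)
    moreover have "anchor t \<omega> = j" using iv Exploiting by (simp add: inv_def alive_def)
    ultimately have "step_regret t \<omega> \<le> drop \<omega>" using inv_gap[OF iv] by (simp add: reg)
    moreover have "used (Suc t) \<omega> = used t \<omega>"
      using used_Suc[OF \<omega>, of t] by (simp add: collect_def Exploiting)
    ultimately show ?thesis by simp
  next
    case (Exploring B q js)
    note okp = ok_st(1)[OF \<omega>, of t, unfolded Exploring ok_phase_def phase.case]
    have ri: "rec t \<omega> = hd js" by (simp add: r recommend_def Exploring)
    have rB: "rec t \<omega> \<in> set B" using okp hd_in_set unfolding ri by blast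
    have aB: "anchor t \<omega> \<in> set B" using iv Exploring by (simp add: inv_def alive_def)
    have q: "1 \<le> q" using okp samples_ge by (meson order_trans)
    define n where "n = length (used t \<omega>)"
    have c: "collect t \<omega> = rec t \<omega>" using True by (simp add: collect_def Exploring)
    have us: "used (Suc t) \<omega> = used t \<omega> @ [(rec t \<omega>, Suc t)]"
      using used_Suc[OF \<omega>, of t] rec_mem[OF \<omega>, of t] by (simp add: c)
    \<comment> \<open>Within a sweep no arm is more than one reward ahead, so n + 1 \<le> m (q + 1)
      \<le> 2 m q.\<close>
    have "pulls (Suc t) \<omega> i \<le> Suc q" if "i \<in> {1..arms S}" for i
    proof (cases "i = rec t \<omega>")
      case True
      have "hd js \<in> set js" using okp by simp
      then have "pulls t \<omega> i = q" using okp True unfolding ri by blast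
      then show ?thesis by (simp add: us True)
    next
      case False
      then show ?thesis using okp that by (simp add: us)
    qed
    then have "(\<Sum>i\<in>{1..arms S}. pulls (Suc t) \<omega> i) \<le> (\<Sum>i\<in>{1..arms S}. Suc q)"
      by (intro sum_mono)
    then have "Suc n \<le> arms S * Suc q"
      using sum_num_used[OF ok_st(4)[OF \<omega>, of "Suc t"]] by (simp add: us n_def)
    also have "\<dots> \<le> arms S * (2 * q)" using q by (intro mult_le_mono2) simp
    finally have nq: "real (Suc n) \<le> 2 * real (arms S) * real q"
      by (metis mult.assoc mult.left_commute of_nat_le_iff of_nat_mult of_nat_numeral)
    have "\<mu> (anchor t \<omega>) - \<mu> (rec t \<omega>) \<le> 4 * sqrt (real (arms S) * ell) / sqrt (real (Suc n))"
    proof (cases "\<mu> (rec t \<omega>) < \<mu> (anchor t \<omega>)")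
      case False
      then have "\<mu> (anchor t \<omega>) - \<mu> (rec t \<omega>) \<le> 0" by simp
      also have "0 \<le> 4 * sqrt (real (arms S) * ell) / sqrt (real (Suc n))" using ell by simp
      finally show ?thesis .
    next
      case True
      define \<delta> where "\<delta> = \<mu> (anchor t \<omega>) - \<mu> (rec t \<omega>)"
      have "\<delta>\<^sup>2 * real q \<le> 8 * ell"
        using iv True rB aB Exploring unfolding inv_def \<delta>_def by blast
      then have "2 * real (arms S) * (\<delta>\<^sup>2 * real q) \<le> 2 * real (arms S) * (8 * ell)"
        by (intro mult_left_mono) auto
      moreover have "\<delta>\<^sup>2 * real (Suc n) \<le> \<delta>\<^sup>2 * (2 * real (arms S) * real q)"
        using nq by (intro mult_left_mono) auto
      \<comment> \<open>2 m from the count times 8 ell from the invariant; the root gives the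
        constant 4.\<close>
      ultimately have "\<delta>\<^sup>2 * real (Suc n) \<le> 16 * (real (arms S) * ell)"
        by (simp add: mult_ac)
      then have "sqrt (\<delta>\<^sup>2 * real (Suc n)) \<le> sqrt (16 * (real (arms S) * ell))"
        by (rule real_sqrt_le_mono)
      moreover have "sqrt (\<delta>\<^sup>2 * real (Suc n)) = \<delta> * sqrt (real (Suc n))"
        using True unfolding real_sqrt_mult by (simp add: \<delta>_def)
      moreover have "sqrt (16 * (real (arms S) * ell)) = 4 * sqrt (real (arms S) * ell)"
        unfolding real_sqrt_mult[of 16] by simp
      ultimately have "\<delta> * sqrt (real (Suc n)) \<le> 4 * sqrt (real (arms S) * ell)" by linarith
      then show ?thesis unfolding \<delta>_def by (subst pos_le_divide_eq) simp_all
    qed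
    also have "\<dots> = 4 * sqrt (real (arms S) * ell) * (1 / sqrt (real (Suc n)))" by simp
    also have "\<dots> \<le> 4 * sqrt (real (arms S) * ell) * (2 * (sqrt (real (Suc n)) - sqrt (real n)))"
      using ell by (intro mult_left_mono inverse_sqrt_le) auto
    finally have "\<mu> (anchor t \<omega>) - \<mu> (rec t \<omega>) \<le>
        8 * sqrt (real (arms S) * ell) * (sqrt (real (Suc n)) - sqrt (real n))" by (simp add: algebra_simps)
    then have "step_regret t \<omega> \<le> drop \<omega> +
        8 * sqrt (real (arms S) * ell) * (sqrt (real (Suc n)) - sqrt (real n))"
      using inv_gap[OF iv] by (simp add: reg gap_def)
    then show ?thesis by (simp add: us n_def)
  qed
qed

text \<open>A bad path is charged 1 per round. On a good one the increments of
  \<open>exploring_step\<close> telescope to the root of the number of collected rewards, which is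
  at most T.\<close>

lemma exploration_regret:
  assumes \<omega>: "\<omega> \<in> space M"
  shows "(\<Sum>t<T. of_bool (\<not> is_sampling t \<omega>) * step_regret t \<omega>) \<le>
    real T * indicator {\<omega>\<in>space M. bad \<omega>} \<omega> + real T * drop \<omega> + 8 * sqrt (real (arms S) * ell * real T)"
proof (cases "bad \<omega>")
  case True
  have "(\<Sum>t<T. of_bool (\<not> is_sampling t \<omega>) * step_regret t \<omega>) \<le> (\<Sum>t<T. 1)"
    using step_regret_range[OF \<omega>] by (intro sum_mono) (auto simp: of_bool_def)
  moreover have "(\<Sum>t<T. 1) = real T * indicator {\<omega>\<in>space M. bad \<omega>} \<omega>" using True \<omega> by simp
  moreover have "0 \<le> real T * drop \<omega>" using drop_nonneg by simp
  moreover have "0 \<le> 8 * sqrt (real (arms S) * ell * real T)" using ell by simp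
  ultimately show ?thesis by linarith
next
  case False
  have "(\<Sum>t<n. of_bool (\<not> is_sampling t \<omega>) * step_regret t \<omega>) \<le>
      real n * drop \<omega> + 8 * sqrt (real (arms S) * ell) * sqrt (real (length (used n \<omega>)))" if "n \<le> T" for n
    using that
  proof (induction n)
    case (Suc n)
    have "of_bool (\<not> is_sampling n \<omega>) * step_regret n \<omega> \<le> drop \<omega> + 8 * sqrt (real (arms S) * ell) *
        (sqrt (real (length (used (Suc n) \<omega>))) - sqrt (real (length (used n \<omega>))))"
    proof (cases "is_sampling n \<omega>")
      case True
      then show ?thesis using progress_nonneg[OF \<omega>, of n] drop_nonneg[of \<omega>] by simp
    next
      case ns: False
      then show ?thesis using exploring_step[OF \<omega> False, of n] Suc.prems by simp
    qed
    then show ?case using Suc by (simp add: algebra_simps)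
  qed simp
  from this[of T] have "(\<Sum>t<T. of_bool (\<not> is_sampling t \<omega>) * step_regret t \<omega>) \<le>
      real T * drop \<omega> + 8 * sqrt (real (arms S) * ell) * sqrt (real (length (used T \<omega>)))" by simp
  also have "8 * sqrt (real (arms S) * ell) * sqrt (real (length (used T \<omega>))) \<le>
      8 * sqrt (real (arms S) * ell) * sqrt (real T)"
    using ok_st(3)[OF \<omega>, of T] ell by (intro mult_left_mono) auto
  finally show ?thesis using False by (simp add: real_sqrt_mult mult.assoc)
qed

text \<open>If \<open>k > T\<close> the sampling step never ends.\<close>

lemma exploration_regret_0:
  assumes \<omega>: "\<omega> \<in> space M" and k: "T < samples S"
  shows "(\<Sum>t<T. of_bool (\<not> is_sampling t \<omega>) * step_regret t \<omega>) = 0"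
proof (rule sum.neutral, rule ballI)
  fix t assume t: "t \<in> {..<T}"
  have "is_sampling t \<omega>"
  proof (rule ccontr)
    assume "\<not> is_sampling t \<omega>"
    then have "samples S \<le> pulls t \<omega> 1"
      using ok_st(1)[OF \<omega>, of t] arms_pos
      by (cases "phase_at t \<omega>") (auto simp: is_sampling_def ok_phase_def)
    then show False
      using num_used_le_length[of "used t \<omega>" 1] ok_st(3)[OF \<omega>, of t] t k by simp
  qed
  then show "of_bool (\<not> is_sampling t \<omega>) * step_regret t \<omega> = 0" by simp
qed

lemma measurable_is_sampling [measurable]: "Measurable.pred M (is_sampling t)"
  unfolding is_sampling_def[abs_def]
  by (rule measurable_compose[OF measurable_st, of "\<lambda>\<sigma>. \<exists>i a n. fst \<sigma> = Sampling i a n"]) simp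

lemma measurable_step_regret [measurable]: "step_regret t \<in> borel_measurable M"
proof -
  have [measurable]: "(\<lambda>\<omega>. gap (rec t \<omega>)) \<in> borel_measurable M"
    by (rule measurable_compose[OF measurable_rec]) simp
  show ?thesis unfolding step_regret_def[abs_def] by measurable
qed

lemma measurable_drop [measurable]: "drop \<in> borel_measurable M"
  unfolding drop_def[abs_def] by measurable

lemma measurable_bad [measurable]: "Measurable.pred M bad"
  unfolding bad_def[abs_def] cheap_kill_def later_kill_def strayed_def by measurable

section \<open>From losses to mean rewards\<close>

lemma expectation_fresh:
  assumes i: "i \<in> {1..arms S}" and "t < s" and P [measurable]: "Measurable.pred M P" and pP: "past t P"
  shows "expectation (\<lambda>\<omega>. fst \<omega> (i, s) * of_bool (P \<omega>)) = \<mu> i * \<P>(\<omega> in M. P \<omega>)"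
    and "integrable M (\<lambda>\<omega>. fst \<omega> (i, s) * of_bool (P \<omega>))"
proof -
  interpret P: prob_space "\<nu> i" by (rule prob_space_\<nu>[OF i])
  have x: "0 \<le> fst \<omega> (i, s) \<and> fst \<omega> (i, s) \<le> 1" if "\<omega> \<in> space M" for \<omega>
  proof -
    obtain x u v where \<omega>: "\<omega> = (x, u, v)" by (cases \<omega>)
    have "x \<in> ({1..arms S} \<times> UNIV) \<rightarrow>\<^sub>E {0..1}" using that unfolding \<omega> space_M_iff by blast
    from PiE_mem[OF this, of "(i, s)"] i have "x (i, s) \<in> {0..1}" by simp
    then show ?thesis by (simp add: \<omega>)
  qed
  have mu: "(\<integral>\<^sup>+z. ennreal z \<partial>\<nu> i) = ennreal (\<mu> i)"
    unfolding mean_def by (rule nn_integral_eq_integral[OF integrable_id_\<nu>[OF i]]) (auto simp: space_\<nu>[OF i])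
  have "(\<integral>\<^sup>+\<omega>. ennreal (fst \<omega> (i, s) * of_bool (P \<omega>)) \<partial>M) =
      (\<integral>\<^sup>+\<omega>. ennreal (fst \<omega> (i, s)) * ennreal (of_bool (P \<omega>)) \<partial>M)"
    using x by (intro nn_integral_cong) (auto simp: ennreal_mult)
  also have "\<dots> = ennreal (\<mu> i) * (\<integral>\<^sup>+\<omega>. ennreal (of_bool (P \<omega>)) \<partial>M)"
    unfolding mu[symmetric]
    by (rule nn_integral_fresh[OF i \<open>t < s\<close> _ _ past_compose[OF pP]]) measurable
  also have "(\<integral>\<^sup>+\<omega>. ennreal (of_bool (P \<omega>)) \<partial>M) = (\<integral>\<^sup>+\<omega>. indicator {\<omega>\<in>space M. P \<omega>} \<omega> \<partial>M)"
    by (intro nn_integral_cong) (auto simp: indicator_def)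
  also have "\<dots> = ennreal (\<P>(\<omega> in M. P \<omega>))" by (simp add: emeasure_eq_measure)
  finally have nn: "(\<integral>\<^sup>+\<omega>. ennreal (fst \<omega> (i, s) * of_bool (P \<omega>)) \<partial>M) = ennreal (\<mu> i * \<P>(\<omega> in M. P \<omega>))"
    using mean_range[OF i] by (simp add: ennreal_mult)
  show "expectation (\<lambda>\<omega>. fst \<omega> (i, s) * of_bool (P \<omega>)) = \<mu> i * \<P>(\<omega> in M. P \<omega>)"
    using x mean_range[OF i] by (subst integral_eq_nn_integral) (auto simp: nn)
  show "integrable M (\<lambda>\<omega>. fst \<omega> (i, s) * of_bool (P \<omega>))"
    using x by (intro integrable_const_bound[of _ 1]) auto
qed

lemma expectation_of_bool:
  "expectation (\<lambda>\<omega>. of_bool (P \<omega>)) = \<P>(\<omega> in M. P \<omega>)"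
proof -
  have "expectation (\<lambda>\<omega>. of_bool (P \<omega>)) = expectation (indicat_real {\<omega>\<in>space M. P \<omega>})"
    by (intro Bochner_Integration.integral_cong) (auto simp: indicator_def)
  also have "\<dots> = prob ({\<omega>\<in>space M. P \<omega>} \<inter> space M)" by simp
  also have "{\<omega>\<in>space M. P \<omega>} \<inter> space M = {\<omega>\<in>space M. P \<omega>}" by blast
  finally show ?thesis .
qed

lemma expectation_rec:
  "expectation (\<lambda>\<omega>. fst \<omega> (rec t \<omega>, Suc t) * of_bool (fol t \<omega>)) = expectation (\<lambda>\<omega>. \<mu> (rec t \<omega>) * of_bool (fol t \<omega>))"
  "integrable M (\<lambda>\<omega>. fst \<omega> (rec t \<omega>, Suc t) * of_bool (fol t \<omega>))"
proof -
  define P where "P i \<omega> \<longleftrightarrow> rec t \<omega> = i \<and> fol t \<omega>" for i \<omega>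
  have P [measurable]: "Measurable.pred M (P i)" for i unfolding P_def[abs_def] by measurable
  have pP: "past t (P i)" for i
    unfolding P_def[abs_def] by (rule past_compose2[where f = "\<lambda>r f. r = i \<and> f"]) (rule rec_past fol_past)+
  have split: "f (rec t \<omega>) * of_bool (fol t \<omega>) = (\<Sum>i\<in>{1..arms S}. f i * of_bool (P i \<omega>))"
    if "\<omega> \<in> space M" for \<omega> and f :: "nat \<Rightarrow> real"
  proof -
    have "(\<Sum>i\<in>{1..arms S}. f i * of_bool (P i \<omega>)) = (\<Sum>i\<in>{rec t \<omega>}. f i * of_bool (P i \<omega>))"
      using rec_mem[OF that, of t] by (intro sum.mono_neutral_right) (auto simp: P_def)
    then show ?thesis by (simp add: P_def)
  qed
  note fresh = expectation_fresh[OF _ lessI P pP]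
  have ind: "integrable M (\<lambda>\<omega>. of_bool (P i \<omega>) :: real)" for i
    by (intro integrable_const_bound[of _ 1]) auto
  have pr: "expectation (\<lambda>\<omega>. of_bool (P i \<omega>)) = \<P>(\<omega> in M. P i \<omega>)" for i
    by (rule expectation_of_bool)
  have "expectation (\<lambda>\<omega>. fst \<omega> (rec t \<omega>, Suc t) * of_bool (fol t \<omega>)) =
      expectation (\<lambda>\<omega>. \<Sum>i\<in>{1..arms S}. fst \<omega> (i, Suc t) * of_bool (P i \<omega>))"
    by (intro Bochner_Integration.integral_cong refl split)
  also have "\<dots> = (\<Sum>i\<in>{1..arms S}. \<mu> i * \<P>(\<omega> in M. P i \<omega>))"
    by (subst Bochner_Integration.integral_sum) (simp_all add: fresh)
  also have "\<dots> = expectation (\<lambda>\<omega>. \<Sum>i\<in>{1..arms S}. \<mu> i * of_bool (P i \<omega>))"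
    using ind by (subst Bochner_Integration.integral_sum) (simp_all add: pr)
  also have "\<dots> = expectation (\<lambda>\<omega>. \<mu> (rec t \<omega>) * of_bool (fol t \<omega>))"
    by (intro Bochner_Integration.integral_cong refl split[symmetric])
  finally show "expectation (\<lambda>\<omega>. fst \<omega> (rec t \<omega>, Suc t) * of_bool (fol t \<omega>)) =
      expectation (\<lambda>\<omega>. \<mu> (rec t \<omega>) * of_bool (fol t \<omega>))" .
  have "integrable M (\<lambda>\<omega>. \<Sum>i\<in>{1..arms S}. fst \<omega> (i, Suc t) * of_bool (P i \<omega>))"
    using fresh(2) by (intro Bochner_Integration.integrable_sum) auto
  then show "integrable M (\<lambda>\<omega>. fst \<omega> (rec t \<omega>, Suc t) * of_bool (fol t \<omega>))"
    using split[of _ "\<lambda>i. fst _ (i, Suc t)"]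
    by (subst Bochner_Integration.integrable_cong[OF refl split]) auto
qed

text \<open>The subtracted reward does not involve the maximized index, so the maximum is attained
  at b.\<close>

lemma loss_eq:
  assumes "integrable M (\<lambda>\<omega>. fst \<omega> (J (\<nu>, \<omega>), Suc t) * of_bool (fol t \<omega>))"
  shows "loss S \<nu> (Suc t) J = \<mu> b - expectation (\<lambda>\<omega>. fst \<omega> (J (\<nu>, \<omega>), Suc t) * of_bool (fol t \<omega>))"
proof -
  let ?e = "expectation (\<lambda>\<omega>. fst \<omega> (J (\<nu>, \<omega>), Suc t) * of_bool (fol t \<omega>))"
  have y: "arp_y S (Suc t) (\<nu>, \<omega>) = fol t \<omega>" for \<omega>
    by (simp add: arp_y_def fol_def)
  have "expectation (\<lambda>\<omega>. fst \<omega> (i, Suc t) - fst \<omega> (J (\<nu>, \<omega>), Suc t) * of_bool (fol t \<omega>)) = \<mu> i - ?e"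
    if i: "i \<in> {1..arms S}" for i
  proof -
    note f = expectation_fresh[OF i lessI, of "\<lambda>_. True" t]
    have "integrable M (\<lambda>\<omega>. fst \<omega> (i, Suc t))" "expectation (\<lambda>\<omega>. fst \<omega> (i, Suc t)) = \<mu> i"
      using f by (simp_all add: past_def prob_space)
    then show ?thesis using assms by simp
  qed
  then have "loss S \<nu> (Suc t) J = Max ((\<lambda>i. \<mu> i - ?e) ` {1..arms S})"
    unfolding loss_def y by (intro arg_cong[where f = Max] image_cong) auto
  also have "\<dots> = \<mu> b - ?e"
    using b b_max by (intro Max_eqI) auto
  finally show ?thesis .
qed

text \<open>A fixed arm is evaluated with the same decisions \<open>fol\<close> as the policy. The
  terms \<mu> b therefore cancel, only followed rounds remain, and every fixed arm loses at least as
  much as b.\<close>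

lemma regret_le: "regret S \<nu> \<le> expectation (\<lambda>\<omega>. \<Sum>t<T. step_regret t \<omega>)"
proof -
  define p where "p t = \<P>(\<omega> in M. fol t \<omega>)" for t
  have shift: "(\<Sum>t = 1..T. f t) = (\<Sum>t<T. f (Suc t))" for f :: "nat \<Rightarrow> real"
    by (rule sum.reindex_bij_witness[of _ Suc "\<lambda>t. t - 1"]) auto
  have I: "arp_I S (Suc t) (\<nu>, \<omega>) = rec t \<omega>" for t \<omega>
    by (simp add: arp_I_def recommendation_arp)
  have ind: "integrable M (\<lambda>\<omega>. of_bool (fol t \<omega>) :: real)" for t
    by (intro integrable_const_bound[of _ 1]) auto
  have [measurable]: "(\<lambda>\<omega>. \<mu> (rec t \<omega>)) \<in> borel_measurable M" for t
    by (rule measurable_compose[OF measurable_rec]) simp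
  have intr: "integrable M (\<lambda>\<omega>. \<mu> (rec t \<omega>) * of_bool (fol t \<omega>))" for t
    using mean_range rec_mem by (intro integrable_const_bound[of _ 1]) auto
  have pe: "expectation (\<lambda>\<omega>. of_bool (fol t \<omega>)) = p t" for t
    unfolding p_def by (rule expectation_of_bool)
  have l1: "loss S \<nu> (Suc t) (arp_I S (Suc t)) = \<mu> b - expectation (\<lambda>\<omega>. \<mu> (rec t \<omega>) * of_bool (fol t \<omega>))" for t
    using loss_eq[of "arp_I S (Suc t)" t] expectation_rec[of t] by (simp add: I)
  have l2: "loss S \<nu> (Suc t) (\<lambda>_. i) = \<mu> b - \<mu> i * p t" if "i \<in> {1..arms S}" for i t
    using loss_eq[of "\<lambda>_. i" t] expectation_fresh[OF that lessI measurable_fol fol_past, of t] by (simp add: p_def)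
  let ?f = "\<lambda>i. \<Sum>t = 1..T. loss S \<nu> t (\<lambda>_. i)"
  have "Min (?f ` {1..arms S}) \<in> ?f ` {1..arms S}" using arms_pos by (intro Min_in) auto
  then obtain i where i: "i \<in> {1..arms S}" "Min (?f ` {1..arms S}) = ?f i" by auto
  have "(\<Sum>t<T. \<mu> b - \<mu> b * p t) \<le> (\<Sum>t<T. \<mu> b - \<mu> i * p t)"
    using b_max[OF i(1)] by (intro sum_mono) (auto simp: p_def intro: mult_right_mono)
  also have "\<dots> = ?f i" unfolding shift by (simp add: l2[OF i(1)])
  finally have lower: "(\<Sum>t<T. \<mu> b - \<mu> b * p t) \<le> ?f i" .
  have "(\<Sum>t = 1..T. loss S \<nu> t (arp_I S t)) =
      (\<Sum>t<T. \<mu> b - expectation (\<lambda>\<omega>. \<mu> (rec t \<omega>) * of_bool (fol t \<omega>)))"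
    by (simp only: shift l1)
  with lower have "regret S \<nu> \<le> (\<Sum>t<T. \<mu> b - expectation (\<lambda>\<omega>. \<mu> (rec t \<omega>) * of_bool (fol t \<omega>)))
      - (\<Sum>t<T. \<mu> b - \<mu> b * p t)"
    unfolding regret_def i(2) by linarith
  also have "\<dots> = (\<Sum>t<T. \<mu> b * p t - expectation (\<lambda>\<omega>. \<mu> (rec t \<omega>) * of_bool (fol t \<omega>)))"
    by (simp add: sum_subtractf)
  also have "\<dots> = (\<Sum>t<T. expectation (step_regret t))"
  proof (rule sum.cong[OF refl])
    fix t
    have "expectation (step_regret t) = expectation (\<lambda>\<omega>. \<mu> b * of_bool (fol t \<omega>) - \<mu> (rec t \<omega>) * of_bool (fol t \<omega>))"
      by (intro Bochner_Integration.integral_cong) (auto simp: step_regret_def gap_def)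
    then show "\<mu> b * p t - expectation (\<lambda>\<omega>. \<mu> (rec t \<omega>) * of_bool (fol t \<omega>)) = expectation (step_regret t)"
      using ind intr by (simp add: pe)
  qed
  also have "\<dots> = expectation (\<lambda>\<omega>. \<Sum>t<T. step_regret t \<omega>)"
    using step_regret_range
    by (subst Bochner_Integration.integral_sum) (auto intro!: integrable_const_bound[of _ 1])
  finally show ?thesis .
qed

lemma sampling_length_ge:
  assumes \<omega>: "\<omega> \<in> space M"
  shows "(\<Sum>t<T. of_bool (is_sampling t \<omega>)) \<le> real (sampling_length S (\<nu>, \<omega>))"
proof -
  have card: "stage_length S i (\<nu>, \<omega>) = (\<Sum>t<T. of_bool (\<exists>a n. phase_at t \<omega> = Sampling i a n))" for i
  proof -
    have "stage_length S i (\<nu>, \<omega>) = (\<Sum>t\<in>{1..T}. of_bool (\<exists>a n. phase_at (t - 1) \<omega> = Sampling i a n))"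
      by (simp add: stage_length_def st_def Int_def)
    also have "\<dots> = (\<Sum>t<T. of_bool (\<exists>a n. phase_at t \<omega> = Sampling i a n))"
      by (rule sum.reindex_bij_witness[of _ Suc "\<lambda>t. t - 1"]) auto
    finally show ?thesis .
  qed
  have "(\<Sum>t<T. of_bool (is_sampling t \<omega>)) \<le> (\<Sum>t<T. \<Sum>i = 1..arms S. of_bool (\<exists>a n. phase_at t \<omega> = Sampling i a n) :: nat)"
  proof (intro sum_mono)
    fix t
    show "of_bool (is_sampling t \<omega>) \<le> (\<Sum>i = 1..arms S. of_bool (\<exists>a n. phase_at t \<omega> = Sampling i a n) :: nat)"
    proof (cases "is_sampling t \<omega>")
      case True
      then obtain i a n where s: "phase_at t \<omega> = Sampling i a n" by (auto simp: is_sampling_def)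
      then have "i \<in> {1..arms S}" using ok_st(1)[OF \<omega>, of t] by (simp add: ok_phase_def)
      then show ?thesis
        using member_le_sum[of i "{1..arms S}" "\<lambda>i. of_bool (\<exists>a n. phase_at t \<omega> = Sampling i a n) :: nat"] s True
        by simp
    qed simp
  qed
  also have "\<dots> = sampling_length S (\<nu>, \<omega>)"
    unfolding sampling_length_def card by (rule sum.swap)
  finally have "real (\<Sum>t<T. of_bool (is_sampling t \<omega>)) \<le> real (sampling_length S (\<nu>, \<omega>))"
    by (subst of_nat_le_iff)
  then show ?thesis by simp
qed

lemma integrable_sampling_length: "integrable M (\<lambda>\<omega>. real (sampling_length S (\<nu>, \<omega>)))"
proof -
  have [measurable]: "Measurable.pred M (\<lambda>\<omega>. \<exists>a n. phase_at t \<omega> = Sampling i a n)" for t i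
    by (rule measurable_compose[OF measurable_st, of "\<lambda>\<sigma>. \<exists>a n. fst \<sigma> = Sampling i a n"]) simp
  have eq: "real (sampling_length S (\<nu>, \<omega>)) =
      (\<Sum>i = 1..arms S. \<Sum>t\<in>{1..T}. of_bool (\<exists>a n. phase_at (t - 1) \<omega> = Sampling i a n))" for \<omega>
    by (simp add: sampling_length_def stage_length_def st_def Int_def)
  show ?thesis
    unfolding eq
    by (intro Bochner_Integration.integrable_sum integrable_const_bound[of _ 1]) auto
qed

lemma regret_bound_of_exploration:
  assumes "integrable M f"
    and "\<And>\<omega>. \<omega> \<in> space M \<Longrightarrow> (\<Sum>t<T. of_bool (\<not> is_sampling t \<omega>) * step_regret t \<omega>) \<le> f \<omega>"
  shows "regret S \<nu> \<le> expected_sampling_length S \<nu> + expectation f"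
proof -
  have "expectation (\<lambda>\<omega>. \<Sum>t<T. step_regret t \<omega>) \<le> expectation (\<lambda>\<omega>. real (sampling_length S (\<nu>, \<omega>)) + f \<omega>)"
  proof (rule integral_mono)
    show "integrable M (\<lambda>\<omega>. \<Sum>t<T. step_regret t \<omega>)"
      using step_regret_range by (intro Bochner_Integration.integrable_sum integrable_const_bound[of _ 1]) auto
    show "integrable M (\<lambda>\<omega>. real (sampling_length S (\<nu>, \<omega>)) + f \<omega>)"
      using integrable_sampling_length assms(1) by simp
    fix \<omega> assume \<omega>: "\<omega> \<in> space M"
    have "(\<Sum>t<T. step_regret t \<omega>) \<le> (\<Sum>t<T. of_bool (is_sampling t \<omega>) + of_bool (\<not> is_sampling t \<omega>) * step_regret t \<omega>)"
      using step_regret_range[OF \<omega>] by (intro sum_mono) (auto simp: of_bool_def)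
    then show "(\<Sum>t<T. step_regret t \<omega>) \<le> real (sampling_length S (\<nu>, \<omega>)) + f \<omega>"
      using sampling_length_ge[OF \<omega>] assms(2)[OF \<omega>] by (simp add: sum.distrib)
  qed
  then show ?thesis
    using regret_le integrable_sampling_length assms(1) by (simp add: expected_sampling_length_def)
qed

lemma bad_prob:
  assumes g: "1 \<le> (\<mu> b - cstar S) * sqrt (2 * real (samples S))"
  shows "\<P>(\<omega> in M. bad \<omega>) \<le> (real (arms S) + 1) * (2 * p_base) + real (arms S) ^ 3 * p_cross\<^sup>2
    + real (arms S) ^ 2 * exp (- (4 * ell))"
proof -
  have [measurable]: "Measurable.pred M cheap_kill" "Measurable.pred M later_kill" "Measurable.pred M strayed"
    unfolding cheap_kill_def[abs_def] later_kill_def[abs_def] strayed_def[abs_def] by measurable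
  have "{\<omega>\<in>space M. bad \<omega>} = {\<omega>\<in>space M. cheap_kill \<omega>} \<union> {\<omega>\<in>space M. later_kill \<omega>} \<union> {\<omega>\<in>space M. strayed \<omega>}"
    by (auto simp: bad_def)
  also have "prob \<dots> \<le> prob ({\<omega>\<in>space M. cheap_kill \<omega>} \<union> {\<omega>\<in>space M. later_kill \<omega>}) + \<P>(\<omega> in M. strayed \<omega>)"
    by (rule measure_Un_le) measurable
  also have "prob ({\<omega>\<in>space M. cheap_kill \<omega>} \<union> {\<omega>\<in>space M. later_kill \<omega>}) \<le>
      \<P>(\<omega> in M. cheap_kill \<omega>) + \<P>(\<omega> in M. later_kill \<omega>)"
    by (rule measure_Un_le) measurable
  finally show ?thesis
    using cheap_kill_prob[OF g] later_kill_prob strayed_prob by linarith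
qed

text \<open>The coefficient 2 m + 1 merges the m + 1 of \<open>cheap_kill_prob\<close> with the m of
  \<open>expectation_drop\<close>.\<close>

theorem regret_bound:
  assumes g: "1 \<le> (\<mu> b - cstar S) * sqrt (2 * real (samples S))"
  defines "m \<equiv> real (arms S)"
  shows "regret S \<nu> \<le> expected_sampling_length S \<nu> + real T * ((2 * m + 1) * (2 * p_base) + m ^ 3 * p_cross\<^sup>2
    + m ^ 2 * exp (- (4 * ell))) + 8 * sqrt (m * ell * real T)"
    and "T < samples S \<Longrightarrow> regret S \<nu> \<le> expected_sampling_length S \<nu>"
proof -
  let ?f = "\<lambda>\<omega>. real T * indicator {\<omega>\<in>space M. bad \<omega>} \<omega> + real T * drop \<omega> + 8 * sqrt (real (arms S) * ell * real T)"
  have i1: "integrable M (indicat_real {\<omega>\<in>space M. bad \<omega>})" by (rule integrable_pred_indicator) measurable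
  have i2: "integrable M drop"
  proof (rule integrable_const_bound[of _ "\<Sum>i\<in>{1..arms S} - {b}. gap i"])
    show "AE \<omega> in M. norm (drop \<omega>) \<le> (\<Sum>i\<in>{1..arms S} - {b}. gap i)"
    proof (rule AE_I2)
      fix \<omega>
      have "drop \<omega> \<le> (\<Sum>i\<in>{1..arms S} - {b}. gap i)"
        unfolding drop_def using gap_nonneg by (intro sum_mono) auto
      then show "norm (drop \<omega>) \<le> (\<Sum>i\<in>{1..arms S} - {b}. gap i)" using drop_nonneg[of \<omega>] by simp
    qed
  qed measurable
  have "regret S \<nu> \<le> expected_sampling_length S \<nu> + expectation ?f"
    using i1 i2 by (intro regret_bound_of_exploration exploration_regret) auto
  also have "expectation ?f = real T * \<P>(\<omega> in M. bad \<omega>) + real T * expectation drop + 8 * sqrt (m * ell * real T)"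
    using i1 i2 by (simp add: m_def prob_space)
  also have "\<dots> \<le> real T * ((m + 1) * (2 * p_base) + m ^ 3 * p_cross\<^sup>2 + m ^ 2 * exp (- (4 * ell)))
      + real T * (m * (2 * p_base)) + 8 * sqrt (m * ell * real T)"
    unfolding m_def using bad_prob[OF g] expectation_drop by (intro add_mono mult_left_mono) auto
  finally show "regret S \<nu> \<le> expected_sampling_length S \<nu> + real T * ((2 * m + 1) * (2 * p_base) + m ^ 3 * p_cross\<^sup>2
    + m ^ 2 * exp (- (4 * ell))) + 8 * sqrt (m * ell * real T)"
    by (simp add: algebra_simps)
  show "regret S \<nu> \<le> expected_sampling_length S \<nu>" if "T < samples S"
    using regret_bound_of_exploration[of "\<lambda>_. 0"] exploration_regret_0[OF _ that] by simp
qed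

end

section \<open>Balancing the error terms\<close>

lemma rate_numerics:
  fixes m t th l N :: real
  assumes m: "2 \<le> m" and th: "4 * m\<^sup>2 \<le> th" and t: "1 \<le> t" and l: "l = ln (t * th)"
    and k: "th\<^sup>2 * l \<le> t" and N: "0 \<le> N" "N \<le> sqrt l * ln t + 2"
  shows "t * ((2 * m + 1) * (2 * exp (1 / 2 - l / 2)) + m ^ 3 * (N * exp (1 / 2 - l / 2))\<^sup>2
    + m\<^sup>2 * exp (- (4 * l))) + 8 * sqrt (m * l * t) \<le> 7200 * sqrt (m * t * ln (m * t))"
proof -
  have m2: "4 \<le> m\<^sup>2" using power_mono[OF m, of 2] by simp
  have th16: "16 \<le> th" using m2 th by linarith
  have tth: "16 \<le> t * th" using mult_mono[OF t th16] t by simp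
  have e3: "exp 1 \<le> (3::real)" by (rule exp_le)
  then have "exp 1 \<le> t * th" using tth by linarith
  then have l1: "1 \<le> l" using tth unfolding l by (subst ln_ge_iff) auto
  have "th\<^sup>2 \<le> th\<^sup>2 * l" using l1 by (simp add: mult_le_cancel_left1)
  then have th2: "th\<^sup>2 \<le> t" using k by linarith
  have "16\<^sup>2 \<le> th\<^sup>2" using th16 by (intro power_mono) auto
  then have t256: "256 \<le> t" using th2 by simp
  then have "exp 1 \<le> t" using e3 by linarith
  then have lnt: "1 \<le> ln t" using t by (subst ln_ge_iff) auto
  \<comment> \<open>From th^2 \<le> t the logarithm of th costs at most half of ln t, so l \<le> 3/2
    ln t.\<close>
  have "ln (th\<^sup>2) \<le> ln t" using th2 th16 t by (subst ln_le_cancel_iff) auto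
  then have "2 * ln th \<le> ln t" using th16 by (simp add: ln_realpow)
  moreover have "l = ln t + ln th" using t th16 unfolding l by (simp add: ln_mult)
  ultimately have l_le: "l \<le> 3 / 2 * ln t" by simp
  have "ln t \<le> ln (m * t)" using m t by (subst ln_le_cancel_iff) auto
  then have lnmt: "1 \<le> ln (m * t)" "l \<le> 3 / 2 * ln (m * t)" using lnt l_le by linarith+
  define Y where "Y = sqrt (m * t * ln (m * t))"
  have mt: "0 \<le> m * t" using m t by simp
  then have "m * t \<le> m * t * ln (m * t)" using lnmt by (simp add: mult_le_cancel_left1)
  then have Y1: "sqrt (m * t) \<le> Y" unfolding Y_def by (rule real_sqrt_le_mono)
  have "sqrt t \<le> sqrt (m * t)" using m t by (intro real_sqrt_le_mono) simp
  then have Y2: "sqrt t \<le> Y" using Y1 by linarith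
  \<comment> \<open>The factor 3/2 is enlarged to its square so that the root is rational.\<close>
  have "m * l * t \<le> (3 / 2)\<^sup>2 * (m * t * ln (m * t))"
  proof -
    have "m * t * l \<le> m * t * ((3 / 2)\<^sup>2 * ln (m * t))"
      using lnmt mt by (intro mult_left_mono) (auto simp: power2_eq_square)
    then show ?thesis by (simp add: mult_ac)
  qed
  then have "sqrt (m * l * t) \<le> sqrt ((3 / 2)\<^sup>2 * (m * t * ln (m * t)))" by (rule real_sqrt_le_mono)
  also have "\<dots> = 3 / 2 * Y" unfolding Y_def real_sqrt_mult[of "(3 / 2)\<^sup>2"] by simp
  finally have s4: "8 * sqrt (m * l * t) \<le> 12 * Y" by simp
  define E where "E = exp (1 / 2 - l / 2)"
  have expl: "exp (- l) = 1 / (t * th)" using tth unfolding l by (simp add: exp_minus field_simps)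
  \<comment> \<open>exp 1 \<le> 4 cancels the 4 in 4 m^2 \<le> th, leaving E \<le> 1 / (m sqrt
    t).\<close>
  have "E\<^sup>2 = exp 1 * exp (- l)" unfolding E_def by (simp add: power2_eq_square flip: exp_add)
  also have "\<dots> \<le> 4 * (1 / (t * (4 * m\<^sup>2)))"
  proof -
    have "1 / (t * th) \<le> 1 / (t * (4 * m\<^sup>2))"
      using th th16 t m2 by (intro divide_left_mono mult_left_mono mult_pos_pos) linarith+
    then show ?thesis
      unfolding expl using e3 th16 t by (intro mult_mono) auto
  qed
  finally have E2: "E\<^sup>2 \<le> 1 / (m\<^sup>2 * t)" by (simp add: mult.commute)
  have "E\<^sup>2 \<le> (1 / (m * sqrt t))\<^sup>2" using E2 t by (simp add: power_divide power_mult_distrib)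
  then have E1: "E \<le> 1 / (m * sqrt t)" by (rule power2_le_imp_le) (use m t in auto)
  have s1: "t * ((2 * m + 1) * (2 * E)) \<le> 6 * Y"
  proof -
    have "t * ((2 * m + 1) * (2 * E)) \<le> t * ((3 * m) * (2 * (1 / (m * sqrt t))))"
      using E1 m t by (intro mult_left_mono mult_mono) (auto simp: E_def)
    also have "\<dots> = 6 * (t / sqrt t)" using m by simp
    also have "\<dots> = 6 * sqrt t" using t by (simp add: real_div_sqrt)
    finally show ?thesis using Y2 by linarith
  qed
  have s3: "t * (m\<^sup>2 * exp (- (4 * l))) \<le> Y"
  proof -
    have "t * (m\<^sup>2 * exp (- (4 * l))) \<le> t * (m\<^sup>2 * exp (- l))"
      using l1 t by (intro mult_left_mono) auto
    also have "\<dots> = m\<^sup>2 / th" using t expl by simp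
    also have "\<dots> \<le> 1" using th th16 m2 by (simp add: divide_le_eq)
    also have "1 \<le> sqrt t" using t by simp
    finally show ?thesis using Y2 by linarith
  qed
  have s2: "t * (m ^ 3 * (N * E)\<^sup>2) \<le> 7168 * Y"
  proof -
    \<comment> \<open>The second term is at most m N^2, with N^2 of order (ln t)^3. Here ln t \<le>
      8 z, and sqrt m \<le> z because m^4 \<le> th^2 \<le> t; hence m z^3 \<le> sqrt m z^4 = sqrt (m
      t). The constant is 27/2 * 8^3 = 6912, rounded up to 7168.\<close>
    define z where "z = root 8 t"
    have z: "z ^ 8 = t" "0 < z" using t by (simp_all add: z_def)
    have "ln t = 8 * ln z" using z by (simp flip: z(1) add: ln_realpow)
    also have "\<dots> \<le> 8 * z" using ln_le_minus_one[of z] z by linarith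
    finally have lnz: "ln t \<le> 8 * z" .
    have "1 \<le> sqrt l * ln t" using mult_mono[of 1 "sqrt l" 1 "ln t"] l1 lnt by simp
    then have "N \<le> 3 * (sqrt l * ln t)" using N by linarith
    then have "N\<^sup>2 \<le> (3 * (sqrt l * ln t))\<^sup>2" using N by (intro power_mono)
    also have "\<dots> = 9 * (l * (ln t)\<^sup>2)" using l1 by (simp add: power_mult_distrib)
    also have "\<dots> \<le> 9 * ((3 / 2 * ln t) * (ln t)\<^sup>2)"
      using l_le by (intro mult_left_mono mult_right_mono) auto
    also have "\<dots> = 27 / 2 * (ln t) ^ 3" by (simp add: power3_eq_cube power2_eq_square)
    also have "\<dots> \<le> 27 / 2 * (8 * z) ^ 3" using lnz lnt by (intro mult_left_mono power_mono) auto
    also have "\<dots> \<le> 7168 * z ^ 3" using z by (simp add: power_mult_distrib)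
    finally have N2: "N\<^sup>2 \<le> 7168 * z ^ 3" .
    have "(sqrt m) ^ 8 = ((sqrt m)\<^sup>2) ^ 4" by (simp flip: power_mult)
    also have "\<dots> = (m\<^sup>2)\<^sup>2" using m by (simp flip: power_mult)
    also have "\<dots> \<le> th\<^sup>2" using th m2 by (intro power_mono) auto
    also have "\<dots> \<le> z ^ 8" using th2 z by simp
    finally have mz: "sqrt m \<le> z" using power_le_imp_le_base[of "sqrt m" 7 z] z(2) by simp
    have z4: "z ^ 4 = sqrt t"
      using z by (intro real_sqrt_unique[symmetric]) (simp_all flip: power_mult)
    have "t * (m ^ 3 * (N * E)\<^sup>2) = (t * m ^ 3 * N\<^sup>2) * E\<^sup>2" by (simp add: power_mult_distrib)
    also have "\<dots> \<le> (t * m ^ 3 * N\<^sup>2) * (1 / (m\<^sup>2 * t))"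
      using E2 m t by (intro mult_left_mono) auto
    also have "\<dots> = m * N\<^sup>2" using m t by (simp add: power3_eq_cube power2_eq_square)
    also have "\<dots> \<le> m * (7168 * z ^ 3)" using N2 m by (intro mult_left_mono) auto
    also have "\<dots> = 7168 * (sqrt m * (sqrt m * z ^ 3))" using m by simp
    also have "\<dots> \<le> 7168 * (sqrt m * (z * z ^ 3))"
      using mz m z by (intro mult_left_mono mult_right_mono) auto
    also have "z * z ^ 3 = sqrt t" unfolding z4[symmetric] by (simp add: eval_nat_numeral)
    also have "sqrt m * sqrt t = sqrt (m * t)" by (simp add: real_sqrt_mult)
    finally show ?thesis using Y1 by linarith
  qed
  have "0 \<le> Y" using Y2 t by (meson order_trans real_sqrt_ge_zero zero_le_one)
  \<comment> \<open>The four contributions 6 + 7168 + 1 + 12 stay below 7200.\<close>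
  then show ?thesis
    using s1 s2 s3 s4 unfolding E_def[symmetric] Y_def[symmetric] distrib_left[of t] by linarith
qed

theorem theorem3p3:
  shows "\<exists>C > 0. \<forall>(S :: setting) (\<nu> :: nat \<Rightarrow> real measure) (\<tau> :: real).
    2 \<le> arms S \<longrightarrow>
    1 \<le> horizon S \<longrightarrow>
    0 < cstar S \<longrightarrow> cstar S < 1 \<longrightarrow>
    (\<forall>t \<ge> 1. cost S t = cstar S) \<longrightarrow>
    (\<forall>t \<ge> 1. tol S t = 1) \<longrightarrow>
    prior S \<in> space (prob_algebra (env_space (arms S))) \<longrightarrow>
    \<nu> \<in> space (env_space (arms S)) \<longrightarrow>
    cstar S < mean \<nu> 1 \<longrightarrow>
    0 < lam S \<longrightarrow> lam S \<le> 3 / 4 * (mean \<nu> 1 - cstar S) \<longrightarrow>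
    0 < \<tau> \<longrightarrow> \<tau> < 1 - cstar S \<longrightarrow>
    0 < theta S \<longrightarrow>
    theta S = 4 * real (arms S) ^ 2 /
      (\<tau> * Min ((\<lambda>i. measure (prior S) {\<nu>' \<in> space (prior S). mean \<nu>' i - cstar S \<ge> \<tau>}) ` {1..arms S})) \<longrightarrow>
    0 < samples S \<longrightarrow>
    real (samples S) \<ge> max (9 / (2 * (lam S)\<^sup>2) * ln (20 * real (arms S) / lam S))
                           ((theta S)\<^sup>2 * ln (real (horizon S) * theta S)) \<longrightarrow>
    regret S \<nu> \<le> expected_sampling_length S \<nu>
      + C * sqrt (real (arms S) * real (horizon S) * ln (real (arms S) * real (horizon S)))"
proof (intro exI[of _ 7200] conjI allI impI)
  fix S :: setting and \<nu> :: "nat \<Rightarrow> real measure" and \<tau> :: real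
  let ?m = "real (arms S)" and ?T = "real (horizon S)" and ?\<theta> = "theta S"
    and ?l = "ln (real (horizon S) * theta S)"
  define P where "P = Min ((\<lambda>i. measure (prior S) {\<nu>' \<in> space (prior S). mean \<nu>' i - cstar S \<ge> \<tau>}) ` {1..arms S})"
  assume m: "2 \<le> arms S" and T: "1 \<le> horizon S" and c: "0 < cstar S" "cstar S < 1"
    and tol: "\<forall>t \<ge> 1. tol S t = 1"
    and prior: "prior S \<in> space (prob_algebra (env_space (arms S)))"
    and \<nu>: "\<nu> \<in> space (env_space (arms S))"
    and mu1: "cstar S < mean \<nu> 1" and lam: "0 < lam S" "lam S \<le> 3 / 4 * (mean \<nu> 1 - cstar S)"
    and \<tau>: "0 < \<tau>" "\<tau> < 1 - cstar S" and th: "0 < ?\<theta>"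
    and th_eq: "?\<theta> = 4 * ?m ^ 2 / (\<tau> * Min ((\<lambda>i. measure (prior S) {\<nu>' \<in> space (prior S). mean \<nu>' i - cstar S \<ge> \<tau>}) ` {1..arms S}))"
    and k0: "0 < samples S"
    and k: "real (samples S) \<ge> max (9 / (2 * (lam S)\<^sup>2) * ln (20 * ?m / lam S)) (?\<theta>\<^sup>2 * ?l)"
  interpret Pr: prob_space "prior S" using prior by (simp add: space_prob_algebra)
  have th_ge: "4 * ?m\<^sup>2 \<le> ?\<theta>"
  proof -
    have "P \<le> measure (prior S) {\<nu>' \<in> space (prior S). mean \<nu>' 1 - cstar S \<ge> \<tau>}"
      unfolding P_def using m by (intro Min_le) auto
    also have "\<dots> \<le> 1" by simp
    finally have P1: "P \<le> 1" .
    have eq: "?\<theta> = 4 * ?m\<^sup>2 / (\<tau> * P)" unfolding P_def by (rule th_eq)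
    \<comment> \<open>Since x / 0 = 0, positivity of \<open>theta S\<close> rules out a vanishing
      denominator.\<close>
    have "0 < \<tau> * P" using th unfolding eq by (simp add: zero_less_divide_iff)
    moreover have "\<tau> * P \<le> 1 * 1" using P1 \<tau> c calculation by (intro mult_mono) (auto simp: zero_less_mult_iff)
    ultimately have "4 * ?m\<^sup>2 * (\<tau> * P) \<le> 4 * ?m\<^sup>2 * 1" by (intro mult_left_mono) auto
    then show ?thesis unfolding eq using \<open>0 < \<tau> * P\<close> by (simp add: pos_le_divide_eq)
  qed
  have m2: "4 \<le> ?m\<^sup>2" using power_mono[of 2 ?m 2] m by simp
  have Tth: "16 \<le> ?T * ?\<theta>" using mult_mono[of 1 ?T 16 ?\<theta>] T th_ge m2 by simp
  have l1: "1 \<le> ?l" using Tth exp_le by (subst ln_ge_iff) auto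
  have "Max (mean \<nu> ` {1..arms S}) \<in> mean \<nu> ` {1..arms S}" using m by (intro Max_in) auto
  then obtain b where b: "b \<in> {1..arms S}" "Max (mean \<nu> ` {1..arms S}) = mean \<nu> b" by auto
  have b_max: "mean \<nu> i \<le> mean \<nu> b" if "i \<in> {1..arms S}" for i
    unfolding b(2)[symmetric] using that by (intro Max_ge) auto
  have b1: "mean \<nu> 1 \<le> mean \<nu> b" using b_max[of 1] m by simp
  have "cstar S < mean \<nu> b" using b1 mu1 by linarith
  then interpret arp_best S \<nu> b
    using prior \<nu> tol k0 m l1 T b(1) b_max by unfold_locales auto
  \<comment> \<open>From \<lambda> \<le> 1 the logarithm in the bound on k is at least 1, so 2 k
    \<lambda>^2 \<ge> 9, more than the 1 required; and \<lambda> is below the margin of arm 1 over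
    the cost, hence below that of b.\<close>
  have g: "1 \<le> (mean \<nu> b - cstar S) * sqrt (2 * real (samples S))"
  proof -
    have "mean \<nu> 1 \<le> 1" using mean_range[of 1] m by simp
    then have "lam S \<le> 1" using lam c by simp
    then have "exp 1 * lam S \<le> 3 * 1" using lam exp_le by (intro mult_mono) auto
    then have "exp 1 \<le> 20 * ?m / lam S"
      using lam m by (simp add: le_divide_eq)
    then have "1 \<le> ln (20 * ?m / lam S)" using lam m by (subst ln_ge_iff) auto
    then have "9 / (2 * (lam S)\<^sup>2) * 1 \<le> 9 / (2 * (lam S)\<^sup>2) * ln (20 * ?m / lam S)"
      by (intro mult_left_mono) auto
    then have "9 / (2 * (lam S)\<^sup>2) \<le> real (samples S)" using k by simp
    then have "9 \<le> (lam S)\<^sup>2 * (2 * real (samples S))" using lam by (simp add: divide_le_eq mult_ac)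
    then have "sqrt 1 \<le> sqrt ((lam S)\<^sup>2 * (2 * real (samples S)))" by (intro real_sqrt_le_mono) linarith
    then have "1 \<le> lam S * sqrt (2 * real (samples S))" using lam by (simp add: real_sqrt_mult)
    also have "\<dots> \<le> (mean \<nu> b - cstar S) * sqrt (2 * real (samples S))"
      using lam b1 mu1 by (intro mult_right_mono) auto
    finally show ?thesis .
  qed
  have mT: "1 \<le> ?m * ?T" using mult_mono[of 1 ?m 1 ?T] m T by simp
  show "regret S \<nu> \<le> expected_sampling_length S \<nu> + 7200 * sqrt (?m * ?T * ln (?m * ?T))"
  proof (cases "horizon S < samples S")
    case True
    then show ?thesis using regret_bound(2)[OF g True] mT by (simp add: add_increasing2)
  next
    case False
    \<comment> \<open>With k \<le> T the lower bound on k becomes an upper bound for theta in terms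
      of T.\<close>
    then have kT: "?\<theta>\<^sup>2 * ?l \<le> ?T" using k by simp
    have N: "real grid_size \<le> sqrt ?l * ln ?T + 2"
    proof -
      have "0 \<le> sqrt ?l * ln ?T" using l1 T by simp
      then show ?thesis unfolding grid_size_def ell_def by linarith
    qed
    have "real (horizon S) * ((2 * ?m + 1) * (2 * exp (1 / 2 - ?l / 2)) + ?m ^ 3 * (real grid_size * exp (1 / 2 - ?l / 2))\<^sup>2
       + ?m\<^sup>2 * exp (- (4 * ?l))) + 8 * sqrt (?m * ?l * ?T) \<le> 7200 * sqrt (?m * ?T * ln (?m * ?T))"
      using m T by (intro rate_numerics[OF _ th_ge _ refl kT _ N]) auto
    then show ?thesis
      using regret_bound(1)[OF g] unfolding p_base_def p_cross_def ell_def by linarith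
  qed
qed simp

end
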